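(* Let $k_1\ge 1$, $k_2\ge 0$ with $2k_1+2k_2>2$, and let $\rho\in\mathbb{Z}$. Then: (1) $B(1,\rho,k_1,k_2)$ is diffeomorphic to $B(1,0,k_1,k_2)=S^2\times S^{2k_1+2k_2}$ if and only if $k_1$ is even or $\rho$ is even; (2) $B(1,\rho,k_1,k_2)$ is diffeomorphic to $B(1,1,k_1,k_2)=S^3\times_{S^1}S(\mathbb{C}_1^{k_1}\oplus\mathbb{R}^{2k_2+1})$, in the remaining case, i.e. this second diffeomorphism type, distinct from that of $S^2\times S^{2k_1+2k_2}$, occurs if and only if $k_1$ and $\rho$ are both odd.
   Context: For $\rho\in\mathbb{Z}$, let $\mathbb{C}_\rho$ be $\mathbb{C}$ with the $S^1$-action $t\cdot z = t^\rho z$, and $\mathbb{C}_\rho^{k}$ the direct sum of $k$ copies; $\mathbb{R}^m$ carries the trivial $S^1$-action. $S^1$ acts on the unit sphere $S^3\subset\mathbb{C}^2$ by scalar multiplication, and $S^3\times_{S^1} F$ is the quotient of $S^3\times F$ by the diagonal action. $S(V)$ is the unit sphere in $V$. Define $B(1,\rho,k_1,k_2)=S^3\times_{S^1}S(\mathbb{C}_\rho^{k_1}\oplus\mathbb{R}^{2k_2+1})$, a sphere bundle over $\mathbb{C}P^1=S^2$ with fibre $S^{2k_1+2k_2}$. *)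

theory Defs
  imports "HOL-Analysis.Analysis"
begin

text \<open>Only used for open \<open>S\<close>: continuity of all iterated directional derivatives up to order
  \<open>n\<close>, each map of the iteration being differentiable.\<close>

primrec Ck_on :: "nat \<Rightarrow> ('a::euclidean_space \<Rightarrow> 'b::euclidean_space) \<Rightarrow> 'a set \<Rightarrow> bool" where
  "Ck_on 0 f S \<longleftrightarrow> continuous_on S f"
| "Ck_on (Suc n) f S \<longleftrightarrow>
     (\<forall>x\<in>S. f differentiable (at x)) \<and>
     (\<forall>v. Ck_on n (\<lambda>x. frechet_derivative f (at x) v) S)"

text \<open>For an arbitrary subset \<open>X\<close>: locally the restriction of a smooth map defined on an open
  subset of the ambient space. For open \<open>X\<close> this is ordinary smoothness.\<close>

definition smooth_on :: "'a::euclidean_space set \<Rightarrow> ('a \<Rightarrow> 'b::euclidean_space) \<Rightarrow> bool" where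
  "smooth_on X f \<longleftrightarrow>
     (\<forall>x\<in>X. \<exists>W g. open W \<and> x \<in> W \<and> (\<forall>n. Ck_on n g W) \<and> (\<forall>y\<in>W \<inter> X. g y = f y))"

text \<open>A chart is a pair \<open>(U, \<phi>)\<close>; the values of \<open>\<phi>\<close> outside \<open>U\<close> are irrelevant. The model space
  \<open>'e\<close> is part of the type, so every manifold below is equidimensional of dimension \<open>DIM('e)\<close>.\<close>

record ('a, 'e) charted_space =
  underlying :: "'a topology"
  atlas :: "('a set \<times> ('a \<Rightarrow> 'e)) set"

definition smooth_manifold :: "('a, 'e::euclidean_space) charted_space \<Rightarrow> bool" where
  "smooth_manifold M \<longleftrightarrow>
     Hausdorff_space (underlying M) \<and>
     second_countable (underlying M) \<and>
     (\<Union>(U, \<phi>)\<in>atlas M. U) = topspace (underlying M) \<and>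
     (\<forall>(U, \<phi>)\<in>atlas M.
        openin (underlying M) U \<and> open (\<phi> ` U) \<and>
        homeomorphic_map (subtopology (underlying M) U) (top_of_set (\<phi> ` U)) \<phi>) \<and>
     (\<forall>(U, \<phi>)\<in>atlas M. \<forall>(V, \<psi>)\<in>atlas M. smooth_on (\<phi> ` (U \<inter> V)) (\<psi> \<circ> inv_into U \<phi>))"

definition smooth_map ::
  "('a, 'd::euclidean_space) charted_space \<Rightarrow> ('b, 'e::euclidean_space) charted_space
    \<Rightarrow> ('a \<Rightarrow> 'b) \<Rightarrow> bool" where
  "smooth_map M N f \<longleftrightarrow>
     continuous_map (underlying M) (underlying N) f \<and>
     (\<forall>(U, \<phi>)\<in>atlas M. \<forall>(V, \<psi>)\<in>atlas N.
        smooth_on (\<phi> ` {x \<in> U. f x \<in> V}) (\<psi> \<circ> f \<circ> inv_into U \<phi>))"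

definition diffeomorphic ::
  "('a, 'd::euclidean_space) charted_space \<Rightarrow> ('b, 'e::euclidean_space) charted_space \<Rightarrow> bool" where
  "diffeomorphic M N \<longleftrightarrow>
     smooth_manifold M \<and> smooth_manifold N \<and>
     (\<exists>f g. smooth_map M N f \<and> smooth_map N M g \<and>
        (\<forall>x\<in>topspace (underlying M). g (f x) = x) \<and>
        (\<forall>y\<in>topspace (underlying N). f (g y) = y))"

text \<open>A subset of a Euclidean space with its maximal atlas as an embedded submanifold: the
  inverses of the charts are the local parametrisations.\<close>

definition embedded :: "'a::euclidean_space set \<Rightarrow> ('a, 'e::euclidean_space) charted_space" where
  "embedded X = \<lparr> underlying = top_of_set X,
     atlas = {(U, \<phi>). openin (top_of_set X) U \<and> inj_on \<phi> U \<and> open (\<phi> ` U) \<and>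
                smooth_on U \<phi> \<and> smooth_on (\<phi> ` U) (inv_into U \<phi>)} \<rparr>"

definition quotient_topology :: "'a topology \<Rightarrow> ('a \<Rightarrow> 'b) \<Rightarrow> 'b topology" where
  "quotient_topology T \<pi> =
     topology (\<lambda>U. U \<subseteq> \<pi> ` topspace T \<and> openin T {x \<in> topspace T. \<pi> x \<in> U})"

lemma openin_quotient_topology:
  "openin (quotient_topology T \<pi>) U \<longleftrightarrow>
     U \<subseteq> \<pi> ` topspace T \<and> openin T {x \<in> topspace T. \<pi> x \<in> U}"
proof -
  have "istopology (\<lambda>U. U \<subseteq> \<pi> ` topspace T \<and> openin T {x \<in> topspace T. \<pi> x \<in> U})"
    unfolding istopology_def
  proof (intro conjI allI impI)
    fix S U
    assume "S \<subseteq> \<pi> ` topspace T \<and> openin T {x \<in> topspace T. \<pi> x \<in> S}"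
      and "U \<subseteq> \<pi> ` topspace T \<and> openin T {x \<in> topspace T. \<pi> x \<in> U}"
    moreover have "{x \<in> topspace T. \<pi> x \<in> S \<inter> U} =
        {x \<in> topspace T. \<pi> x \<in> S} \<inter> {x \<in> topspace T. \<pi> x \<in> U}" by auto
    ultimately show "S \<inter> U \<subseteq> \<pi> ` topspace T" "openin T {x \<in> topspace T. \<pi> x \<in> S \<inter> U}"
      by auto
  next
    fix K
    assume K: "\<forall>S\<in>K. S \<subseteq> \<pi> ` topspace T \<and> openin T {x \<in> topspace T. \<pi> x \<in> S}"
    then show "\<Union>K \<subseteq> \<pi> ` topspace T" by blast
    have "{x \<in> topspace T. \<pi> x \<in> \<Union>K} = \<Union>((\<lambda>S. {x \<in> topspace T. \<pi> x \<in> S}) ` K)" by blast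
    with K show "openin T {x \<in> topspace T. \<pi> x \<in> \<Union>K}" by auto
  qed
  then show ?thesis by (simp add: quotient_topology_def)
qed

lemma topspace_quotient_topology: "topspace (quotient_topology T \<pi>) = \<pi> ` topspace T"
proof
  show "topspace (quotient_topology T \<pi>) \<subseteq> \<pi> ` topspace T"
    using openin_topspace[of "quotient_topology T \<pi>"] by (simp only: openin_quotient_topology)
  have "{x \<in> topspace T. \<pi> x \<in> \<pi> ` topspace T} = topspace T" by blast
  then have "openin (quotient_topology T \<pi>) (\<pi> ` topspace T)"
    by (simp add: openin_quotient_topology)
  then show "\<pi> ` topspace T \<subseteq> topspace (quotient_topology T \<pi>)" by (rule openin_subset)
qed

text \<open>The quotient topology with the unique smooth structure making \<open>\<pi>\<close> a smooth submersion,
  given by its maximal atlas: the charts \<open>(V, \<psi>)\<close> in which every coordinate representation of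
  \<open>\<pi>\<close> is smooth with everywhere surjective derivative. (For the orbit map of a free action of a
  compact Lie group such a structure exists; this is the quotient manifold theorem.)\<close>

definition quotient_manifold ::
  "('a, 'd::euclidean_space) charted_space \<Rightarrow> ('a \<Rightarrow> 'b) \<Rightarrow> ('b, 'e::euclidean_space) charted_space"
  where
  "quotient_manifold M \<pi> = \<lparr> underlying = quotient_topology (underlying M) \<pi>,
     atlas = {(V, \<psi>). openin (quotient_topology (underlying M) \<pi>) V \<and>
                inj_on \<psi> V \<and> open (\<psi> ` V) \<and>
                (\<forall>(U, \<phi>)\<in>atlas M.
                   smooth_on (\<phi> ` {x \<in> U. \<pi> x \<in> V}) (\<psi> \<circ> \<pi> \<circ> inv_into U \<phi>) \<and>
                   (\<forall>y \<in> \<phi> ` {x \<in> U. \<pi> x \<in> V}.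
                      surj (frechet_derivative (\<psi> \<circ> \<pi> \<circ> inv_into U \<phi>) (at y))))} \<rparr>"

text \<open>\<open>\<complex>\<^sub>\<rho>\<^bsup>k\<^esup> \<oplus> \<real>\<^bsup>m\<^esup>\<close> is \<open>(complex ^ 'k) \<times> (real ^ 'm)\<close> with \<open>k = CARD('k)\<close> and \<open>m = CARD('m)\<close>.\<close>

definition circle_action ::
  "int \<Rightarrow> complex \<Rightarrow> (complex ^ 2) \<times> (complex ^ 'k) \<times> (real ^ 'm)
    \<Rightarrow> (complex ^ 2) \<times> (complex ^ 'k) \<times> (real ^ 'm)" where
  "circle_action \<rho> t = (\<lambda>(z, w, x). (t *s z, (t powi \<rho>) *s w, x))"

definition circle_orbit ::
  "int \<Rightarrow> (complex ^ 2) \<times> (complex ^ 'k) \<times> (real ^ 'm)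
    \<Rightarrow> ((complex ^ 2) \<times> (complex ^ 'k) \<times> (real ^ 'm)) set" where
  "circle_orbit \<rho> p = {circle_action \<rho> t p | t. cmod t = 1}"

text \<open>With \<open>k = CARD('k)\<close> and \<open>m = CARD('m)\<close>, \<open>S\<^sup>3 \<times> S(\<complex>\<^bsup>k\<^esup> \<oplus> \<real>\<^bsup>m\<^esup>)\<close> has dimension
  \<open>2k + m + 2\<close>, which is \<open>CARD('k + 'k + 'm + 2)\<close>, and its quotient has dimension
  \<open>CARD('k + 'k + 'm + 1)\<close>.\<close>

definition total_space ::
  "((complex ^ 2) \<times> (complex ^ 'k::finite) \<times> (real ^ 'm::finite), real ^ ('k + 'k + 'm + 2)) charted_space" where
  "total_space = embedded (sphere 0 1 \<times> sphere 0 1)"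

text \<open>\<open>B(1,\<rho>,k\<^sub>1,k\<^sub>2)\<close>, for \<open>k\<^sub>1 = CARD('k)\<close> and \<open>2k\<^sub>2 + 1 = CARD('m)\<close>.\<close>

definition sphere_bundle ::
  "'k::finite itself \<Rightarrow> 'm::finite itself \<Rightarrow> int \<Rightarrow>
     (((complex ^ 2) \<times> (complex ^ 'k) \<times> (real ^ 'm)) set, real ^ ('k + 'k + 'm + 1)) charted_space"
  where
  "sphere_bundle _ _ \<rho> = quotient_manifold total_space (circle_orbit \<rho>)"

text \<open>\<open>S\<^sup>2 \<times> S\<^bsup>n\<^esup>\<close> for \<open>n + 1 = CARD('n)\<close>, a manifold of dimension \<open>n + 2 = CARD('n + 1)\<close>.\<close>

definition S2_times_sphere ::
  "'n::finite itself \<Rightarrow> ((real ^ 3) \<times> (real ^ 'n), real ^ ('n + 1)) charted_space" where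
  "S2_times_sphere _ = embedded (sphere 0 1 \<times> sphere 0 1)"

end

theory Submission
  imports Defs
begin

text \<open>The bundle \<open>B(1,\<rho>,k\<^sub>1,k\<^sub>2)\<close> is the sphere bundle of the sum of \<open>k\<^sub>1\<close> copies of a complex line bundle
  \<open>O(\<rho>)\<close> over the projective line and a trivial real bundle. Since \<open>O(a) \<oplus> O(b)\<close> is isomorphic to
  \<open>O(a + b) \<oplus> O(0)\<close>, and \<open>O(2 s) \<oplus> \<real>\<close> is trivial (for \<open>s = 1\<close> it is the stabilised tangent bundle of
  \<open>S\<^sup>2\<close>), by explicit isometries depending smoothly on \<open>z \<in> \<complex>\<^sup>2 - {0}\<close>, only the parity of \<open>k\<^sub>1 \<rho>\<close> matters.

  If this parity is odd, a diffeomorphism to \<open>S\<^sup>2 \<times> S\<^sup>n\<close>, which is stably parallelisable, would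
  stably trivialise the tangent bundle along the section of poles of the fibres. By the same
  isomorphisms this means that \<open>O(1)\<close> plus a trivial bundle is trivial, that is, there is a frame over
  \<open>S\<^sup>3\<close> consisting of a pair of vectors rotated by the circle and of invariant vectors. An invariant
  vector misses a direction for dimension reasons, so it can be split off as long as the dimension is
  at least 4. What remains is an equivariant pair in \<open>\<real>\<^sup>3\<close>, hence a map from \<open>S\<^sup>3\<close> to the cone of
  isotropic vectors of \<open>\<complex>\<^sup>3\<close>. It lifts to the double cover of the cone because \<open>S\<^sup>3\<close> is simply connected,
  but along a circle orbit the lift changes sign.\<close>

section \<open>Smooth maps\<close>

text \<open>Vector bundles over the projective line are never constructed. Such a bundle is a circle
  action on a fixed vector space, and an isomorphism is an equivariant family of linear maps over
  the punctured plane C^2 - {0}. That set is open, unlike the 3-sphere, so ordinary Frechet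
  derivatives are available. The bound 2 k1 + 2 k2 > 2 enters through a spare invariant summand C +
  R next to the weighted line. A weight difference 2 s is moved into the spare line and cancelled
  there: O(a) + O(0) + R = O(c) + O(a - c) + R = O(c) + O(0) + R whenever a - c = 2 s. In the odd
  case, the tangent bundle along the section of poles is O(2) plus k1 copies of O(rho) plus a
  trivial part, where O(2) comes from the base. The even summand disappears after adding a line, the
  copies of O(rho) reduce to O(1), and the class that survives is the second Stiefel-Whitney class.
  The covering argument at the end is its hands-on replacement.\<close>

lemma Ck_on_cong:
  assumes "open S" "\<And>x. x \<in> S \<Longrightarrow> f x = g x"
  shows "Ck_on n f S \<longleftrightarrow> Ck_on n g S"
  using assms(2)
proof (induction n arbitrary: f g)
  case 0
  then show ?case by (metis Ck_on.simps(1) continuous_on_cong)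
next
  case (Suc n)
  have hd: "(f has_derivative f') (at x) \<longleftrightarrow> (g has_derivative f') (at x)" if "x \<in> S" for x f'
    using has_derivative_transform_within_open[OF _ assms(1) that, of f f' UNIV g]
      has_derivative_transform_within_open[OF _ assms(1) that, of g f' UNIV f] Suc.prems by metis
  have "frechet_derivative f (at x) = frechet_derivative g (at x)" if "x \<in> S" for x
    unfolding frechet_derivative_def using hd[OF that] by simp
  then show ?case
    using Suc.IH[of "\<lambda>x. frechet_derivative f (at x) v" "\<lambda>x. frechet_derivative g (at x) v" for v]
    by (auto simp: differentiable_def hd)
qed

lemma Ck_on_subset:
  assumes "Ck_on n f S" "T \<subseteq> S"
  shows "Ck_on n f T"
  using assms
proof (induction n arbitrary: f)
  case 0
  then show ?case by (auto intro: continuous_on_subset)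
next
  case (Suc n)
  then show ?case by auto
qed

lemma Ck_on_Union:
  assumes "\<And>x. x \<in> S \<Longrightarrow> \<exists>W. open W \<and> x \<in> W \<and> Ck_on n f W"
  shows "Ck_on n f S"
  using assms
proof (induction n arbitrary: f)
  case 0
  then show ?case
    by (force intro!: continuous_at_imp_continuous_on simp: continuous_on_eq_continuous_at)
next
  case (Suc n)
  from Suc.prems have "f differentiable (at x)" if "x \<in> S" for x
    using that by fastforce
  moreover have "Ck_on n (\<lambda>x. frechet_derivative f (at x) v) S" for v
    by (rule Suc.IH) (use Suc.prems in force)
  ultimately show ?case by simp
qed

text \<open>Lets an explicit formula stand in for the abstractly chosen
  \<open>frechet_derivative\<close>.\<close>

lemma Ck_on_SucI:
  assumes "open S" "\<And>x. x \<in> S \<Longrightarrow> (f has_derivative f' x) (at x)" "\<And>v. Ck_on n (\<lambda>x. f' x v) S"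
  shows "Ck_on (Suc n) f S"
proof -
  have "frechet_derivative f (at x) = f' x" if "x \<in> S" for x
    using assms(2)[OF that] frechet_derivative_at by metis
  then have "Ck_on n (\<lambda>x. frechet_derivative f (at x) v) S" for v
    using assms(1,3) by (subst Ck_on_cong[where g = "\<lambda>x. f' x v"]) auto
  then show ?thesis using assms(2) by (auto simp: differentiable_def)
qed

lemma Ck_on_Suc_has_derivative:
  assumes "Ck_on (Suc n) f S" "x \<in> S"
  shows "(f has_derivative frechet_derivative f (at x)) (at x)"
  using assms by (simp add: frechet_derivative_works[symmetric])

lemma Ck_on_Suc_imp_continuous_on: "Ck_on (Suc n) f S \<Longrightarrow> continuous_on S f"
  by (auto intro!: continuous_at_imp_continuous_on differentiable_imp_continuous_within)

lemma Ck_on_Suc_imp_Ck_on: "Ck_on (Suc n) f S \<Longrightarrow> Ck_on n f S"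
proof (induction n arbitrary: f)
  case 0
  then show ?case using Ck_on_Suc_imp_continuous_on by (metis Ck_on.simps(1))
next
  case (Suc n)
  then show ?case by (metis Ck_on.simps(2))
qed

lemma Ck_on_imp_continuous_on: "Ck_on n f S \<Longrightarrow> continuous_on S f"
  by (cases n) (use Ck_on_Suc_imp_continuous_on in auto)

lemma Ck_on_const: "open S \<Longrightarrow> Ck_on n (\<lambda>x. c) S"
proof (induction n arbitrary: c)
  case (Suc n)
  show ?case by (rule Ck_on_SucI[where f' = "\<lambda>x v. 0"]) (use Suc in auto)
qed auto

lemma Ck_on_bounded_linear: "bounded_linear f \<Longrightarrow> open S \<Longrightarrow> Ck_on n f S"
proof (cases n)
  case (Suc m)
  assume "bounded_linear f" "open S"
  then show ?thesis unfolding Suc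
    by (intro Ck_on_SucI[where f' = "\<lambda>x. f"] Ck_on_const) (auto intro: bounded_linear_imp_has_derivative)
qed (auto intro: linear_continuous_on)

lemma Ck_on_bounded_linear_compose:
  assumes "bounded_linear L" "open S" "Ck_on n f S"
  shows "Ck_on n (\<lambda>x. L (f x)) S"
  using assms(3)
proof (induction n arbitrary: f)
  case 0
  then show ?case using assms(1) by (auto intro: bounded_linear.continuous_on)
next
  case (Suc n)
  show ?case
  proof (rule Ck_on_SucI[OF \<open>open S\<close>])
    show "((\<lambda>x. L (f x)) has_derivative (\<lambda>v. L (frechet_derivative f (at x) v))) (at x)" if "x \<in> S" for x
      using bounded_linear.has_derivative[OF assms(1) Ck_on_Suc_has_derivative[OF Suc.prems that]] .
  qed (use Suc in auto)
qed

lemma Ck_on_add: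
  assumes "open S" "Ck_on n f S" "Ck_on n g S"
  shows "Ck_on n (\<lambda>x. f x + g x) S"
  using assms(2,3)
proof (induction n arbitrary: f g)
  case 0
  then show ?case by (auto intro: continuous_intros)
next
  case (Suc n)
  show ?case
    by (rule Ck_on_SucI[OF \<open>open S\<close> has_derivative_add[OF Ck_on_Suc_has_derivative Ck_on_Suc_has_derivative]])
      (use Suc in auto)
qed

lemma Ck_on_sum:
  assumes "open S" "\<And>i. i \<in> I \<Longrightarrow> Ck_on n (f i) S"
  shows "Ck_on n (\<lambda>x. \<Sum>i\<in>I. f i x) S"
  using assms(2)
  by (induction I rule: infinite_finite_induct) (auto intro!: Ck_on_add Ck_on_const \<open>open S\<close>)

lemma Ck_on_bilinear:
  assumes "bounded_bilinear B" "open S" "Ck_on n f S" "Ck_on n g S"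
  shows "Ck_on n (\<lambda>x. B (f x) (g x)) S"
  using assms(3,4)
proof (induction n arbitrary: f g)
  case 0
  then show ?case using assms(1) by (auto intro: bounded_bilinear.continuous_on)
next
  case (Suc n)
  show ?case
  proof (rule Ck_on_SucI[OF \<open>open S\<close> bounded_bilinear.FDERIV[OF assms(1) Ck_on_Suc_has_derivative Ck_on_Suc_has_derivative]])
    fix v
    show "Ck_on n (\<lambda>x. B (f x) (frechet_derivative g (at x) v) + B (frechet_derivative f (at x) v) (g x)) S"
      using Suc Ck_on_Suc_imp_Ck_on[OF Suc.prems(1)] Ck_on_Suc_imp_Ck_on[OF Suc.prems(2)]
      by (intro Ck_on_add Suc.IH \<open>open S\<close>) auto
  qed (use Suc in auto)
qed

lemma Ck_on_compose:
  assumes "open S" "open T" "Ck_on n f S" "Ck_on n g T" "f ` S \<subseteq> T"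
  shows "Ck_on n (\<lambda>x. g (f x)) S"
  using assms(3-5)
proof (induction n arbitrary: f g)
  case 0
  then show ?case by (auto intro: continuous_on_compose2)
next
  case (Suc n)
  let ?f' = "\<lambda>x. frechet_derivative f (at x)" and ?g' = "\<lambda>y. frechet_derivative g (at y)"
  have lin: "linear (?g' (f x))" if "x \<in> S" for x
    using Suc.prems that by (auto intro!: linear_frechet_derivative)
  \<comment> \<open>\<open>Ck_on\<close> controls derivatives in a fixed direction only, but here
    the direction \<open>?f' x v\<close> moves with \<open>x\<close>. Expanding it in
    \<open>Basis\<close> leaves fixed directions with smooth coefficients.\<close>
  have eq: "(\<Sum>b\<in>Basis. (?f' x v \<bullet> b) *\<^sub>R ?g' (f x) b) = ?g' (f x) (?f' x v)" if "x \<in> S" for x v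
    using linear_sum[OF lin[OF that], of "\<lambda>b. (?f' x v \<bullet> b) *\<^sub>R b" Basis] linear_cmul[OF lin[OF that]]
    by (simp add: euclidean_representation)
  show ?case
  proof (rule Ck_on_SucI[OF \<open>open S\<close>])
    fix x assume x: "x \<in> S"
    then have "(f has_derivative ?f' x) (at x)" "(g has_derivative ?g' (f x)) (at (f x))"
      using Suc.prems by (auto intro!: Ck_on_Suc_has_derivative)
    from has_derivative_compose[OF this]
    show "((\<lambda>x. g (f x)) has_derivative (\<lambda>v. ?g' (f x) (?f' x v))) (at x)" .
  next
    fix v
    have "Ck_on n (\<lambda>x. \<Sum>b\<in>Basis. (?f' x v \<bullet> b) *\<^sub>R ?g' (f x) b) S"
    proof (intro Ck_on_sum \<open>open S\<close> Ck_on_bilinear[OF bounded_bilinear_scaleR]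
        Ck_on_bounded_linear_compose[OF bounded_linear_inner_left])
      show "Ck_on n (\<lambda>x. ?f' x v) S" using Suc.prems by simp
      fix b :: 'b
      show "Ck_on n (\<lambda>x. ?g' (f x) b) S"
        using Suc.prems Ck_on_Suc_imp_Ck_on[OF Suc.prems(1)] Suc.IH[of f "\<lambda>y. ?g' y b"] by auto
    qed
    moreover have "Ck_on n (\<lambda>x. \<Sum>b\<in>Basis. (?f' x v \<bullet> b) *\<^sub>R ?g' (f x) b) S
        = Ck_on n (\<lambda>x. ?g' (f x) (?f' x v)) S"
      by (rule Ck_on_cong[OF \<open>open S\<close> eq])
    ultimately show "Ck_on n (\<lambda>x. ?g' (f x) (?f' x v)) S" by simp
  qed
qed

text \<open>The derivative is a product of copies of \<open>inverse\<close> itself, so the induction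
  on the order closes.\<close>

lemma Ck_on_inverse:
  "Ck_on n (inverse :: 'a::{real_normed_field,euclidean_space} \<Rightarrow> 'a) (- {0})"
proof (induction n)
  case 0
  show ?case by (auto intro: continuous_intros)
next
  case (Suc n)
  show ?case
    by (rule Ck_on_SucI[where f' = "\<lambda>x v. - (inverse x * v * inverse x)"])
      (auto intro!: has_derivative_inverse' Ck_on_bilinear[OF bounded_bilinear_mult] Ck_on_const
        Ck_on_bounded_linear_compose[OF bounded_linear_minus[OF bounded_linear_ident]] Suc)
qed

lemma Ck_on_sqrt: "Ck_on n sqrt {0<..}"
proof (induction n)
  case 0
  show ?case by (auto intro: continuous_intros)
next
  case (Suc n)
  have "Ck_on n (\<lambda>x. inverse (sqrt x)) {0<..}"
    by (rule Ck_on_compose[OF _ _ Suc Ck_on_inverse]) auto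
  moreover have "((\<lambda>x. sqrt x) has_derivative (\<lambda>v. v *\<^sub>R (inverse 2 *\<^sub>R inverse (sqrt x)))) (at x)" if "x > 0" for x
    by (rule has_derivative_eq_rhs[OF DERIV_real_sqrt[OF that, unfolded has_field_derivative_def]])
      (simp add: fun_eq_iff)
  ultimately show ?case
    by (intro Ck_on_SucI[where f' = "\<lambda>x v. v *\<^sub>R (inverse 2 *\<^sub>R inverse (sqrt x))"]
        Ck_on_bounded_linear_compose[OF bounded_linear_scaleR_right]) auto
qed

declare Ck_on.simps [simp del]

section \<open>Smoothness on arbitrary subsets of Euclidean space\<close>

lemma smooth_on_open:
  assumes "open S"
  shows "smooth_on S f \<longleftrightarrow> (\<forall>n. Ck_on n f S)"
proof
  assume f: "smooth_on S f"
  show "\<forall>n. Ck_on n f S"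
  proof (intro allI Ck_on_Union)
    fix n x assume "x \<in> S"
    then obtain W g where W: "open W" "x \<in> W" "\<And>n. Ck_on n g W" "\<forall>y\<in>W \<inter> S. g y = f y"
      using f unfolding smooth_on_def by meson
    have "Ck_on n g (W \<inter> S)" using Ck_on_subset[OF W(3)] by blast
    moreover have "Ck_on n g (W \<inter> S) = Ck_on n f (W \<inter> S)"
      by (rule Ck_on_cong) (use W(1,4) assms in auto)
    ultimately have "Ck_on n f (W \<inter> S)" by simp
    then show "\<exists>W. open W \<and> x \<in> W \<and> Ck_on n f W" using W \<open>x \<in> S\<close> assms by (meson IntI open_Int)
  qed
next
  show "\<forall>n. Ck_on n f S \<Longrightarrow> smooth_on S f" unfolding smooth_on_def using assms by blast
qed

lemma smooth_on_subset: "smooth_on S f \<Longrightarrow> T \<subseteq> S \<Longrightarrow> smooth_on T f"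
  unfolding smooth_on_def by (meson Int_mono order_refl subsetD)

lemma smooth_on_cong:
  assumes "\<And>x. x \<in> S \<Longrightarrow> f x = g x"
  shows "smooth_on S f \<longleftrightarrow> smooth_on S g"
proof -
  have "(\<forall>y\<in>W \<inter> S. h y = f y) = (\<forall>y\<in>W \<inter> S. h y = g y)" for W h using assms by auto
  then show ?thesis unfolding smooth_on_def by presburger
qed

lemma smooth_on_local:
  assumes "\<And>x. x \<in> S \<Longrightarrow> \<exists>U. openin (top_of_set S) U \<and> x \<in> U \<and> smooth_on U f"
  shows "smooth_on S f"
  unfolding smooth_on_def
proof
  fix x assume "x \<in> S"
  then obtain V where V: "open V" "x \<in> V" "smooth_on (S \<inter> V) f"
    using assms[of x] unfolding openin_open by auto
  then obtain W g where "open W" "x \<in> W" "\<And>n. Ck_on n g W" "\<forall>y\<in>W \<inter> (S \<inter> V). g y = f y"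
    using \<open>x \<in> S\<close> unfolding smooth_on_def by (meson IntI)
  then show "\<exists>W g. open W \<and> x \<in> W \<and> (\<forall>n. Ck_on n g W) \<and> (\<forall>y\<in>W \<inter> S. g y = f y)"
    using V by (intro exI[of _ "W \<inter> V"] exI[of _ g]) (auto intro: Ck_on_subset)
qed

lemma smooth_on_imp_continuous_on:
  assumes "smooth_on S f" shows "continuous_on S f"
  unfolding continuous_on_eq_continuous_within
proof
  fix x assume x: "x \<in> S"
  then obtain W g where W: "open W" "x \<in> W" "\<And>n. Ck_on n g W" "\<forall>y\<in>W \<inter> S. g y = f y"
    using assms unfolding smooth_on_def by meson
  then have "continuous (at x within S) g"
    using Ck_on_imp_continuous_on continuous_on_eq_continuous_at continuous_at_imp_continuous_at_within
    by metis
  moreover have "\<forall>\<^sub>F y in at x within S. g y = f y"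
    using W by (auto simp: eventually_at_topological)
  ultimately show "continuous (at x within S) f"
    using W x by (auto simp: continuous_within intro: tendsto_cong[THEN iffD1])
qed

lemma smooth_on_compose:
  assumes f: "smooth_on S f" and g: "smooth_on T g" and "f ` S \<subseteq> T"
  shows "smooth_on S (\<lambda>x. g (f x))"
  unfolding smooth_on_def
proof
  fix x assume x: "x \<in> S"
  then obtain U f1 where U: "open U" "x \<in> U" "\<And>n. Ck_on n f1 U" "\<forall>y\<in>U \<inter> S. f1 y = f y"
    using f unfolding smooth_on_def by meson
  have "f x \<in> T" using x assms(3) by auto
  then obtain V g1 where V: "open V" "f x \<in> V" "\<And>n. Ck_on n g1 V" "\<forall>y\<in>V \<inter> T. g1 y = g y"
    using g unfolding smooth_on_def by meson
  \<comment> \<open>Off \<open>S\<close> the local extension \<open>f1\<close> may leave the domain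
    of \<open>g1\<close>, so its own domain is cut down.\<close>
  define W where "W = U \<inter> f1 -` V"
  have oW: "open W" unfolding W_def
    by (rule continuous_open_preimage[OF Ck_on_imp_continuous_on[OF U(3)[of 0]] U(1) V(1)])
  show "\<exists>W g'. open W \<and> x \<in> W \<and> (\<forall>n. Ck_on n g' W) \<and> (\<forall>y\<in>W \<inter> S. g' y = g (f y))"
  proof (intro exI[of _ W] exI[of _ "\<lambda>y. g1 (f1 y)"] conjI allI ballI)
    show "x \<in> W" using U V x by (auto simp: W_def)
    show "Ck_on n (\<lambda>y. g1 (f1 y)) W" for n
      by (rule Ck_on_compose[OF oW V(1) Ck_on_subset[OF U(3)] V(3)]) (auto simp: W_def)
    show "g1 (f1 y) = g (f y)" if "y \<in> W \<inter> S" for y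
    proof -
      have "f1 y = f y" "f1 y \<in> V" using that U by (auto simp: W_def)
        then show ?thesis using that V(4) assms(3) by auto
    qed
  qed (rule oW)
qed

lemma smooth_on_compose_open:
  assumes "smooth_on S f" "open T" "\<And>n. Ck_on n g T" "\<And>x. x \<in> S \<Longrightarrow> f x \<in> T"
  shows "smooth_on S (\<lambda>x. g (f x))"
  using assms by (intro smooth_on_compose[of S f T g]) (auto simp: smooth_on_open)

named_theorems smooth_intros

lemma smooth_on_const [smooth_intros]: "smooth_on S (\<lambda>x. c)"
  by (rule smooth_on_subset[of UNIV]) (auto simp: smooth_on_open intro: Ck_on_const)

lemma smooth_on_ident [smooth_intros]: "smooth_on S (\<lambda>x. x)"
  by (rule smooth_on_subset[of UNIV]) (auto simp: smooth_on_open intro: Ck_on_bounded_linear)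

lemma smooth_on_bounded_linear: "bounded_linear L \<Longrightarrow> smooth_on S f \<Longrightarrow> smooth_on S (\<lambda>x. L (f x))"
  by (rule smooth_on_compose_open[of _ _ UNIV]) (auto intro: Ck_on_bounded_linear)

lemmas smooth_on_linear = smooth_on_bounded_linear[OF linear_conv_bounded_linear[THEN iffD1]]

lemma smooth_on_Pair [smooth_intros]:
  assumes "smooth_on S f" "smooth_on S g"
  shows "smooth_on S (\<lambda>x. (f x, g x))"
  unfolding smooth_on_def
proof
  fix x assume x: "x \<in> S"
  obtain U f1 where U: "open U" "x \<in> U" "\<And>n. Ck_on n f1 U" "\<forall>y\<in>U \<inter> S. f1 y = f y"
    using assms(1) x unfolding smooth_on_def by meson
  obtain V g1 where V: "open V" "x \<in> V" "\<And>n. Ck_on n g1 V" "\<forall>y\<in>V \<inter> S. g1 y = g y"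
    using assms(2) x unfolding smooth_on_def by meson
  \<comment> \<open>The pair is written as a sum of two linear embeddings, which reduces pairing to
    sums and linear maps.\<close>
  have "Ck_on n (\<lambda>y. (f1 y, 0) + (0, g1 y)) (U \<inter> V)" for n
    using U V
    by (intro Ck_on_add Ck_on_bounded_linear_compose[of "\<lambda>x. (x, 0)"] Ck_on_bounded_linear_compose[of "\<lambda>x. (0, x)"]
        bounded_linear_Pair bounded_linear_ident bounded_linear_zero open_Int
        Ck_on_subset[OF U(3)] Ck_on_subset[OF V(3)]) auto
  then show "\<exists>W h. open W \<and> x \<in> W \<and> (\<forall>n. Ck_on n h W) \<and> (\<forall>y\<in>W \<inter> S. h y = (f y, g y))"
    using U V by (intro exI[of _ "U \<inter> V"] exI[of _ "\<lambda>y. (f1 y, g1 y)"]) auto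
qed

lemma Ck_on_bilinear_pair:
  assumes "bounded_bilinear B" shows "Ck_on n (\<lambda>p. B (fst p) (snd p)) UNIV"
  by (intro Ck_on_bilinear[OF assms] Ck_on_bounded_linear bounded_linear_fst bounded_linear_snd open_UNIV)

lemma smooth_on_bilinear:
  assumes "bounded_bilinear B" "smooth_on S f" "smooth_on S g"
  shows "smooth_on S (\<lambda>x. B (f x) (g x))"
  using smooth_on_compose_open[OF smooth_on_Pair[OF assms(2,3)] open_UNIV Ck_on_bilinear_pair[OF assms(1)]]
  by simp

lemmas smooth_on_scaleR [smooth_intros] = smooth_on_bilinear[OF bounded_bilinear_scaleR]
lemmas smooth_on_mult [smooth_intros] =
  smooth_on_bilinear[OF bounded_bilinear_mult[where 'a = "'a::{real_normed_algebra,euclidean_space}"]]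
lemmas smooth_on_inner [smooth_intros] = smooth_on_bilinear[OF bounded_bilinear_inner]
lemmas smooth_on_fst [smooth_intros] = smooth_on_bounded_linear[OF bounded_linear_fst]
lemmas smooth_on_snd [smooth_intros] = smooth_on_bounded_linear[OF bounded_linear_snd]
lemmas smooth_on_cnj [smooth_intros] = smooth_on_bounded_linear[OF bounded_linear_cnj]
lemmas smooth_on_Re [smooth_intros] = smooth_on_bounded_linear[OF bounded_linear_Re]
lemmas smooth_on_Im [smooth_intros] = smooth_on_bounded_linear[OF bounded_linear_Im]
lemmas smooth_on_minus [smooth_intros] = smooth_on_bounded_linear[OF bounded_linear_minus[OF bounded_linear_ident]]
lemmas smooth_on_vec_nth [smooth_intros] = smooth_on_bounded_linear[OF bounded_linear_vec_nth]
lemmas smooth_on_of_real [smooth_intros] =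
  smooth_on_bounded_linear[OF bounded_linear_of_real[where 'a = "'a::{real_normed_algebra_1,euclidean_space}"]]

lemma smooth_on_add [smooth_intros]:
  assumes "smooth_on S f" "smooth_on S g" shows "smooth_on S (\<lambda>x. f x + g x)"
  using smooth_on_bounded_linear[OF bounded_linear_add[OF bounded_linear_fst bounded_linear_snd] smooth_on_Pair[OF assms]]
  by simp

lemma smooth_on_diff [smooth_intros]:
  "smooth_on S f \<Longrightarrow> smooth_on S g \<Longrightarrow> smooth_on S (\<lambda>x. f x - g x)"
  using smooth_on_add[OF _ smooth_on_minus[of S g], of f] by simp

lemma smooth_on_sum [smooth_intros]:
  "(\<And>i. i \<in> I \<Longrightarrow> smooth_on S (f i)) \<Longrightarrow> smooth_on S (\<lambda>x. \<Sum>i\<in>I. f i x)"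
  by (induction I rule: infinite_finite_induct) (auto intro!: smooth_intros)

lemma smooth_on_prod [smooth_intros]:
  fixes f :: "_ \<Rightarrow> _ \<Rightarrow> 'b::{real_normed_field,euclidean_space}"
  shows "(\<And>i. i \<in> I \<Longrightarrow> smooth_on S (f i)) \<Longrightarrow> smooth_on S (\<lambda>x. \<Prod>i\<in>I. f i x)"
  by (induction I rule: infinite_finite_induct) (auto intro!: smooth_intros)

lemma smooth_on_power [smooth_intros]:
  fixes f :: "_ \<Rightarrow> 'b::{real_normed_field,euclidean_space}"
  shows "smooth_on S f \<Longrightarrow> smooth_on S (\<lambda>x. f x ^ n)"
  by (induction n) (auto intro!: smooth_intros)

lemma smooth_on_inverse [smooth_intros]:
  fixes f :: "_ \<Rightarrow> 'b::{real_normed_field,euclidean_space}"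
  assumes "smooth_on S f" "\<And>x. x \<in> S \<Longrightarrow> f x \<noteq> 0"
  shows "smooth_on S (\<lambda>x. inverse (f x))"
  by (rule smooth_on_compose_open[OF assms(1) _ Ck_on_inverse]) (use assms(2) in auto)

lemma smooth_on_divide [smooth_intros]:
  fixes f :: "_ \<Rightarrow> 'b::{real_normed_field,euclidean_space}"
  assumes "smooth_on S f" "smooth_on S g" "\<And>x. x \<in> S \<Longrightarrow> g x \<noteq> 0"
  shows "smooth_on S (\<lambda>x. f x / g x)"
  unfolding divide_inverse by (intro smooth_intros assms)

lemma smooth_on_sqrt [smooth_intros]:
  assumes "smooth_on S f" "\<And>x. x \<in> S \<Longrightarrow> f x > 0"
  shows "smooth_on S (\<lambda>x. sqrt (f x))"
  by (rule smooth_on_compose_open[OF assms(1) _ Ck_on_sqrt]) (use assms(2) in auto)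

lemma smooth_on_norm [smooth_intros]:
  assumes "smooth_on S f" "\<And>x. x \<in> S \<Longrightarrow> f x \<noteq> 0"
  shows "smooth_on S (\<lambda>x. norm (f x))"
  unfolding norm_eq_sqrt_inner by (intro smooth_intros assms) (use assms in auto)

lemma smooth_on_sgn [smooth_intros]:
  assumes "smooth_on S f" "\<And>x. x \<in> S \<Longrightarrow> f x \<noteq> 0"
  shows "smooth_on S (\<lambda>x. sgn (f x))"
  unfolding sgn_div_norm by (intro smooth_intros assms) (use assms in auto)

lemma smooth_on_componentwise:
  assumes "\<And>b. b \<in> Basis \<Longrightarrow> smooth_on S (\<lambda>x. f x \<bullet> b)"
  shows "smooth_on S f"
proof -
  have "smooth_on S (\<lambda>x. \<Sum>b\<in>Basis. (f x \<bullet> b) *\<^sub>R b)" by (intro smooth_intros assms)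
  then show ?thesis by (simp add: euclidean_representation)
qed

lemma smooth_on_vec_lambda [smooth_intros]:
  fixes f :: "_ \<Rightarrow> 'n::finite \<Rightarrow> 'b::euclidean_space"
  assumes "\<And>i. smooth_on S (\<lambda>x. f x i)"
  shows "smooth_on S (\<lambda>x. \<chi> i. f x i)"
proof (rule smooth_on_componentwise)
  fix b :: "'b ^ 'n" assume "b \<in> Basis"
  then obtain i u where b: "b = axis i u" by (auto simp: Basis_vec_def)
  show "smooth_on S (\<lambda>x. (\<chi> i. f x i) \<bullet> b)"
    unfolding b inner_axis by (simp, intro smooth_intros assms)
qed

lemma smooth_on_det:
  fixes A :: "_ \<Rightarrow> real ^ 'n ^ 'n"
  assumes "\<And>i j. smooth_on S (\<lambda>x. A x $ i $ j)"
  shows "smooth_on S (\<lambda>x. det (A x))"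
  unfolding det_def by (intro smooth_on_sum smooth_on_mult smooth_on_const smooth_on_prod assms)

section \<open>Derivatives of smooth maps and smoothness of inverses\<close>

lemma smooth_on_has_derivative:
  assumes "smooth_on S f" "open S" "x \<in> S"
  shows "(f has_derivative frechet_derivative f (at x)) (at x)"
  using assms Ck_on_Suc_has_derivative[of 0 f S x] by (auto simp: smooth_on_open)

lemma smooth_on_frechet_derivative_direction:
  assumes "smooth_on S f" "open S"
  shows "smooth_on S (\<lambda>x. frechet_derivative f (at x) v)"
  using assms by (auto simp: smooth_on_open) (metis Ck_on.simps(2))

text \<open>Here the base point and the direction vary together; expanding the direction in
  \<open>Basis\<close> reduces this to fixed directions.\<close>

lemma smooth_on_frechet_derivative:
  assumes f: "smooth_on S f" "open S" and p: "smooth_on T p" "\<And>y. y \<in> T \<Longrightarrow> p y \<in> S" and v: "smooth_on T v"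
  shows "smooth_on T (\<lambda>y. frechet_derivative f (at (p y)) (v y))"
proof -
  let ?D = "\<lambda>x. frechet_derivative f (at x)"
  have "smooth_on T (\<lambda>y. \<Sum>b\<in>Basis. (v y \<bullet> b) *\<^sub>R ?D (p y) b)"
    by (intro smooth_intros v smooth_on_compose[OF p(1) smooth_on_frechet_derivative_direction[OF f]])
      (use p in auto)
  moreover have "(\<Sum>b\<in>Basis. (v y \<bullet> b) *\<^sub>R ?D (p y) b) = ?D (p y) (v y)" if "y \<in> T" for y
  proof -
    have lin: "linear (?D (p y))"
      using smooth_on_has_derivative[OF f p(2)[OF that]] has_derivative_linear by blast
    show ?thesis
      using linear_sum[OF lin, of "\<lambda>b. (v y \<bullet> b) *\<^sub>R b" Basis] linear_cmul[OF lin]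
      by (simp add: euclidean_representation)
  qed
  ultimately show ?thesis using smooth_on_cong by (metis (no_types, lifting))
qed

lemma smooth_on_imp_differentiable_on:
  assumes "smooth_on S f" "open S" shows "f differentiable_on S"
  using smooth_on_has_derivative[OF assms] differentiableI
  by (metis differentiable_at_withinI differentiable_on_def)

text \<open>The directional derivatives of the inverse solve a linear system, so Cramer's rule expresses
  them rationally in terms of first derivatives taken along the inverse itself.\<close>

lemma smooth_on_inverse_map:
  fixes f :: "real ^ 'n \<Rightarrow> real ^ 'n"
  assumes f: "smooth_on S f" and S: "open S" and inj: "inj_on f S"
    and surj: "\<And>x. x \<in> S \<Longrightarrow> surj (frechet_derivative f (at x))"
  shows "open (f ` S)" "smooth_on (f ` S) (inv_into S f)"
proof -
  let ?g = "inv_into S f" and ?D = "\<lambda>x. frechet_derivative f (at x)"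
  have cf: "continuous_on S f" using smooth_on_imp_continuous_on[OF f] .
  \<comment> \<open>Invariance of domain yields openness of the image and continuity of the inverse,
    so only differentiability of the inverse is left.\<close>
  show T: "open (f ` S)" using invariance_of_domain[OF cf S inj] .
  have cg: "continuous_on (f ` S) ?g"
    by (metis S cf continuous_on_inverse_open inj inv_into_f_f order_refl)
  have D: "(f has_derivative ?D x) (at x)" if "x \<in> S" for x
    using smooth_on_has_derivative[OF f S that] .
  have lin: "linear (?D x)" if "x \<in> S" for x using D[OF that] has_derivative_linear by blast
  have bij: "bij (?D x)" if "x \<in> S" for x
    using lin[OF that] surj[OF that] linear_surjective_imp_injective bij_def by blast
  have detnz: "det (matrix (?D x)) \<noteq> 0" if "x \<in> S" for x
    by (metis bij bij_betw_def det_nz_iff_inj lin matrix_vector_mul(1) that)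
  define A where "A = (\<lambda>x. matrix (?D x))"
  define h where "h = (\<lambda>x v. \<chi> k. det (\<chi> i j. if j = k then v $ i else A x $ i $ j) / det (A x))"
  have h: "inv (?D x) v = h x v" if "x \<in> S" for x v
  proof -
    have "A x *v inv (?D x) v = v"
      unfolding A_def using lin[OF that] surj[OF that]
      by (simp add: matrix_works linear_matrix_vector_mul_eq surj_f_inv_f)
    moreover have "det (A x) \<noteq> 0" using detnz[OF that] by (simp add: A_def)
    ultimately show ?thesis unfolding h_def using cramer[of "A x" "inv (?D x) v" v] by blast
  qed
  have Dg: "(?g has_derivative (\<lambda>v. h (?g y) v)) (at y)" if y: "y \<in> f ` S" for y
  proof -
    have gy: "?g y \<in> S" "f (?g y) = y" using y by (auto simp: inv_into_into f_inv_into_f)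
    have "(?g has_derivative inv (?D (?g y))) (at y)"
    proof (rule has_derivative_inverse_basic[where g = ?g and y = y, OF D[OF gy(1)] _ _ _ T y])
      show "bounded_linear (inv (?D (?g y)))"
        using inj_linear_imp_inv_linear bij lin gy(1) bij_is_inj linear_conv_bounded_linear by blast
      show "inv (?D (?g y)) \<circ> ?D (?g y) = id" using bij[OF gy(1)] by (simp add: bij_is_inj)
      show "continuous (at y) ?g" using cg T y continuous_on_eq_continuous_at by blast
    qed (auto simp: f_inv_into_f)
    moreover have "inv (?D (?g y)) = h (?g y)" using h[OF gy(1)] by auto
    ultimately show ?thesis by simp
  qed
  have hs: "smooth_on S (\<lambda>x. h x v)" for v
  proof -
    have A: "smooth_on S (\<lambda>x. A x $ i $ j)" for i j
      unfolding A_def matrix_def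
      by (simp, intro smooth_intros smooth_on_frechet_derivative_direction f S)
    have "smooth_on S (\<lambda>x. if j = k then v $ i else A x $ i $ j)" for i j k
      using A by (cases "j = k") (auto intro: smooth_intros)
    then have "smooth_on S (\<lambda>x. det (\<chi> i j. if j = k then v $ i else A x $ i $ j))" for k
      by (intro smooth_on_det) simp
    moreover have "det (A x) \<noteq> 0" if "x \<in> S" for x using detnz[OF that] by (simp add: A_def)
    moreover have "smooth_on S (\<lambda>x. det (A x))" by (intro smooth_on_det A)
    ultimately show ?thesis unfolding h_def by (intro smooth_on_vec_lambda smooth_on_divide)
  qed
  have "Ck_on n ?g (f ` S)" for n
  proof (induction n)
    case 0
    then show ?case using cg by (simp add: Ck_on.simps)
  next
    case (Suc n)
    \<comment> \<open>Bootstrapping: the derivative of \<open>?g\<close> is \<open>h\<close>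
      evaluated along \<open>?g\<close>, so one more order of smoothness costs only the previous
      order of \<open>?g\<close>.\<close>
    have "?g ` f ` S \<subseteq> S" using inj by auto
    moreover have "Ck_on n (\<lambda>x. h x v) S" for v using hs S smooth_on_open by blast
    ultimately have "Ck_on n (\<lambda>y. h (?g y) v) (f ` S)" for v by (rule Ck_on_compose[OF T S Suc, rotated])
    then show ?case by (intro Ck_on_SucI[OF T Dg])
  qed
  then show "smooth_on (f ` S) ?g" using T smooth_on_open by blast
qed

section \<open>Manifolds presented as quotients of subsets of Euclidean space\<close>

text \<open>\<open>M\<close> is a quotient of \<open>X\<close> along a smooth \<open>\<pi>\<close> with smooth local sections; smoothness of maps
  between such manifolds can then be tested on lifts, without mentioning charts.\<close>

definition presents ::
  "'x::euclidean_space set \<Rightarrow> ('x \<Rightarrow> 'q) \<Rightarrow> ('q, 'e::euclidean_space) charted_space \<Rightarrow> bool" where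
  "presents X \<pi> M \<longleftrightarrow>
     underlying M = quotient_topology (top_of_set X) \<pi> \<and>
     (\<Union>(U, \<phi>)\<in>atlas M. U) = topspace (underlying M) \<and>
     (\<forall>(V, \<psi>)\<in>atlas M. openin (underlying M) V \<and> inj_on \<psi> V \<and> open (\<psi> ` V) \<and>
        smooth_on {x \<in> X. \<pi> x \<in> V} (\<psi> \<circ> \<pi>) \<and>
        (\<forall>y\<in>\<psi> ` V. \<exists>N \<sigma>. open N \<and> y \<in> N \<and> N \<subseteq> \<psi> ` V \<and> smooth_on N \<sigma> \<and> \<sigma> ` N \<subseteq> X \<and>
           (\<forall>u\<in>N. \<pi> (\<sigma> u) = inv_into V \<psi> u)))"

lemma presents_topspace: "presents X \<pi> M \<Longrightarrow> topspace (underlying M) = \<pi> ` X"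
  by (simp add: presents_def topspace_quotient_topology)

lemma presents_openin:
  assumes "presents X \<pi> M"
  shows "openin (underlying M) V \<longleftrightarrow> V \<subseteq> \<pi> ` X \<and> openin (top_of_set X) {x \<in> X. \<pi> x \<in> V}"
  using assms by (simp add: presents_def openin_quotient_topology)

lemma presents_chart:
  assumes "presents X \<pi> M" "(V, \<psi>) \<in> atlas M"
  shows "openin (underlying M) V" "inj_on \<psi> V" "open (\<psi> ` V)" "smooth_on {x \<in> X. \<pi> x \<in> V} (\<lambda>x. \<psi> (\<pi> x))"
    "openin (top_of_set X) {x \<in> X. \<pi> x \<in> V}" "V \<subseteq> \<pi> ` X"
proof -
  show 1: "openin (underlying M) V" "inj_on \<psi> V" "open (\<psi> ` V)" "smooth_on {x \<in> X. \<pi> x \<in> V} (\<lambda>x. \<psi> (\<pi> x))"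
    using assms by (auto simp: presents_def o_def)
  show "openin (top_of_set X) {x \<in> X. \<pi> x \<in> V}" "V \<subseteq> \<pi> ` X"
    using 1(1) presents_openin[OF assms(1)] by auto
qed

lemma presents_section:
  assumes "presents X \<pi> M" "(V, \<psi>) \<in> atlas M" "y \<in> \<psi> ` V"
  obtains N \<sigma> where "open N" "y \<in> N" "N \<subseteq> \<psi> ` V" "smooth_on N \<sigma>" "\<sigma> ` N \<subseteq> X"
    "\<And>u. u \<in> N \<Longrightarrow> \<pi> (\<sigma> u) = inv_into V \<psi> u"
proof -
  have "\<exists>N \<sigma>. open N \<and> y \<in> N \<and> N \<subseteq> \<psi> ` V \<and> smooth_on N \<sigma> \<and> \<sigma> ` N \<subseteq> X \<and> (\<forall>u\<in>N. \<pi> (\<sigma> u) = inv_into V \<psi> u)"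
    using assms unfolding presents_def by fastforce
  then show thesis using that by blast
qed

lemma presents_covered:
  assumes "presents X \<pi> M" "x \<in> X"
  obtains V \<psi> where "(V, \<psi>) \<in> atlas M" "\<pi> x \<in> V"
proof -
  have "\<pi> x \<in> (\<Union>(U, \<phi>)\<in>atlas M. U)"
    using assms presents_topspace[OF assms(1)] by (auto simp: presents_def)
  then show thesis using that by auto
qed

lemma openin_smooth_on_preimage:
  assumes "smooth_on S f" "open W"
  shows "openin (top_of_set S) {x \<in> S. f x \<in> W}"
  using continuous_openin_preimage_gen[OF smooth_on_imp_continuous_on[OF assms(1)] assms(2)]
  by (simp add: vimage_def Int_def)

lemma openin_smooth_on_preimage_openin:
  assumes "smooth_on S f" "f ` S \<subseteq> T" "openin (top_of_set T) W"
  shows "openin (top_of_set S) {x \<in> S. f x \<in> W}"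
proof -
  obtain W' where W': "open W'" "W = T \<inter> W'" using assms(3) by (auto simp: openin_open)
  have "{x \<in> S. f x \<in> W} = {x \<in> S. f x \<in> W'}" using assms(2) W' by auto
  then show ?thesis using openin_smooth_on_preimage[OF assms(1) W'(1)] by simp
qed

text \<open>\<open>\<psi>\<close> is continuous because \<open>\<psi> \<circ> \<pi>\<close> is and
  the topology is the quotient topology; the inverse is continuous because locally it is
  \<open>\<pi>\<close> after a smooth section.\<close>

lemma presents_homeomorphic_chart:
  assumes P: "presents X \<pi> M" and c: "(V, \<psi>) \<in> atlas M"
  shows "homeomorphic_map (subtopology (underlying M) V) (top_of_set (\<psi> ` V)) \<psi>"
proof -
  let ?M = "underlying M" and ?X = "top_of_set X"
  note ch = presents_chart[OF P c]
  have top: "topspace (subtopology ?M V) = V"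
    using openin_subset[OF ch(1)] by (auto simp: topspace_subtopology)
  have "continuous_map (subtopology ?M V) (top_of_set (\<psi> ` V)) \<psi>"
    unfolding continuous_map_def top
  proof (intro conjI allI impI)
    fix O' assume "openin (top_of_set (\<psi> ` V)) O'"
    then have O': "open O'" using ch(3) by (simp add: openin_open_eq)
    have "openin (top_of_set {x \<in> X. \<pi> x \<in> V}) {x \<in> {x \<in> X. \<pi> x \<in> V}. \<psi> (\<pi> x) \<in> O'}"
      by (rule openin_smooth_on_preimage[OF ch(4) O'])
    then have "openin ?X {x \<in> {x \<in> X. \<pi> x \<in> V}. \<psi> (\<pi> x) \<in> O'}"
      using ch(5) openin_trans by blast
    moreover have "{x \<in> {x \<in> X. \<pi> x \<in> V}. \<psi> (\<pi> x) \<in> O'} = {x \<in> X. \<pi> x \<in> {q \<in> V. \<psi> q \<in> O'}}" by auto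
    ultimately have "openin ?M {q \<in> V. \<psi> q \<in> O'}" unfolding presents_openin[OF P] using ch(6) by auto
    then show "openin (subtopology ?M V) {q \<in> V. \<psi> q \<in> O'}"
      by (simp add: openin_open_subtopology[OF ch(1)])
  qed auto
  moreover have "continuous_map (top_of_set (\<psi> ` V)) (subtopology ?M V) (inv_into V \<psi>)"
    unfolding continuous_map_in_subtopology
  proof
    show "continuous_map (top_of_set (\<psi> ` V)) ?M (inv_into V \<psi>)"
      unfolding continuous_map_def
    proof (intro conjI allI impI)
      show "inv_into V \<psi> \<in> topspace (top_of_set (\<psi> ` V)) \<rightarrow> topspace ?M"
        using openin_subset[OF ch(1)] by (auto simp: inv_into_into)
      fix W assume W: "openin ?M W"
      then have WX: "openin ?X {x \<in> X. \<pi> x \<in> W}" using presents_openin[OF P] by blast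
      have "open {y \<in> \<psi> ` V. inv_into V \<psi> y \<in> W}"
      proof (subst open_subopen, intro ballI)
        fix y assume y: "y \<in> {y \<in> \<psi> ` V. inv_into V \<psi> y \<in> W}"
        then obtain N \<sigma> where N: "open N" "y \<in> N" "N \<subseteq> \<psi> ` V" "smooth_on N \<sigma>" "\<sigma> ` N \<subseteq> X"
          "\<And>u. u \<in> N \<Longrightarrow> \<pi> (\<sigma> u) = inv_into V \<psi> u"
          using presents_section[OF P c, of y] by blast
        have "openin (top_of_set N) {u \<in> N. \<sigma> u \<in> {x \<in> X. \<pi> x \<in> W}}"
          by (rule openin_smooth_on_preimage_openin[OF N(4,5) WX])
        then have "open {u \<in> N. \<sigma> u \<in> {x \<in> X. \<pi> x \<in> W}}" using N(1) by (simp add: openin_open_eq)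
        then show "\<exists>T. open T \<and> y \<in> T \<and> T \<subseteq> {y \<in> \<psi> ` V. inv_into V \<psi> y \<in> W}"
          using N y by (intro exI[of _ "{u \<in> N. \<sigma> u \<in> {x \<in> X. \<pi> x \<in> W}}"]) force
      qed
      then show "openin (top_of_set (\<psi> ` V)) {y \<in> topspace (top_of_set (\<psi> ` V)). inv_into V \<psi> y \<in> W}"
        using ch(3) by (simp add: openin_open_eq)
    qed
  qed (auto simp: inv_into_into)
  ultimately have "homeomorphic_maps (subtopology ?M V) (top_of_set (\<psi> ` V)) \<psi> (inv_into V \<psi>)"
    unfolding homeomorphic_maps_def top using ch(2) by (auto simp: f_inv_into_f)
  then show ?thesis using homeomorphic_maps_imp_map by blast
qed

text \<open>A transition map is locally a section of one chart followed by
  \<open>\<psi> \<circ> \<pi>\<close> of the other, hence smooth.\<close>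

lemma presents_smooth_manifold:
  assumes P: "presents X \<pi> M" and "Hausdorff_space (underlying M)" "second_countable (underlying M)"
  shows "smooth_manifold M"
proof -
  have "smooth_on (\<phi> ` (U \<inter> V)) (\<psi> \<circ> inv_into U \<phi>)"
    if c: "(U, \<phi>) \<in> atlas M" and d: "(V, \<psi>) \<in> atlas M" for U \<phi> V \<psi>
  proof (rule smooth_on_local)
    note ch = presents_chart[OF P c]
    fix y assume y: "y \<in> \<phi> ` (U \<inter> V)"
    then obtain N \<sigma> where N: "open N" "y \<in> N" "N \<subseteq> \<phi> ` U" "smooth_on N \<sigma>" "\<sigma> ` N \<subseteq> X"
      "\<And>u. u \<in> N \<Longrightarrow> \<pi> (\<sigma> u) = inv_into U \<phi> u"
      using presents_section[OF P c, of y] by blast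
    have in_V: "inv_into U \<phi> u \<in> V" if "u \<in> \<phi> ` (U \<inter> V)" for u
      using that ch(2) by (auto simp: inv_into_f_f)
    have "smooth_on (\<phi> ` (U \<inter> V) \<inter> N) (\<lambda>u. \<psi> (\<pi> (\<sigma> u)))"
      by (rule smooth_on_compose[OF smooth_on_subset[OF N(4)] presents_chart(4)[OF P d]])
        (use N in_V in auto)
    then have "smooth_on (\<phi> ` (U \<inter> V) \<inter> N) (\<psi> \<circ> inv_into U \<phi>)"
      by (rule smooth_on_cong[THEN iffD1, rotated]) (use N in auto)
    then show "\<exists>W. openin (top_of_set (\<phi> ` (U \<inter> V))) W \<and> y \<in> W \<and> smooth_on W (\<psi> \<circ> inv_into U \<phi>)"
      using N y by (intro exI[of _ "\<phi> ` (U \<inter> V) \<inter> N"]) auto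
  qed
  then show ?thesis
    unfolding smooth_manifold_def
    using assms presents_chart[OF P] presents_homeomorphic_chart[OF P] by (auto simp: presents_def)
qed

text \<open>From charts to lifts: a section of a target chart after
  \<open>\<psi> \<circ> f \<circ> \<pi>\<close> is a local lift. From lifts to charts: precompose
  the lift with a section of the source chart. The lifts need not be compatible with one
  another.\<close>

lemma presents_smooth_map_iff:
  assumes P: "presents X \<pi> M" and Q: "presents Y \<tau> N"
  shows "smooth_map M N f \<longleftrightarrow>
    (\<forall>x\<in>X. \<exists>U \<Phi>. openin (top_of_set X) U \<and> x \<in> U \<and> smooth_on U \<Phi> \<and> \<Phi> ` U \<subseteq> Y \<and> (\<forall>u\<in>U. \<tau> (\<Phi> u) = f (\<pi> u)))"
    (is "_ \<longleftrightarrow> ?lift")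
proof
  assume f: "smooth_map M N f"
  show ?lift
  proof
    fix x assume x: "x \<in> X"
    obtain U \<phi> where c: "(U, \<phi>) \<in> atlas M" and xU: "\<pi> x \<in> U" using presents_covered[OF P x] .
    have cf: "continuous_map (underlying M) (underlying N) f" using f by (simp add: smooth_map_def)
    have "f (\<pi> x) \<in> topspace (underlying N)"
      using continuous_map_image_subset_topspace[OF cf] presents_topspace[OF P] x by auto
    then obtain x' where "x' \<in> Y" "\<tau> x' = f (\<pi> x)" using presents_topspace[OF Q] by auto
    then obtain V \<psi> where d: "(V, \<psi>) \<in> atlas N" and xV: "f (\<pi> x) \<in> V" using presents_covered[OF Q] by metis
    obtain N0 \<sigma> where N0: "open N0" "\<psi> (f (\<pi> x)) \<in> N0" "N0 \<subseteq> \<psi> ` V" "smooth_on N0 \<sigma>" "\<sigma> ` N0 \<subseteq> Y"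
      "\<And>u. u \<in> N0 \<Longrightarrow> \<tau> (\<sigma> u) = inv_into V \<psi> u"
      using presents_section[OF Q d, of "\<psi> (f (\<pi> x))"] xV by blast
    define A where "A = {x \<in> X. \<pi> x \<in> U \<and> f (\<pi> x) \<in> V}"
    note ch = presents_chart[OF P c] and dh = presents_chart[OF Q d]
    have "openin (underlying M) {q \<in> topspace (underlying M). f q \<in> V}"
      using cf dh(1) openin_continuous_map_preimage by blast
    then have "openin (underlying M) (U \<inter> {q \<in> topspace (underlying M). f q \<in> V})"
      using ch(1) by blast
    then have "openin (top_of_set X) {x \<in> X. \<pi> x \<in> U \<inter> {q \<in> topspace (underlying M). f q \<in> V}}"
      using presents_openin[OF P] by blast
    moreover have "{x \<in> X. \<pi> x \<in> U \<inter> {q \<in> topspace (underlying M). f q \<in> V}} = A"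
      unfolding A_def presents_topspace[OF P] by auto
    ultimately have oA: "openin (top_of_set X) A" by simp
    have fc: "smooth_on (\<phi> ` {q \<in> U. f q \<in> V}) (\<psi> \<circ> f \<circ> inv_into U \<phi>)"
      using f c d unfolding smooth_map_def by fastforce
    have "smooth_on A (\<lambda>u. (\<psi> \<circ> f \<circ> inv_into U \<phi>) (\<phi> (\<pi> u)))"
      by (rule smooth_on_compose[OF smooth_on_subset[OF ch(4)] fc]) (auto simp: A_def)
    then have s: "smooth_on A (\<lambda>u. \<psi> (f (\<pi> u)))"
      by (rule smooth_on_cong[THEN iffD1, rotated]) (auto simp: A_def inv_into_f_f[OF ch(2)])
    define U0 where "U0 = {u \<in> A. \<psi> (f (\<pi> u)) \<in> N0}"
    have "openin (top_of_set X) U0"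
      unfolding U0_def using openin_smooth_on_preimage[OF s N0(1)] oA openin_trans by blast
    moreover have "x \<in> U0" using x xU xV N0 by (auto simp: U0_def A_def)
    moreover have "smooth_on U0 (\<lambda>u. \<sigma> (\<psi> (f (\<pi> u))))"
      by (rule smooth_on_compose[OF smooth_on_subset[OF s] N0(4)]) (auto simp: U0_def)
    moreover have "\<tau> (\<sigma> (\<psi> (f (\<pi> u)))) = f (\<pi> u)" if "u \<in> U0" for u
      using that N0(6) by (auto simp: U0_def A_def inv_into_f_f[OF dh(2)])
    moreover have "(\<lambda>u. \<sigma> (\<psi> (f (\<pi> u)))) ` U0 \<subseteq> Y" using N0(5) by (auto simp: U0_def)
    ultimately show "\<exists>U \<Phi>. openin (top_of_set X) U \<and> x \<in> U \<and> smooth_on U \<Phi> \<and> \<Phi> ` U \<subseteq> Y \<and> (\<forall>u\<in>U. \<tau> (\<Phi> u) = f (\<pi> u))"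
      by (intro exI[of _ U0] exI[of _ "\<lambda>u. \<sigma> (\<psi> (f (\<pi> u)))"]) (intro conjI ballI)
  qed
next
  assume L: ?lift
  have "continuous_map (underlying M) (underlying N) f"
    unfolding continuous_map_def
  proof (intro conjI allI impI)
    show "f \<in> topspace (underlying M) \<rightarrow> topspace (underlying N)"
    proof
      fix q assume "q \<in> topspace (underlying M)"
      then obtain x where x: "x \<in> X" "q = \<pi> x" using presents_topspace[OF P] by auto
      obtain U \<Phi> where "x \<in> U" "\<Phi> ` U \<subseteq> Y" "\<forall>u\<in>U. \<tau> (\<Phi> u) = f (\<pi> u)"
        using L[rule_format, OF x(1)] by blast
      then show "f q \<in> topspace (underlying N)"
        unfolding presents_topspace[OF Q] x(2) by (metis image_eqI image_subset_iff)
    qed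
    fix W assume "openin (underlying N) W"
    then have W: "openin (top_of_set Y) {y \<in> Y. \<tau> y \<in> W}" using presents_openin[OF Q] by blast
    have "openin (top_of_set X) {x \<in> X. f (\<pi> x) \<in> W}"
    proof (subst openin_subopen, intro ballI)
      fix x assume x: "x \<in> {x \<in> X. f (\<pi> x) \<in> W}"
      then obtain U \<Phi> where U: "openin (top_of_set X) U" "x \<in> U" "smooth_on U \<Phi>" "\<Phi> ` U \<subseteq> Y"
        "\<forall>u\<in>U. \<tau> (\<Phi> u) = f (\<pi> u)" using L by blast
      have "openin (top_of_set U) {u \<in> U. \<Phi> u \<in> {y \<in> Y. \<tau> y \<in> W}}"
        by (rule openin_smooth_on_preimage_openin[OF U(3,4) W])
      then have "openin (top_of_set X) {u \<in> U. \<Phi> u \<in> {y \<in> Y. \<tau> y \<in> W}}"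
        using U(1) openin_trans by blast
      then show "\<exists>T. openin (top_of_set X) T \<and> x \<in> T \<and> T \<subseteq> {x \<in> X. f (\<pi> x) \<in> W}"
        using U x openin_subset[OF U(1)] by (intro exI[of _ "{u \<in> U. \<Phi> u \<in> {y \<in> Y. \<tau> y \<in> W}}"]) auto
    qed
    moreover have "{x \<in> X. \<pi> x \<in> {q \<in> \<pi> ` X. f q \<in> W}} = {x \<in> X. f (\<pi> x) \<in> W}" by auto
    ultimately show "openin (underlying M) {q \<in> topspace (underlying M). f q \<in> W}"
      unfolding presents_topspace[OF P] presents_openin[OF P] by auto
  qed
  moreover have "smooth_on (\<phi> ` {q \<in> U. f q \<in> V}) (\<psi> \<circ> f \<circ> inv_into U \<phi>)"
    if c: "(U, \<phi>) \<in> atlas M" and d: "(V, \<psi>) \<in> atlas N" for U \<phi> V \<psi>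
  proof (rule smooth_on_local)
    let ?S = "\<phi> ` {q \<in> U. f q \<in> V}"
    note ch = presents_chart[OF P c] and dh = presents_chart[OF Q d]
    fix y assume y: "y \<in> ?S"
    obtain N0 \<sigma> where N0: "open N0" "y \<in> N0" "N0 \<subseteq> \<phi> ` U" "smooth_on N0 \<sigma>" "\<sigma> ` N0 \<subseteq> X"
      "\<And>u. u \<in> N0 \<Longrightarrow> \<pi> (\<sigma> u) = inv_into U \<phi> u"
      using presents_section[OF P c, of y] y by blast
    have "\<sigma> y \<in> X" using N0(2,5) by blast
    then obtain U0 \<Phi> where U0: "openin (top_of_set X) U0" "\<sigma> y \<in> U0" "smooth_on U0 \<Phi>" "\<Phi> ` U0 \<subseteq> Y"
      "\<forall>u\<in>U0. \<tau> (\<Phi> u) = f (\<pi> u)" using L[rule_format, of "\<sigma> y"] by blast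
    define B where "B = {u \<in> ?S \<inter> N0. \<sigma> u \<in> U0}"
    have s: "smooth_on (?S \<inter> N0) \<sigma>" using N0(4) by (rule smooth_on_subset) auto
    have "openin (top_of_set (?S \<inter> N0)) B"
      unfolding B_def by (rule openin_smooth_on_preimage_openin[OF s _ U0(1)]) (use N0 in auto)
    then have "openin (top_of_set ?S) B" using N0(1) openin_trans by blast
    moreover have "y \<in> B" using y N0 U0 by (auto simp: B_def)
    moreover have fV: "f (inv_into U \<phi> u) \<in> V" if "u \<in> ?S" for u
      using that ch(2) by (auto simp: inv_into_f_f)
    have "smooth_on B (\<lambda>u. \<psi> (\<tau> (\<Phi> (\<sigma> u))))"
    proof (rule smooth_on_compose[OF smooth_on_compose[OF smooth_on_subset[OF s] U0(3)] dh(4)])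
      show "(\<lambda>u. \<Phi> (\<sigma> u)) ` B \<subseteq> {x \<in> Y. \<tau> x \<in> V}"
      proof clarify
        fix u assume u: "u \<in> B"
        then have "\<tau> (\<Phi> (\<sigma> u)) = f (inv_into U \<phi> u)" using U0 N0 by (auto simp: B_def)
        then show "\<Phi> (\<sigma> u) \<in> Y \<and> \<tau> (\<Phi> (\<sigma> u)) \<in> V" using u fV[of u] U0(4) by (auto simp: B_def)
      qed
    qed (auto simp: B_def)
    then have "smooth_on B (\<psi> \<circ> f \<circ> inv_into U \<phi>)"
      by (rule smooth_on_cong[THEN iffD1, rotated]) (use U0 N0 in \<open>auto simp: B_def\<close>)
    ultimately show "\<exists>W. openin (top_of_set ?S) W \<and> y \<in> W \<and> smooth_on W (\<psi> \<circ> f \<circ> inv_into U \<phi>)" by blast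
  qed
  ultimately show "smooth_map M N f" unfolding smooth_map_def by blast
qed

lemma presents_smooth_mapI:
  assumes "presents X \<pi> M" "presents Y \<tau> N" "smooth_on X \<Phi>" "\<Phi> ` X \<subseteq> Y" "\<And>x. x \<in> X \<Longrightarrow> f (\<pi> x) = \<tau> (\<Phi> x)"
  shows "smooth_map M N f"
  unfolding presents_smooth_map_iff[OF assms(1,2)] using assms(3-5)
  by (intro ballI exI[of _ X] exI[of _ \<Phi>]) auto

lemma presents_smooth_map_compose:
  assumes M: "presents X \<pi> M" and N: "presents Y \<tau> N" and K: "presents Z \<kappa> K"
    and f: "smooth_map M N f" and g: "smooth_map N K g"
  shows "smooth_map M K (\<lambda>x. g (f x))"
  unfolding presents_smooth_map_iff[OF M K]
proof
  fix x assume "x \<in> X"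
  then obtain U \<Phi> where U: "openin (top_of_set X) U" "x \<in> U" "smooth_on U \<Phi>" "\<Phi> ` U \<subseteq> Y"
    "\<forall>u\<in>U. \<tau> (\<Phi> u) = f (\<pi> u)" using f unfolding presents_smooth_map_iff[OF M N] by meson
  then have "\<Phi> x \<in> Y" by auto
  then obtain V \<Psi> where V: "openin (top_of_set Y) V" "\<Phi> x \<in> V" "smooth_on V \<Psi>" "\<Psi> ` V \<subseteq> Z"
    "\<forall>u\<in>V. \<kappa> (\<Psi> u) = g (\<tau> u)" using g unfolding presents_smooth_map_iff[OF N K] by meson
  define W where "W = {u \<in> U. \<Phi> u \<in> V}"
  have "openin (top_of_set X) W"
    unfolding W_def using openin_smooth_on_preimage_openin[OF U(3,4) V(1)] U(1) openin_trans by blast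
  moreover have "smooth_on W (\<lambda>u. \<Psi> (\<Phi> u))"
    by (rule smooth_on_compose[OF smooth_on_subset[OF U(3)] V(3)]) (auto simp: W_def)
  ultimately show "\<exists>U \<Phi>. openin (top_of_set X) U \<and> x \<in> U \<and> smooth_on U \<Phi> \<and> \<Phi> ` U \<subseteq> Z \<and> (\<forall>u\<in>U. \<kappa> (\<Phi> u) = g (f (\<pi> u)))"
    using U V by (intro exI[of _ W] exI[of _ "\<lambda>u. \<Psi> (\<Phi> u)"]) (auto simp: W_def)
qed

lemma diffeomorphic_sym: "diffeomorphic M N \<Longrightarrow> diffeomorphic N M"
  unfolding diffeomorphic_def by blast

lemma presents_diffeomorphic_trans:
  assumes M: "presents X \<pi> M" and N: "presents Y \<tau> N" and K: "presents Z \<kappa> K"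
    and "diffeomorphic M N" "diffeomorphic N K"
  shows "diffeomorphic M K"
proof -
  obtain f g where f: "smooth_map M N f" "smooth_map N M g"
    "\<forall>x\<in>topspace (underlying M). g (f x) = x" "\<forall>y\<in>topspace (underlying N). f (g y) = y"
    using assms(4) unfolding diffeomorphic_def by meson
  obtain h k where h: "smooth_map N K h" "smooth_map K N k"
    "\<forall>x\<in>topspace (underlying N). k (h x) = x" "\<forall>y\<in>topspace (underlying K). h (k y) = y"
    using assms(5) unfolding diffeomorphic_def by meson
  have "f x \<in> topspace (underlying N)" if "x \<in> topspace (underlying M)" for x
    using f(1) that unfolding smooth_map_def continuous_map_def by auto
  moreover have "k x \<in> topspace (underlying N)" if "x \<in> topspace (underlying K)" for x
    using h(2) that unfolding smooth_map_def continuous_map_def by auto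
  ultimately show ?thesis
    using assms(4,5) presents_smooth_map_compose[OF M N K f(1) h(1)] presents_smooth_map_compose[OF K N M h(2) f(2)]
    using f h unfolding diffeomorphic_def by (intro conjI exI[of _ "\<lambda>x. h (f x)"] exI[of _ "\<lambda>x. g (k x)"]) auto
qed

section \<open>Embedded submanifolds and quotient manifolds as presented manifolds\<close>

lemma quotient_topology_id: "quotient_topology T id = T"
  unfolding topology_eq openin_quotient_topology
proof (intro allI)
  fix S
  have "S \<subseteq> topspace T \<Longrightarrow> {x \<in> topspace T. x \<in> S} = S" by auto
  then show "(S \<subseteq> id ` topspace T \<and> openin T {x \<in> topspace T. id x \<in> S}) = openin T S"
    using openin_subset[of T S] by auto
qed

lemma embedded_simps:
  "underlying (embedded X) = top_of_set X"
  "(U, \<phi>) \<in> atlas (embedded X) \<longleftrightarrow> openin (top_of_set X) U \<and> inj_on \<phi> U \<and> open (\<phi> ` U) \<and>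
     smooth_on U \<phi> \<and> smooth_on (\<phi> ` U) (inv_into U \<phi>)"
  by (auto simp: embedded_def)

text \<open>With \<open>id\<close> as projection the inverse of a chart is itself a section, so only
  the existence of enough charts remains to be checked.\<close>

lemma presents_embedded:
  fixes X :: "'a::euclidean_space set"
  assumes "\<And>x. x \<in> X \<Longrightarrow> \<exists>(U, \<phi>)\<in>atlas (embedded X :: ('a, 'e::euclidean_space) charted_space). x \<in> U"
  shows "presents X id (embedded X :: ('a, 'e) charted_space)"
  unfolding presents_def
proof (intro conjI ballI)
  show "(\<Union>(U, \<phi>)\<in>atlas (embedded X :: ('a, 'e) charted_space). U) = topspace (underlying (embedded X :: ('a, 'e) charted_space))"
  proof
    show "(\<Union>(U, \<phi>)\<in>atlas (embedded X :: ('a, 'e) charted_space). U) \<subseteq> topspace (underlying (embedded X :: ('a, 'e) charted_space))"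
      using openin_imp_subset by (fastforce simp: embedded_simps)
    show "topspace (underlying (embedded X :: ('a, 'e) charted_space)) \<subseteq> (\<Union>(U, \<phi>)\<in>atlas (embedded X :: ('a, 'e) charted_space). U)"
      using assms by (fastforce simp: embedded_simps(1))
  qed
next
  fix c assume c: "c \<in> atlas (embedded X :: ('a, 'e) charted_space)"
  obtain V \<psi> where [simp]: "c = (V, \<psi>)" by (cases c)
  have V: "openin (top_of_set X) V" "inj_on \<psi> V" "open (\<psi> ` V)" "smooth_on V \<psi>" "smooth_on (\<psi> ` V) (inv_into V \<psi>)"
    using c by (auto simp: embedded_simps)
  moreover have "{x \<in> X. x \<in> V} = V" using openin_imp_subset[OF V(1)] by auto
  moreover have "inv_into V \<psi> ` \<psi> ` V \<subseteq> X" using openin_imp_subset[OF V(1)] V(2) by auto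
  ultimately show "case c of (V, \<psi>) \<Rightarrow> openin (underlying (embedded X :: ('a, 'e) charted_space)) V \<and> inj_on \<psi> V \<and> open (\<psi> ` V) \<and>
        smooth_on {x \<in> X. id x \<in> V} (\<psi> \<circ> id) \<and>
        (\<forall>y\<in>\<psi> ` V. \<exists>N \<sigma>. open N \<and> y \<in> N \<and> N \<subseteq> \<psi> ` V \<and> smooth_on N \<sigma> \<and> \<sigma> ` N \<subseteq> X \<and>
           (\<forall>u\<in>N. id (\<sigma> u) = inv_into V \<psi> u))"
    by (auto simp: embedded_simps(1) intro!: exI[of _ "\<psi> ` V"] exI[of _ "inv_into V \<psi>"])
qed (simp add: quotient_topology_id embedded_simps)

text \<open>A tangent space appears as a subspace without preferred coordinates, whereas charts must
  take values in the model type; the dimension count provides the identification.\<close>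

lemma subspace_coordinates:
  fixes S :: "'v::euclidean_space set"
  assumes "subspace S" "dim S = DIM('e::euclidean_space)"
  obtains l :: "'v \<Rightarrow> 'e::euclidean_space" and l' where "linear l" "linear l'" "\<And>y. l' y \<in> S" "\<And>y. l (l' y) = y"
    "\<And>x. x \<in> S \<Longrightarrow> l' (l x) = x"
proof -
  have "dim S = dim (UNIV :: 'e set)" using assms(2) by simp
  then obtain f g where "linear f" "linear g" "f ` S = (UNIV :: 'e set)" "g ` UNIV = S"
    "\<And>x. x \<in> S \<Longrightarrow> g (f x) = x" "\<And>y. f (g y) = y"
    using isometries_subspaces[OF assms(1) subspace_UNIV] by (metis UNIV_I)
  then show thesis using that by (metis rangeI)
qed

text \<open>Turns a factorisation of maps into one of derivatives. With \<open>k = id\<close> it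
  shows that \<open>A\<close> is onto, and with an onto \<open>C\<close> it again shows that
  \<open>A\<close> is onto.\<close>

lemma has_derivative_factor:
  assumes "(g has_derivative B) (at x)" "(f has_derivative A) (at (g x))" "(k has_derivative C) (at x)"
    and "open N" "x \<in> N" "\<And>u. u \<in> N \<Longrightarrow> f (g u) = k u"
  shows "C = (\<lambda>v. A (B v))"
proof -
  have "((\<lambda>u. f (g u)) has_derivative (\<lambda>v. A (B v))) (at x)"
    using has_derivative_compose[OF assms(1,2)] .
  then have "(k has_derivative (\<lambda>v. A (B v))) (at x)"
    by (rule has_derivative_transform_within_open[OF _ assms(4-6)])
  then show ?thesis using has_derivative_unique[OF assms(3)] by simp
qed

lemma embedded_chart_image_open:
  assumes "(U, \<phi>) \<in> atlas (embedded X)" "openin (top_of_set X) U'"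
  shows "open (\<phi> ` (U \<inter> U'))"
proof -
  note c = assms(1)[unfolded embedded_simps]
  have "openin (top_of_set (\<phi> ` U)) {y \<in> \<phi> ` U. inv_into U \<phi> y \<in> U'}"
    by (rule openin_smooth_on_preimage_openin[OF _ _ assms(2)]) (use c openin_imp_subset in \<open>auto simp: inv_into_f_f\<close>)
  moreover have "{y \<in> \<phi> ` U. inv_into U \<phi> y \<in> U'} = \<phi> ` (U \<inter> U')" using c by (auto simp: inv_into_f_f)
  ultimately show ?thesis using c by (metis openin_open_trans)
qed

text \<open>\<open>h\<close> descends to a chart of the quotient: it separates exactly the fibres of \<open>\<pi>\<close> and has a smooth
  section through every point.\<close>

definition quotient_chart ::
  "'a::euclidean_space set \<Rightarrow> ('a \<Rightarrow> 'q) \<Rightarrow> 'a set \<Rightarrow> ('a \<Rightarrow> 'e::euclidean_space) \<Rightarrow> bool" where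
  "quotient_chart X \<pi> W h \<longleftrightarrow> openin (top_of_set X) W \<and>
     (\<forall>a\<in>W. \<forall>b\<in>X. \<pi> a = \<pi> b \<longrightarrow> b \<in> W) \<and> open (h ` W) \<and> smooth_on W h \<and>
     (\<forall>a\<in>W. \<forall>b\<in>W. \<pi> a = \<pi> b \<longleftrightarrow> h a = h b) \<and>
     (\<forall>a\<in>W. \<exists>\<sigma>. smooth_on (h ` W) \<sigma> \<and> \<sigma> ` h ` W \<subseteq> W \<and> (\<forall>y\<in>h ` W. h (\<sigma> y) = y) \<and> \<sigma> (h a) = a)"

lemma quotient_chartD:
  assumes "quotient_chart X \<pi> W h"
  shows "openin (top_of_set X) W" "W \<subseteq> X" "open (h ` W)" "smooth_on W h"
    "\<And>a b. a \<in> W \<Longrightarrow> b \<in> X \<Longrightarrow> \<pi> a = \<pi> b \<Longrightarrow> b \<in> W"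
    "\<And>a b. a \<in> W \<Longrightarrow> b \<in> W \<Longrightarrow> \<pi> a = \<pi> b \<longleftrightarrow> h a = h b"
  using assms openin_imp_subset unfolding quotient_chart_def by blast+

lemma quotient_chart_section:
  assumes "quotient_chart X \<pi> W h" "a \<in> W"
  obtains \<sigma> where "smooth_on (h ` W) \<sigma>" "\<sigma> ` h ` W \<subseteq> W" "\<forall>y\<in>h ` W. h (\<sigma> y) = y" "\<sigma> (h a) = a"
  using assms unfolding quotient_chart_def by blast

text \<open>The atlas is known only through its submersion condition. A quotient chart belongs to it
  because a section provides a right inverse of the derivative. Conversely an arbitrary member of
  the atlas acquires local sections by comparison with a quotient chart of the same dimension, using
  the inverse mapping result.\<close>

lemma presents_quotient_manifold:
  fixes X :: "'a::euclidean_space set" and \<pi> :: "'a \<Rightarrow> 'q"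
  assumes E: "presents X id (embedded X :: ('a, 'd::euclidean_space) charted_space)"
    and H: "\<And>x. x \<in> X \<Longrightarrow> \<exists>W (h :: 'a \<Rightarrow> real ^ 'n). x \<in> W \<and> quotient_chart X \<pi> W h"
  shows "presents X \<pi> (quotient_manifold (embedded X :: ('a, 'd) charted_space) \<pi> :: ('q, real ^ 'n) charted_space)"
    (is "presents X \<pi> ?M")
proof -
  let ?E = "embedded X :: ('a, 'd) charted_space"
  have und: "underlying ?M = quotient_topology (top_of_set X) \<pi>"
    by (simp add: quotient_manifold_def embedded_simps)
  have at: "(V, \<psi>) \<in> atlas ?M \<longleftrightarrow> openin (quotient_topology (top_of_set X) \<pi>) V \<and>
      inj_on \<psi> V \<and> open (\<psi> ` V) \<and>
      (\<forall>(U, \<phi>)\<in>atlas ?E. smooth_on (\<phi> ` {x \<in> U. \<pi> x \<in> V}) (\<psi> \<circ> \<pi> \<circ> inv_into U \<phi>) \<and>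
         (\<forall>y \<in> \<phi> ` {x \<in> U. \<pi> x \<in> V}. surj (frechet_derivative (\<psi> \<circ> \<pi> \<circ> inv_into U \<phi>) (at y))))" for V \<psi>
    by (simp add: quotient_manifold_def embedded_simps(1))
  have chart_at: "\<exists>U \<phi>. (U, \<phi>) \<in> atlas ?E \<and> x \<in> U" if "x \<in> X" for x
    using presents_covered[OF E that] by (metis id_apply)
  have cover: "\<exists>V \<psi>. (V, \<psi>) \<in> atlas ?M \<and> \<pi> x \<in> V" if x: "x \<in> X" for x
  proof -
    obtain W and h :: "'a \<Rightarrow> real ^ 'n" where xW: "x \<in> W" and qc: "quotient_chart X \<pi> W h"
      using H[OF x] by blast
    note oW = quotient_chartD(1)[OF qc] and WX = quotient_chartD(2)[OF qc] and oh = quotient_chartD(3)[OF qc]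
      and sh = quotient_chartD(4)[OF qc] and sat = quotient_chartD(5)[OF qc] and eq = quotient_chartD(6)[OF qc]
    obtain \<psi> where \<psi>: "\<And>a. a \<in> W \<Longrightarrow> \<psi> (\<pi> a) = h a"
      using function_factors_left_gen[of "\<lambda>a. a \<in> W" \<pi> h] eq by metis
    have pre: "{a \<in> X. \<pi> a \<in> \<pi> ` W} = W" using sat WX by auto
    have "(\<pi> ` W, \<psi>) \<in> atlas ?M"
      unfolding at
    proof (intro conjI)
      show "openin (quotient_topology (top_of_set X) \<pi>) (\<pi> ` W)"
        using oW WX pre by (auto simp: openin_quotient_topology)
      show "inj_on \<psi> (\<pi> ` W)" by (auto simp: inj_on_def \<psi> eq)
      have "\<psi> ` \<pi> ` W = h ` W" by (simp add: image_image \<psi>)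
      then show "open (\<psi> ` \<pi> ` W)" using oh by simp
      show "\<forall>(U, \<phi>)\<in>atlas ?E. smooth_on (\<phi> ` {x \<in> U. \<pi> x \<in> \<pi> ` W}) (\<psi> \<circ> \<pi> \<circ> inv_into U \<phi>) \<and>
         (\<forall>y \<in> \<phi> ` {x \<in> U. \<pi> x \<in> \<pi> ` W}. surj (frechet_derivative (\<psi> \<circ> \<pi> \<circ> inv_into U \<phi>) (at y)))"
      proof (clarify, intro conjI ballI)
        fix U and \<phi> :: "'a \<Rightarrow> 'd" assume c: "(U, \<phi>) \<in> atlas ?E"
        note ch = c[unfolded embedded_simps]
        have UW: "{x \<in> U. \<pi> x \<in> \<pi> ` W} = U \<inter> W"
          using pre openin_imp_subset ch WX by blast
        have oD: "open (\<phi> ` (U \<inter> W))" using embedded_chart_image_open[OF c oW] .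
        have inv_UW: "inv_into U \<phi> y \<in> U \<inter> W" if "y \<in> \<phi> ` (U \<inter> W)" for y
          using that ch by (auto simp: inv_into_f_f)
        have "smooth_on (\<phi> ` (U \<inter> W)) (\<lambda>y. h (inv_into U \<phi> y))"
          by (rule smooth_on_compose[OF smooth_on_subset[of "\<phi> ` U"] sh]) (use ch inv_UW in auto)
        then have s: "smooth_on (\<phi> ` (U \<inter> W)) (\<psi> \<circ> \<pi> \<circ> inv_into U \<phi>)"
          by (rule smooth_on_cong[THEN iffD1, rotated]) (use inv_UW \<psi> in auto)
        then show "smooth_on (\<phi> ` {x \<in> U. \<pi> x \<in> \<pi> ` W}) (\<psi> \<circ> \<pi> \<circ> inv_into U \<phi>)" unfolding UW .
        fix y assume "y \<in> \<phi> ` {x \<in> U. \<pi> x \<in> \<pi> ` W}"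
        then obtain x where xx: "x \<in> U" "x \<in> W" "y = \<phi> x" unfolding UW by auto
        then obtain \<sigma> where \<sigma>: "smooth_on (h ` W) \<sigma>" "\<sigma> ` h ` W \<subseteq> W" "\<forall>y\<in>h ` W. h (\<sigma> y) = y" "\<sigma> (h x) = x"
          using quotient_chart_section[OF qc, of x] by metis
        define N where "N = {w \<in> h ` W. \<sigma> w \<in> U}"
        have oN: "open N"
          unfolding N_def using openin_smooth_on_preimage_openin[of "h ` W" \<sigma> X U] \<sigma>(1,2) WX ch oh
          by (meson openin_open_trans subset_trans)
        have sN: "smooth_on N (\<lambda>w. \<phi> (\<sigma> w))"
          by (rule smooth_on_compose[OF smooth_on_subset[OF \<sigma>(1)], of N U]) (use ch in \<open>auto simp: N_def\<close>)
        have hN: "h x \<in> N" using xx \<sigma> by (auto simp: N_def)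
        let ?k = "\<psi> \<circ> \<pi> \<circ> inv_into U \<phi>"
        \<comment> \<open>\<open>h (\<sigma> w) = w\<close>, so differentiating exhibits a right
          inverse of the derivative of \<open>?k\<close>.\<close>
        have "id = (\<lambda>v. frechet_derivative ?k (at (\<phi> (\<sigma> (h x)))) (frechet_derivative (\<lambda>w. \<phi> (\<sigma> w)) (at (h x)) v))"
        proof (rule has_derivative_factor[OF smooth_on_has_derivative[OF sN oN hN] _ has_derivative_id oN hN])
          show "(?k has_derivative frechet_derivative ?k (at (\<phi> (\<sigma> (h x))))) (at (\<phi> (\<sigma> (h x))))"
            by (rule smooth_on_has_derivative[OF s oD]) (use xx \<sigma> in auto)
          fix w assume w: "w \<in> N"
          then show "?k (\<phi> (\<sigma> w)) = id w"
            using ch \<sigma>(2,3) by (auto simp: N_def inv_into_f_f \<psi> image_subset_iff)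
        qed
        then have "v = frechet_derivative ?k (at y) (frechet_derivative (\<lambda>w. \<phi> (\<sigma> w)) (at (h x)) v)" for v
          using xx(3) \<sigma>(4) by (metis id_apply)
        then show "surj (frechet_derivative ?k (at y))" by (metis surjI)
      qed
    qed
    then show ?thesis using xW by blast
  qed
  have smooth: "smooth_on {x \<in> X. \<pi> x \<in> V} (\<psi> \<circ> \<pi>)"
    and openV: "openin (top_of_set X) {x \<in> X. \<pi> x \<in> V}" if d: "(V, \<psi>) \<in> atlas ?M" for V \<psi>
  proof -
    note dh = d[unfolded at]
    show oX: "openin (top_of_set X) {x \<in> X. \<pi> x \<in> V}" using dh by (simp add: openin_quotient_topology)
    show "smooth_on {x \<in> X. \<pi> x \<in> V} (\<psi> \<circ> \<pi>)"
    proof (rule smooth_on_local)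
      fix x assume x: "x \<in> {x \<in> X. \<pi> x \<in> V}"
      then obtain U \<phi> where c: "(U, \<phi>) \<in> atlas ?E" and xU: "x \<in> U" using chart_at by blast
      note ch = c[unfolded embedded_simps]
      have k: "smooth_on (\<phi> ` {x \<in> U. \<pi> x \<in> V}) (\<psi> \<circ> \<pi> \<circ> inv_into U \<phi>)" using dh c by fast
      have "smooth_on {x \<in> U. \<pi> x \<in> V} (\<lambda>u. (\<psi> \<circ> \<pi> \<circ> inv_into U \<phi>) (\<phi> u))"
        by (rule smooth_on_compose[OF smooth_on_subset[of U] k]) (use ch in auto)
      then have "smooth_on {x \<in> U. \<pi> x \<in> V} (\<psi> \<circ> \<pi>)"
        by (rule smooth_on_cong[THEN iffD1, rotated]) (use ch in \<open>auto simp: inv_into_f_f\<close>)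
      moreover have "{x \<in> U. \<pi> x \<in> V} = U \<inter> {x \<in> X. \<pi> x \<in> V}" using ch openin_imp_subset by blast
      moreover have "openin (top_of_set {x \<in> X. \<pi> x \<in> V}) (U \<inter> {x \<in> X. \<pi> x \<in> V})"
        using ch by (metis (no_types, lifting) Int_lower2 oX openin_Int openin_imp_subset openin_subset_trans)
      ultimately show "\<exists>W. openin (top_of_set {x \<in> X. \<pi> x \<in> V}) W \<and> x \<in> W \<and> smooth_on W (\<psi> \<circ> \<pi>)"
        using x xU by (intro exI[of _ "{x \<in> U. \<pi> x \<in> V}"]) auto
    qed
  qed
  have section_ex: "\<exists>N \<sigma>. open N \<and> y \<in> N \<and> N \<subseteq> \<psi> ` V \<and> smooth_on N \<sigma> \<and> \<sigma> ` N \<subseteq> X \<and> (\<forall>u\<in>N. \<pi> (\<sigma> u) = inv_into V \<psi> u)"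
    if d: "(V, \<psi>) \<in> atlas ?M" and y: "y \<in> \<psi> ` V" for V \<psi> y
  proof -
    note dh = d[unfolded at]
    obtain x where x: "x \<in> X" "\<pi> x \<in> V" "y = \<psi> (\<pi> x)"
      using y dh openin_subset[of "quotient_topology (top_of_set X) \<pi>" V]
      by (auto simp: topspace_quotient_topology)
    obtain W and h :: "'a \<Rightarrow> real ^ 'n" where xW: "x \<in> W" and qc: "quotient_chart X \<pi> W h"
      using H[OF x(1)] by blast
    note oW = quotient_chartD(1)[OF qc] and WX = quotient_chartD(2)[OF qc] and oh = quotient_chartD(3)[OF qc]
      and sh = quotient_chartD(4)[OF qc] and eq = quotient_chartD(6)[OF qc]
    obtain \<sigma> where \<sigma>: "smooth_on (h ` W) \<sigma>" "\<sigma> ` h ` W \<subseteq> W" "\<forall>y\<in>h ` W. h (\<sigma> y) = y" "\<sigma> (h x) = x"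
      using quotient_chart_section[OF qc xW] .
    have \<sigma>W: "\<sigma> w \<in> W" if "w \<in> h ` W" for w using \<sigma>(2) that by blast
    have \<pi>\<sigma>: "\<pi> (\<sigma> (h a)) = \<pi> a" if "a \<in> W" for a
      using eq[of "\<sigma> (h a)" a] \<sigma>(3) \<sigma>W that by auto
    let ?XV = "{x \<in> X. \<pi> x \<in> V}"
    define N where "N = {w \<in> h ` W. \<sigma> w \<in> ?XV}"
    \<comment> \<open>The change of coordinates from the quotient chart \<open>h\<close> to the
      given chart \<open>\<psi>\<close>. Once it is inverted, its inverse followed by
      \<open>\<sigma>\<close> is the wanted section.\<close>
    define f where "f w = \<psi> (\<pi> (\<sigma> w))" for w
    have oN: "open N"
      unfolding N_def using openin_smooth_on_preimage_openin[OF \<sigma>(1) _ openV[OF d]] \<sigma>(2) WX oh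
      by (meson openin_open_trans subset_trans)
    have sf: "smooth_on N f"
      unfolding f_def using smooth_on_compose[OF smooth_on_subset[OF \<sigma>(1)] smooth[OF d], of N]
      by (auto simp: N_def)
    have injf: "inj_on f N"
    proof (rule inj_onI)
      fix v w assume vw: "v \<in> N" "w \<in> N" "f v = f w"
      then have "\<pi> (\<sigma> v) = \<pi> (\<sigma> w)" using dh by (auto simp: N_def f_def dest: inj_onD)
      then have "h (\<sigma> v) = h (\<sigma> w)" using eq \<sigma>W vw by (auto simp: N_def)
      then show "v = w" using \<sigma>(3) vw by (auto simp: N_def)
    qed
    have surjf: "surj (frechet_derivative f (at w))" if w: "w \<in> N" for w
    proof -
      have wX: "\<sigma> w \<in> W" "\<sigma> w \<in> X" "\<pi> (\<sigma> w) \<in> V" "h (\<sigma> w) = w" using w \<sigma>W \<sigma>(3) by (auto simp: N_def)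
      then obtain U \<phi> where c: "(U, \<phi>) \<in> atlas ?E" and xU: "\<sigma> w \<in> U" using chart_at by blast
      note ch = c[unfolded embedded_simps]
      let ?k = "\<psi> \<circ> \<pi> \<circ> inv_into U \<phi>" and ?D = "\<phi> ` (U \<inter> (W \<inter> ?XV))"
      have XV: "{x \<in> U. \<pi> x \<in> V} = U \<inter> ?XV" using ch openin_imp_subset by blast
      have k: "smooth_on (\<phi> ` (U \<inter> ?XV)) ?k" and kd: "surj (frechet_derivative ?k (at (\<phi> (\<sigma> w))))"
        using dh c xU wX unfolding XV[symmetric] by fast+
      have oD: "open ?D" using embedded_chart_image_open[OF c openin_Int[OF oW openV[OF d]]] .
      have wD: "\<phi> (\<sigma> w) \<in> ?D" using xU wX by auto
      have inv_D: "inv_into U \<phi> u \<in> U \<inter> (W \<inter> ?XV)" if "u \<in> ?D" for u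
        using that ch by (auto simp: inv_into_f_f)
      have "smooth_on ?D (inv_into U \<phi>)" by (rule smooth_on_subset[of "\<phi> ` U"]) (use ch in auto)
      then have s: "smooth_on ?D (\<lambda>u. h (inv_into U \<phi> u))"
        by (rule smooth_on_compose[OF _ sh]) (use inv_D in auto)
      \<comment> \<open>\<open>?k\<close> factors through \<open>f\<close>, so surjectivity of its
        derivative passes to that of \<open>f\<close>.\<close>
      have "frechet_derivative ?k (at (\<phi> (\<sigma> w))) = (\<lambda>v. frechet_derivative f (at (h (inv_into U \<phi> (\<phi> (\<sigma> w)))))
          (frechet_derivative (\<lambda>u. h (inv_into U \<phi> u)) (at (\<phi> (\<sigma> w))) v))"
      proof (rule has_derivative_factor[OF smooth_on_has_derivative[OF s oD wD] _ _ oD wD])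
        show "(f has_derivative frechet_derivative f (at (h (inv_into U \<phi> (\<phi> (\<sigma> w))))))
            (at (h (inv_into U \<phi> (\<phi> (\<sigma> w)))))"
          by (rule smooth_on_has_derivative[OF sf oN]) (use ch xU wX w in \<open>auto simp: inv_into_f_f\<close>)
        show "(?k has_derivative frechet_derivative ?k (at (\<phi> (\<sigma> w)))) (at (\<phi> (\<sigma> w)))"
          by (rule smooth_on_has_derivative[OF smooth_on_subset[OF k] oD wD]) auto
        show "f (h (inv_into U \<phi> u)) = ?k u" if "u \<in> ?D" for u
          using inv_D[OF that] \<pi>\<sigma> by (auto simp: f_def)
      qed
      then show ?thesis using kd ch xU wX by (auto simp: inv_into_f_f surj_def)
    qed
    note inv = smooth_on_inverse_map[OF sf oN injf surjf]
    have invN: "inv_into N f u \<in> N" "f (inv_into N f u) = u" if "u \<in> f ` N" for u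
      using that by (auto simp: inv_into_into f_inv_into_f)
    have N: "w \<in> h ` W" "\<sigma> w \<in> X" "\<pi> (\<sigma> w) \<in> V" "\<psi> (\<pi> (\<sigma> w)) = f w" if "w \<in> N" for w
      using that by (auto simp: N_def f_def)
    show ?thesis
    proof (intro exI[of _ "f ` N"] exI[of _ "\<lambda>u. \<sigma> (inv_into N f u)"] conjI ballI)
      show "open (f ` N)" by (rule inv(1))
      have "h x \<in> N" "f (h x) = y" using xW x \<sigma> by (auto simp: N_def f_def)
      then show "y \<in> f ` N" by auto
      show "f ` N \<subseteq> \<psi> ` V" by (auto simp: f_def N_def)
      show "smooth_on (f ` N) (\<lambda>u. \<sigma> (inv_into N f u))"
        by (rule smooth_on_compose[OF inv(2) \<sigma>(1)]) (use invN(1) N(1) in auto)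
      show "(\<lambda>u. \<sigma> (inv_into N f u)) ` f ` N \<subseteq> X"
        using invN(1) N(2) by auto
      show "\<pi> (\<sigma> (inv_into N f u)) = inv_into V \<psi> u" if "u \<in> f ` N" for u
        using invN[OF that] N dh inv_into_f_f[of \<psi> V "\<pi> (\<sigma> (inv_into N f u))"] by auto
    qed
  qed
  show ?thesis
    unfolding presents_def
  proof (intro conjI ballI)
    show "(\<Union>(U, \<phi>)\<in>atlas ?M. U) = topspace (underlying ?M)"
    proof
      show "(\<Union>(U, \<phi>)\<in>atlas ?M. U) \<subseteq> topspace (underlying ?M)"
        unfolding und by (auto simp: at dest!: openin_subset)
      show "topspace (underlying ?M) \<subseteq> (\<Union>(U, \<phi>)\<in>atlas ?M. U)"
        unfolding und topspace_quotient_topology using cover by fastforce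
    qed
    fix c assume c: "c \<in> atlas ?M"
    obtain V \<psi> where [simp]: "c = (V, \<psi>)" by (cases c)
    show "case c of (V, \<psi>) \<Rightarrow> openin (underlying ?M) V \<and> inj_on \<psi> V \<and> open (\<psi> ` V) \<and>
        smooth_on {x \<in> X. \<pi> x \<in> V} (\<psi> \<circ> \<pi>) \<and>
        (\<forall>y\<in>\<psi> ` V. \<exists>N \<sigma>. open N \<and> y \<in> N \<and> N \<subseteq> \<psi> ` V \<and> smooth_on N \<sigma> \<and> \<sigma> ` N \<subseteq> X \<and>
           (\<forall>u\<in>N. \<pi> (\<sigma> u) = inv_into V \<psi> u))"
      using c at[of V \<psi>] smooth[of V \<psi>] section_ex[of V \<psi>] by (simp add: und)
  qed (rule und)
qed

section \<open>Charts of spheres\<close>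

text \<open>For a unit vector \<open>p\<close>, the orthogonal projection along \<open>p\<close>.
  Together with \<open>dome\<close> it forms the graph chart of the open hemisphere centred at
  \<open>p\<close>, over the unit ball in the complement of \<open>p\<close>.\<close>

definition flat :: "'v::euclidean_space \<Rightarrow> 'v \<Rightarrow> 'v" where
  "flat p v = v - (v \<bullet> p) *\<^sub>R p"

definition dome :: "'v::euclidean_space \<Rightarrow> 'v \<Rightarrow> 'v" where
  "dome p y = y + sqrt (1 - y \<bullet> y) *\<^sub>R p"

lemma linear_flat: "linear (flat p)"
  by (rule linearI) (auto simp: flat_def algebra_simps inner_add_left)

lemma dome:
  assumes "norm p = 1" "y \<bullet> p = 0" "norm y < 1"
  shows "norm (dome p y) = 1" "dome p y \<bullet> p > 0" "flat p (dome p y) = y"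
proof -
  have p: "p \<bullet> p = 1" using assms(1) by (simp add: norm_eq_1)
  have y: "y \<bullet> y < 1" using assms(3) by (simp add: dot_square_norm abs_square_less_1)
  have "dome p y \<bullet> dome p y = 1"
    using assms(2) p y by (simp add: dome_def inner_add_left inner_add_right inner_commute[of p y] flip: power2_eq_square)
  then show "norm (dome p y) = 1" by (simp add: norm_eq_1)
  show "dome p y \<bullet> p > 0" using assms(2) p y by (simp add: dome_def inner_add_left)
  show "flat p (dome p y) = y" using assms(2) p by (simp add: dome_def flat_def inner_add_left)
qed

lemma flat:
  assumes "norm p = 1" "norm v = 1" "v \<bullet> p > 0"
  shows "flat p v \<bullet> p = 0" "norm (flat p v) < 1" "dome p (flat p v) = v"
proof -
  have p: "p \<bullet> p = 1" "v \<bullet> v = 1" using assms(1,2) by (simp_all add: norm_eq_1)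
  have sq: "flat p v \<bullet> flat p v = 1 - (v \<bullet> p)\<^sup>2"
    using p by (simp add: flat_def inner_diff_left inner_diff_right inner_commute[of p v] power2_eq_square)
  show "flat p v \<bullet> p = 0" using p by (simp add: flat_def inner_diff_left)
  have "(norm (flat p v))\<^sup>2 < 1\<^sup>2" using sq assms(3) by (simp add: power2_norm_eq_inner)
  then show "norm (flat p v) < 1" using power_less_imp_less_base by fastforce
  show "dome p (flat p v) = v" using assms(3) by (simp add: dome_def sq) (simp add: flat_def)
qed

lemma smooth_on_flat [smooth_intros]: "smooth_on S f \<Longrightarrow> smooth_on S (\<lambda>x. flat p (f x))"
  by (rule smooth_on_linear[OF linear_flat])

lemma smooth_on_dome [smooth_intros]:
  assumes "smooth_on S f" "\<And>x. x \<in> S \<Longrightarrow> norm (f x) < 1" shows "smooth_on S (\<lambda>x. dome p (f x))"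
proof -
  have "f x \<bullet> f x < 1" if "x \<in> S" for x
    using assms(2)[OF that] by (simp add: dot_square_norm abs_square_less_1)
  then show ?thesis unfolding dome_def by (intro smooth_intros assms) auto
qed

text \<open>Around \<open>(p, q)\<close> the product of the two hemispheres is projected to the
  product of the complements of \<open>p\<close> and \<open>q\<close>. The two lost normal
  directions are the \<open>+ 2\<close>.\<close>

lemma presents_sphere_product:
  assumes "DIM('a::euclidean_space) + DIM('b::euclidean_space) = DIM('e::euclidean_space) + 2"
  shows "presents (sphere 0 1 \<times> sphere 0 1) id (embedded (sphere 0 1 \<times> sphere 0 1) :: ('a \<times> 'b, 'e) charted_space)"
proof (rule presents_embedded)
  let ?X = "sphere (0::'a) 1 \<times> sphere (0::'b) 1"
  fix x assume "x \<in> ?X"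
  then obtain p q where x: "x = (p, q)" and pq: "norm p = 1" "norm q = 1" by auto
  then have nz: "p \<noteq> 0" "q \<noteq> 0" by auto
  let ?S = "{a. p \<bullet> a = 0} \<times> {b. q \<bullet> b = 0}"
  have "subspace ?S" by (intro subspace_Times subspace_hyperplane)
  moreover have "dim ?S = DIM('e)"
    using assms nz DIM_positive[where 'a = 'a] DIM_positive[where 'a = 'b]
    by (simp add: dim_Times subspace_hyperplane dim_hyperplane)
  ultimately obtain l :: "'a \<times> 'b \<Rightarrow> 'e" and l' where l: "linear l" "linear l'" "\<And>y. l' y \<in> ?S" "\<And>y. l (l' y) = y"
    "\<And>x. x \<in> ?S \<Longrightarrow> l' (l x) = x" by (rule subspace_coordinates) (rule that)
  have perp: "fst (l' y) \<bullet> p = 0" "snd (l' y) \<bullet> q = 0" for y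
    using l(3)[of y] by (auto simp: inner_commute)
  define U where "U = {z \<in> ?X. fst z \<bullet> p > 0 \<and> snd z \<bullet> q > 0}"
  define \<phi> where "\<phi> z = l (flat p (fst z), flat q (snd z))" for z
  define \<sigma> where "\<sigma> y = (dome p (fst (l' y)), dome q (snd (l' y)))" for y
  define D where "D = {y. norm (fst (l' y)) < 1 \<and> norm (snd (l' y)) < 1}"
  have fl: "\<phi> z \<in> D \<and> \<sigma> (\<phi> z) = z" if "z \<in> U" for z
  proof -
    have z: "norm (fst z) = 1" "norm (snd z) = 1" "fst z \<bullet> p > 0" "snd z \<bullet> q > 0"
      using that by (auto simp: U_def)
    note f1 = flat[OF pq(1) z(1,3)] and f2 = flat[OF pq(2) z(2,4)]
    have "l' (\<phi> z) = (flat p (fst z), flat q (snd z))"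
      unfolding \<phi>_def by (rule l(5)) (use f1 f2 in \<open>auto simp: inner_commute\<close>)
    then show ?thesis using f1 f2 by (simp add: D_def \<sigma>_def)
  qed
  have dm: "\<sigma> y \<in> U \<and> \<phi> (\<sigma> y) = y" if "y \<in> D" for y
    using dome[OF pq(1) perp(1)[of y]] dome[OF pq(2) perp(2)[of y]] that l(4)[of y]
    by (auto simp: D_def \<sigma>_def U_def \<phi>_def)
  have im: "\<phi> ` U = D" using fl dm by force
  have inj: "inj_on \<phi> U" using fl by (metis inj_onI)
  have "continuous_on UNIV l'" using l(2) linear_continuous_on linear_conv_bounded_linear by blast
  then have oD: "open D" unfolding D_def by (intro open_Collect_conj open_Collect_less continuous_intros)
  have "(U, \<phi>) \<in> atlas (embedded ?X)"
    unfolding embedded_simps im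
  proof (intro conjI inj oD)
    have "U = ?X \<inter> {z. fst z \<bullet> p > 0 \<and> snd z \<bullet> q > 0}" by (auto simp: U_def)
    moreover have "open {z :: 'a \<times> 'b. fst z \<bullet> p > 0 \<and> snd z \<bullet> q > 0}"
      by (intro open_Collect_conj open_Collect_less continuous_intros)
    ultimately show "openin (top_of_set ?X) U" by auto
    show "smooth_on U \<phi>" unfolding \<phi>_def by (intro smooth_on_linear[OF l(1)] smooth_intros)
    have "smooth_on D l'" using smooth_on_linear[OF l(2) smooth_on_ident] by simp
    then have "smooth_on D \<sigma>" unfolding \<sigma>_def by (intro smooth_intros) (auto simp: D_def)
    then show "smooth_on D (inv_into U \<phi>)"
      by (rule smooth_on_cong[THEN iffD1, rotated]) (use dm inj inv_into_f_eq in metis)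
  qed
  moreover have "x \<in> U" using x pq by (auto simp: U_def norm_eq_1)
  ultimately show "\<exists>(U, \<phi>)\<in>atlas (embedded ?X :: ('a \<times> 'b, 'e) charted_space). x \<in> U" by blast
qed

lemma second_countable_euclidean: "second_countable (euclidean :: 'a::second_countable_topology topology)"
proof -
  obtain \<B> :: "'a set set" where B: "countable \<B>" "topological_basis \<B>" using ex_countable_basis by blast
  show ?thesis
    unfolding second_countable_def
  proof (intro exI[of _ \<B>] conjI allI impI ballI)
    show "openin euclidean V" if "V \<in> \<B>" for V using topological_basis_open[OF B(2) that] by simp
    show "\<exists>V\<in>\<B>. x \<in> V \<and> V \<subseteq> U" if "openin euclidean U \<and> x \<in> U" for U x
      using topological_basisE[OF B(2), of U x] that by (metis open_openin)
  qed (rule B(1))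
qed

text \<open>A complete continuous invariant induces a continuous injection of the compact quotient
  into a Hausdorff space, hence a homeomorphism onto its image, and the image inherits both
  properties from Euclidean space.\<close>

lemma quotient_topology_by_invariants:
  fixes X :: "'a::euclidean_space set" and J :: "'a \<Rightarrow> 'b::euclidean_space"
  assumes X: "compact X" and J: "continuous_on X J"
    and eq: "\<And>x y. x \<in> X \<Longrightarrow> y \<in> X \<Longrightarrow> \<pi> x = \<pi> y \<longleftrightarrow> J x = J y"
  shows "Hausdorff_space (quotient_topology (top_of_set X) \<pi>)"
    "second_countable (quotient_topology (top_of_set X) \<pi>)"
proof -
  let ?Q = "quotient_topology (top_of_set X) \<pi>"
  have top: "topspace ?Q = \<pi> ` X" by (simp add: topspace_quotient_topology)
  obtain K where K: "\<And>x. x \<in> X \<Longrightarrow> K (\<pi> x) = J x"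
    using function_factors_left_gen[of "\<lambda>x. x \<in> X" \<pi> J] eq by metis
  have "continuous_map (top_of_set X) ?Q \<pi>"
    unfolding continuous_map_def by (auto simp: top openin_quotient_topology)
  moreover have "compactin (top_of_set X) X" using X by simp
  ultimately have "compactin ?Q (\<pi> ` X)" by (rule image_compactin[rotated])
  then have "compact_space ?Q" by (simp add: compact_space_def top)
  moreover have "continuous_map ?Q (top_of_set (J ` X)) K"
    unfolding continuous_map_def
  proof (intro conjI allI impI)
    fix U assume "openin (top_of_set (J ` X)) U"
    then have "openin (top_of_set X) (X \<inter> J -` U)"
      by (rule continuous_openin_preimage[OF J, rotated]) auto
    moreover have "{x \<in> X. \<pi> x \<in> {q \<in> \<pi> ` X. K q \<in> U}} = X \<inter> J -` U"
      using K by auto (metis K)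
    ultimately show "openin ?Q {q \<in> topspace ?Q. K q \<in> U}"
      by (auto simp: openin_quotient_topology top)
  qed (use K in \<open>auto simp: top\<close>)
  moreover have "K ` topspace ?Q = topspace (top_of_set (J ` X))" using K by (force simp: top)
  moreover have "inj_on K (topspace ?Q)" using K eq by (auto simp: top inj_on_def)
  moreover have "Hausdorff_space (top_of_set (J ` X))" by (simp add: Hausdorff_space_subtopology)
  ultimately have "homeomorphic_map ?Q (top_of_set (J ` X)) K"
    by (intro continuous_imp_homeomorphic_map)
  then have h: "?Q homeomorphic_space top_of_set (J ` X)" using homeomorphic_map_imp_homeomorphic_space by blast
  show "Hausdorff_space ?Q" using homeomorphic_Hausdorff_space[OF h] by (simp add: Hausdorff_space_subtopology)
  show "second_countable ?Q"
    using homeomorphic_space_second_countability[OF h] second_countable_subtopology second_countable_euclidean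
    by blast
qed

section \<open>Integer powers and weighted circle actions\<close>

text \<open>On the unit circle this is the integer power; unlike \<open>powi\<close> it is smooth at \<open>0\<close>.\<close>

definition cpow :: "complex \<Rightarrow> int \<Rightarrow> complex" where
  "cpow z a = (if a \<ge> 0 then z ^ nat a else cnj z ^ nat (- a))"

lemma cpow_mult: "cpow (z * w) a = cpow z a * cpow w a"
  by (simp add: cpow_def power_mult_distrib)

lemma norm_cpow: "cmod (cpow z a) = cmod z ^ nat \<bar>a\<bar>"
  by (simp add: cpow_def norm_power)

lemma cpow_eq_0_iff: "cpow z a = 0 \<longleftrightarrow> z = 0 \<and> a \<noteq> 0"
  by (auto simp: cpow_def)

lemma cpow_0 [simp]: "cpow z 0 = 1" and cpow_1 [simp]: "cpow z 1 = z" and cpow_one [simp]: "cpow 1 a = 1"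
  by (auto simp: cpow_def)

lemma cpow_uminus: "cpow z (- a) = cnj (cpow z a)"
  by (auto simp: cpow_def)

lemma cnj_unit: "cmod t = 1 \<Longrightarrow> cnj t = inverse t"
  by (metis complex_norm_square inverse_unique of_real_1 power_one)

lemma cpow_unit: "cmod t = 1 \<Longrightarrow> cpow t a = t powi a"
  by (simp add: cpow_def power_int_def cnj_unit)

lemma cpow_add: "cmod t = 1 \<Longrightarrow> cpow t (a + b) = cpow t a * cpow t b"
  by (subst (1 2 3) cpow_unit; (intro power_int_add disjI1)?) auto

lemma cpow_unit_cancel: "cmod t = 1 \<Longrightarrow> cpow t a * cnj (cpow t a) = 1"
  by (metis add.right_inverse cpow_0 cpow_add cpow_uminus)

lemma smooth_on_cpow [smooth_intros]: "smooth_on S f \<Longrightarrow> smooth_on S (\<lambda>x. cpow (f x) a)"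
  unfolding cpow_def by (cases "a \<ge> 0") (simp_all add: smooth_intros)

section \<open>Weighted circle actions on the fibre and their orbits\<close>

type_synonym ('k, 'm) fibre = "(complex ^ 'k) \<times> (real ^ 'm)"

text \<open>The bundles have equal weights on all complex coordinates, but reducing them passes
  through unequal ones. For \<open>t\<close> off the unit circle this is still a smooth family of
  linear maps, though no longer isometric in general.\<close>

definition twist :: "('k \<Rightarrow> int) \<Rightarrow> complex \<Rightarrow> ('k::finite, 'm::finite) fibre \<Rightarrow> ('k, 'm) fibre" where
  "twist w t v = (\<chi> i. cpow t (w i) * fst v $ i, snd v)"

lemma twist_twist: "twist w t (twist w s v) = twist w (t * s) v"
  by (simp add: twist_def cpow_mult vec_eq_iff mult.assoc)

lemma twist_1 [simp]: "twist w 1 v = v" and twist_0_weight [simp]: "twist (\<lambda>_. 0) t v = v"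
  by (simp_all add: twist_def)

lemma linear_twist: "linear (twist w t)"
  by (rule linearI) (auto simp: twist_def vec_eq_iff distrib_left prod_eq_iff scaleR_conv_of_real)

lemma twist_cancel:
  assumes "cmod t = 1" shows "twist w (cnj t) (twist w t v) = v" "twist w t (twist w (cnj t) v) = v"
  using assms by (simp_all add: twist_twist cnj_unit) (metis norm_zero right_inverse twist_1 zero_neq_one left_inverse)+

lemma norm_twist [simp]: "cmod t = 1 \<Longrightarrow> norm (twist w t v) = norm v"
  by (simp add: twist_def norm_prod_def norm_vec_def norm_mult norm_cpow)

lemma smooth_on_twist [smooth_intros]:
  assumes "smooth_on S f" "smooth_on S g" shows "smooth_on S (\<lambda>x. twist w (f x) (g x))"
  unfolding twist_def by (intro smooth_intros assms)

lemma smooth_on_smult [smooth_intros]: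
  assumes "smooth_on S f" "smooth_on S g" shows "smooth_on S (\<lambda>x. (f x :: complex) *s g x)"
  unfolding vector_scalar_mult_def by (intro smooth_intros assms)

lemma norm_smult [simp]: "norm (t *s (z :: complex ^ 'n)) = cmod t * norm z"
  by (simp add: norm_vec_def norm_mult L2_set_right_distrib)

lemma circle_action_twist:
  "cmod t = 1 \<Longrightarrow> circle_action \<rho> t (z, v) = (t *s z, twist (\<lambda>_. \<rho>) t v)"
  by (cases v) (simp add: circle_action_def twist_def cpow_unit vector_scalar_mult_def)

lemma circle_orbit_twist:
  "circle_orbit \<rho> (z, v) = {(t *s z, twist (\<lambda>_. \<rho>) t v) | t. cmod t = 1}"
  unfolding circle_orbit_def by (intro Collect_cong ex_cong1) (metis circle_action_twist)

lemma circle_orbit_eq_iff: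
  "circle_orbit \<rho> (z, v) = circle_orbit \<rho> (z', v') \<longleftrightarrow>
     (\<exists>t. cmod t = 1 \<and> z' = t *s z \<and> v' = twist (\<lambda>_. \<rho>) t v)"
proof
  assume "circle_orbit \<rho> (z, v) = circle_orbit \<rho> (z', v')"
  moreover have "(z', v') \<in> circle_orbit \<rho> (z', v')"
    unfolding circle_orbit_twist by (force intro: exI[of _ 1])
  ultimately have "(z', v') \<in> circle_orbit \<rho> (z, v)" by simp
  then show "\<exists>t. cmod t = 1 \<and> z' = t *s z \<and> v' = twist (\<lambda>_. \<rho>) t v"
    unfolding circle_orbit_twist by auto
next
  assume "\<exists>t. cmod t = 1 \<and> z' = t *s z \<and> v' = twist (\<lambda>_. \<rho>) t v"
  then obtain t where t: "cmod t = 1" "z' = t *s z" "v' = twist (\<lambda>_. \<rho>) t v" by blast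
  have sub: "circle_orbit \<rho> (s *s x, twist (\<lambda>_. \<rho>) s u) \<subseteq> circle_orbit \<rho> (x, u)"
    if "cmod s = 1" for s x and u :: "('a, 'b) fibre"
  proof
    fix q assume "q \<in> circle_orbit \<rho> (s *s x, twist (\<lambda>_. \<rho>) s u)"
    then obtain r where "cmod r = 1" "q = ((r * s) *s x, twist (\<lambda>_. \<rho>) (r * s) u)"
      by (auto simp: circle_orbit_twist vector_smult_assoc twist_twist)
    then show "q \<in> circle_orbit \<rho> (x, u)"
      using that by (auto simp: circle_orbit_twist norm_mult intro!: exI[of _ "r * s"])
  qed
  have "circle_orbit \<rho> (cnj t *s (t *s z), twist (\<lambda>_. \<rho>) (cnj t) (twist (\<lambda>_. \<rho>) t v)) = circle_orbit \<rho> (z, v)"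
    using t(1) cpow_unit_cancel[OF t(1), of 1] by (simp add: vector_smult_assoc twist_cancel mult.commute)
  then show "circle_orbit \<rho> (z, v) = circle_orbit \<rho> (z', v')"
    using sub[OF t(1), of z v] sub[of "cnj t" z' v'] t by auto
qed

lemma norm_complex_2: "(norm (z :: complex ^ 2))\<^sup>2 = (cmod (z $ 1))\<^sup>2 + (cmod (z $ 2))\<^sup>2"
  by (simp add: norm_vec_def L2_set_def sum_2)

abbreviation total_set :: "((complex ^ 2) \<times> ('k::finite, 'm::finite) fibre) set" where
  "total_set \<equiv> sphere 0 1 \<times> sphere 0 1"

text \<open>On the unit sphere the first two entries determine the orbit of the base vector. The
  last two are the fibre vector with its phase compensated by a base coordinate; both are kept
  because either coordinate may vanish.\<close>

definition orbit_invariant ::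
  "int \<Rightarrow> (complex ^ 2) \<times> ('k::finite, 'm::finite) fibre
    \<Rightarrow> complex \<times> real \<times> ('k, 'm) fibre \<times> ('k, 'm) fibre" where
  "orbit_invariant \<rho> p = (fst p $ 1 * cnj (fst p $ 2), (cmod (fst p $ 1))\<^sup>2,
     twist (\<lambda>_. - \<rho>) (fst p $ 1) (snd p), twist (\<lambda>_. - \<rho>) (fst p $ 2) (snd p))"

lemma twist_uminus_invariant:
  "cmod t = 1 \<Longrightarrow> twist (\<lambda>_. - \<rho>) (t * c) (twist (\<lambda>_. \<rho>) t v) = twist (\<lambda>_. - \<rho>) c v"
  using cpow_unit_cancel[of t \<rho>] by (simp add: twist_def cpow_mult cpow_uminus vec_eq_iff algebra_simps)

lemma twist_uminus_cancel:
  assumes "twist (\<lambda>_. - \<rho>) (t * c) v' = twist (\<lambda>_. - \<rho>) c v" "c \<noteq> 0" "cmod t = 1"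
  shows "v' = twist (\<lambda>_. \<rho>) t v"
proof -
  have "cnj (cpow t \<rho>) * fst v' $ i = fst v $ i" for i
    using assms(1,2) by (auto simp: twist_def cpow_mult cpow_uminus vec_eq_iff cpow_eq_0_iff)
  then have "cpow t \<rho> * (cnj (cpow t \<rho>) * fst v' $ i) = cpow t \<rho> * fst v $ i" for i by simp
  then have "fst v' $ i = cpow t \<rho> * fst v $ i" for i
    using cpow_unit_cancel[OF assms(3), of \<rho>] by (simp flip: mult.assoc)
  then show ?thesis using assms(1) by (simp add: twist_def vec_eq_iff prod_eq_iff)
qed

lemma orbit_invariant_eq_iff:
  assumes "p \<in> total_set" "q \<in> total_set"
  shows "circle_orbit \<rho> p = circle_orbit \<rho> q \<longleftrightarrow> orbit_invariant \<rho> p = orbit_invariant \<rho> q"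
proof -
  obtain z v z' v' where pq: "p = (z, v)" "q = (z', v')" using surj_pair by metis
  have nz: "norm z = 1" "norm z' = 1" using assms pq by auto
  show ?thesis
  proof
    assume "circle_orbit \<rho> p = circle_orbit \<rho> q"
    then obtain t where t: "cmod t = 1" "z' = t *s z" "v' = twist (\<lambda>_. \<rho>) t v"
      unfolding pq circle_orbit_eq_iff by blast
    then show "orbit_invariant \<rho> p = orbit_invariant \<rho> q"
      using cpow_unit_cancel[of t 1] by (simp add: orbit_invariant_def pq twist_uminus_invariant norm_mult algebra_simps)
  next
    assume "orbit_invariant \<rho> p = orbit_invariant \<rho> q"
    then have J: "z $ 1 * cnj (z $ 2) = z' $ 1 * cnj (z' $ 2)" "cmod (z $ 1) = cmod (z' $ 1)"
      "twist (\<lambda>_. - \<rho>) (z $ 1) v = twist (\<lambda>_. - \<rho>) (z' $ 1) v'"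
      "twist (\<lambda>_. - \<rho>) (z $ 2) v = twist (\<lambda>_. - \<rho>) (z' $ 2) v'"
      by (auto simp: orbit_invariant_def pq)
    have "(cmod (z $ 2))\<^sup>2 = (cmod (z' $ 2))\<^sup>2"
      using norm_complex_2[of z] norm_complex_2[of z'] nz J(2) by (simp del: power2_eq_iff_nonneg)
    then have J5: "cmod (z $ 2) = cmod (z' $ 2)" by simp
    \<comment> \<open>The phase is the ratio of corresponding coordinates, taken where they do not
      vanish.\<close>
    have "\<exists>t. cmod t = 1 \<and> z' $ 1 = t * z $ 1 \<and> z' $ 2 = t * z $ 2"
    proof (cases "z $ 1 = 0")
      case True
      then have "z' $ 1 = 0" "z $ 2 \<noteq> 0" using J(2) norm_complex_2[of z] nz by auto
      then show ?thesis using True J5 by (intro exI[of _ "z' $ 2 / z $ 2"]) (auto simp: norm_divide)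
    next
      case False
      let ?t = "z' $ 1 / z $ 1"
      have "z' $ 1 \<noteq> 0" using J(2) False by (metis norm_eq_zero)
      then have t: "cmod ?t = 1" using J(2) by (simp add: norm_divide)
      have "cnj (z $ 2) = ?t * cnj (z' $ 2)" using J(1) False by (simp add: field_simps)
      then have "z $ 2 = cnj ?t * z' $ 2" by (metis complex_cnj_cnj complex_cnj_mult)
      then have "?t * z $ 2 = (?t * cnj ?t) * z' $ 2" by (simp only: mult.assoc)
      then have "z' $ 2 = ?t * z $ 2" using cpow_unit_cancel[OF t, of 1] by (simp only: cpow_1 mult_1_left)
      then show ?thesis using t False by (intro exI[of _ ?t]) auto
    qed
    then obtain t where t: "cmod t = 1" "z' $ 1 = t * z $ 1" "z' $ 2 = t * z $ 2" by blast
    have z': "z' = t *s z" using t by (simp add: vec_eq_iff forall_2)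
    have "z $ 1 \<noteq> 0 \<or> z $ 2 \<noteq> 0" using norm_complex_2[of z] nz by auto
    then have "v' = twist (\<lambda>_. \<rho>) t v"
      using twist_uminus_cancel[of \<rho> t "z $ 1" v' v] twist_uminus_cancel[of \<rho> t "z $ 2" v' v] J t by auto
    then show "circle_orbit \<rho> p = circle_orbit \<rho> q" unfolding pq circle_orbit_eq_iff using z' t by blast
  qed
qed

section \<open>The sphere bundles as smooth manifolds\<close>

text \<open>Where \<open>z $ i\<close> is nonzero, the phase that rotates it onto the positive real
  axis.\<close>

abbreviation hopf_phase :: "2 \<Rightarrow> complex ^ 2 \<Rightarrow> complex" where
  "hopf_phase i z \<equiv> sgn (cnj (z $ i))"

text \<open>The fibre coordinate of the bundle in its trivialisation over
  \<open>z $ i \<noteq> 0\<close>: the point is moved along its orbit until the coordinate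
  \<open>i\<close> of the base vector is positive.\<close>

definition local_fibre :: "int \<Rightarrow> 2 \<Rightarrow> (complex ^ 2) \<times> ('k::finite, 'm::finite) fibre \<Rightarrow> ('k, 'm) fibre" where
  "local_fibre \<rho> i a = twist (\<lambda>_. \<rho>) (hopf_phase i (fst a)) (snd a)"

text \<open>The unit representative with positive coordinate \<open>i\<close> of the projective
  point with affine coordinate \<open>\<zeta>\<close>.\<close>

definition affine_lift :: "2 \<Rightarrow> complex \<Rightarrow> complex ^ 2" where
  "affine_lift i \<zeta> = (\<chi> l. (if l = i then 1 else \<zeta>) / complex_of_real (sqrt (1 + (cmod \<zeta>)\<^sup>2)))"

lemma affine_lift_pos: "sqrt (1 + (cmod \<zeta>)\<^sup>2) > 0"
  by (simp add: add_pos_nonneg)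

lemma norm_affine_lift: "norm (affine_lift i \<zeta>) = 1"
proof -
  have "(norm (affine_lift i \<zeta>))\<^sup>2 = 1"
    using affine_lift_pos[of \<zeta>] exhaust_2[of i]
    by (auto simp: norm_complex_2 affine_lift_def norm_divide power_divide simp flip: add_divide_distrib)
  then show ?thesis by (simp add: power2_eq_1_iff) (smt (verit) norm_ge_zero)
qed

lemma affine_lift_recover:
  assumes z: "norm z = 1" and i: "z $ i \<noteq> 0" and j: "j \<noteq> i"
  shows "sgn (z $ i) *s affine_lift i (z $ j / z $ i) = z"
proof -
  have ij: "l = i \<or> l = j" for l using exhaust_2[of l] exhaust_2[of i] exhaust_2[of j] j by auto
  have "(cmod (z $ i))\<^sup>2 + (cmod (z $ j))\<^sup>2 = 1"
    using norm_complex_2[of z] z exhaust_2[of i] exhaust_2[of j] j by (auto simp: add.commute)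
  then have "1 + (cmod (z $ j / z $ i))\<^sup>2 = (1 / cmod (z $ i))\<^sup>2"
    using i by (simp add: norm_divide power_divide field_simps)
  then have "sqrt (1 + (cmod (z $ j / z $ i))\<^sup>2) = 1 / cmod (z $ i)"
    by (metis norm_ge_zero real_sqrt_unique zero_le_divide_1_iff)
  then show ?thesis
    using i j ij by (auto simp: vec_eq_iff affine_lift_def sgn_eq)
qed

lemma smooth_on_affine_lift [smooth_intros]:
  assumes "smooth_on S f" shows "smooth_on S (\<lambda>x. affine_lift i (f x))"
proof -
  have "1 + f x \<bullet> f x > 0" for x by (simp add: add_pos_nonneg)
  moreover have "smooth_on S (\<lambda>x. if l = i then 1 else f x)" for l
    by (cases "l = i") (auto intro: smooth_intros assms)
  ultimately show ?thesis
    unfolding affine_lift_def power2_norm_eq_inner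
    by (intro smooth_on_vec_lambda smooth_on_divide smooth_on_of_real smooth_on_sqrt smooth_on_add
        smooth_on_const smooth_on_inner assms) (auto simp: less_imp_neq[symmetric])
qed

lemma presents_total_space:
  "presents total_set id (total_space :: ((complex ^ 2) \<times> ('k::finite, 'm::finite) fibre, _) charted_space)"
  unfolding total_space_def
  by (rule presents_sphere_product) (simp add: DIM_prod)

lemma local_fibre_unit:
  assumes "fst a $ i \<noteq> 0"
  shows "norm (local_fibre \<rho> i a) = norm (snd a)" and "twist (\<lambda>_. \<rho>) (sgn (fst a $ i)) (local_fibre \<rho> i a) = snd a"
proof -
  have t: "cmod (sgn (fst a $ i)) = 1" using assms by (simp add: norm_sgn)
  have c: "hopf_phase i (fst a) = cnj (sgn (fst a $ i))" by (simp add: sgn_eq)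
  show "norm (local_fibre \<rho> i a) = norm (snd a)" using t by (simp add: local_fibre_def c)
  show "twist (\<lambda>_. \<rho>) (sgn (fst a $ i)) (local_fibre \<rho> i a) = snd a"
    unfolding local_fibre_def c using twist_cancel(2)[OF t] .
qed

lemma local_fibre_invariant:
  assumes "cmod t = 1"
  shows "local_fibre \<rho> i (t *s z, twist (\<lambda>_. \<rho>) t v) = local_fibre \<rho> i (z, v)"
proof -
  have "hopf_phase i (t *s z) * t = hopf_phase i z"
    using cpow_unit_cancel[OF assms, of 1] assms
    by (simp add: sgn_eq norm_mult) (metis (no_types, lifting) mult.assoc mult.commute mult_1)
  then show ?thesis by (simp add: local_fibre_def twist_twist)
qed

text \<open>The chart consists of the affine coordinate on the base and the hemisphere chart of the
  trivialised fibre coordinate. Both are constant on orbits, and together they determine the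
  orbit.\<close>

lemma sphere_bundle_charts:
  fixes a0 :: "(complex ^ 2) \<times> ('k::finite, 'm::finite) fibre"
  assumes a0: "a0 \<in> total_set"
  shows "\<exists>W (h :: _ \<Rightarrow> real ^ ('k + 'k + 'm + 1)). a0 \<in> W \<and> quotient_chart total_set (circle_orbit \<rho>) W h"
proof -
  let ?X = "total_set :: ((complex ^ 2) \<times> ('k, 'm) fibre) set"
  have "fst a0 $ 1 \<noteq> 0 \<or> fst a0 $ 2 \<noteq> 0" using norm_complex_2[of "fst a0"] a0 by auto
  then obtain i j where i: "fst a0 $ i \<noteq> 0" and j: "j \<noteq> (i :: 2)"
    by (metis exhaust_2 zero_neq_one)
  define p where "p = local_fibre \<rho> i a0"
  have p: "norm p = 1" using local_fibre_unit(1)[OF i] a0 by (auto simp: p_def)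
  then have p0: "p \<noteq> 0" by auto
  let ?S = "(UNIV :: complex set) \<times> {v. p \<bullet> v = 0}"
  have "subspace ?S" by (intro subspace_Times subspace_hyperplane subspace_UNIV)
  moreover have "dim ?S = DIM(real ^ ('k + 'k + 'm + 1))"
    using p0 DIM_positive[where 'a = "('k, 'm) fibre"]
    by (simp add: dim_Times subspace_hyperplane dim_hyperplane)
  ultimately obtain l :: "complex \<times> ('k, 'm) fibre \<Rightarrow> real ^ ('k + 'k + 'm + 1)" and l'
    where l: "linear l" "linear l'" "\<And>y. l' y \<in> ?S" "\<And>y. l (l' y) = y" "\<And>x. x \<in> ?S \<Longrightarrow> l' (l x) = x"
    by (rule subspace_coordinates) (rule that)
  have perp: "snd (l' y) \<bullet> p = 0" for y using l(3)[of y] by (auto simp: inner_commute)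
  define W where "W = {a \<in> ?X. fst a $ i \<noteq> 0 \<and> local_fibre \<rho> i a \<bullet> p > 0}"
  define h where "h a = l (fst a $ j / fst a $ i, flat p (local_fibre \<rho> i a))" for a
  \<comment> \<open>The phase \<open>t\<close> moves the section along the orbits, so that it can be
    made to pass through any prescribed point, as \<open>quotient_chart\<close> demands.\<close>
  define \<sigma> where "\<sigma> t y = (t *s affine_lift i (fst (l' y)), twist (\<lambda>_. \<rho>) t (dome p (snd (l' y))))" for t y
  define D where "D = {y. norm (snd (l' y)) < 1}"
  have hW: "h a \<in> D \<and> \<sigma> (sgn (fst a $ i)) (h a) = a" if "a \<in> W" for a
  proof -
    have a: "norm (fst a) = 1" "norm (snd a) = 1" "fst a $ i \<noteq> 0" "local_fibre \<rho> i a \<bullet> p > 0"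
      using that by (auto simp: W_def)
    note f = flat[OF p _ a(4), unfolded local_fibre_unit(1)[OF a(3)], OF a(2)]
    have "l' (h a) = (fst a $ j / fst a $ i, flat p (local_fibre \<rho> i a))"
      unfolding h_def by (rule l(5)) (use f in \<open>auto simp: inner_commute\<close>)
    then show ?thesis
      using f affine_lift_recover[OF a(1,3) j] local_fibre_unit(2)[OF a(3)]
      by (simp add: D_def \<sigma>_def)
  qed
  have \<sigma>D: "\<sigma> t y \<in> W \<and> h (\<sigma> t y) = y" if t: "cmod t = 1" and y: "y \<in> D" for t y
  proof -
    note d = dome[OF p perp[of y], of] y[unfolded D_def mem_Collect_eq]
    have s: "sqrt (1 + (cmod (fst (l' y)))\<^sup>2) > 0" by (rule affine_lift_pos)
    have lf: "local_fibre \<rho> i (\<sigma> t y) = dome p (snd (l' y))"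
    proof -
      have "local_fibre \<rho> i (\<sigma> t y) = local_fibre \<rho> i (affine_lift i (fst (l' y)), dome p (snd (l' y)))"
        unfolding \<sigma>_def by (rule local_fibre_invariant[OF t])
      also have "\<dots> = dome p (snd (l' y))"
        using s by (simp add: local_fibre_def affine_lift_def sgn_eq norm_divide)
      finally show ?thesis .
    qed
    have "fst (\<sigma> t y) $ i \<noteq> 0" using t s by (auto simp: \<sigma>_def affine_lift_def)
    moreover have "fst (\<sigma> t y) $ j / fst (\<sigma> t y) $ i = fst (l' y)"
      using t s j by (auto simp: \<sigma>_def affine_lift_def)
    moreover have "\<sigma> t y \<in> ?X" using t d by (simp add: \<sigma>_def norm_affine_lift)
    ultimately show ?thesis using d lf l(4)[of y] by (simp add: W_def h_def)
  qed
  have u: "cmod (sgn (fst a $ i)) = 1" if "a \<in> W" for a using that by (auto simp: W_def norm_sgn)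
  have im: "h ` W = D"
  proof
    show "h ` W \<subseteq> D" using hW by blast
    show "D \<subseteq> h ` W" using \<sigma>D[of 1] by (metis image_eqI norm_one subsetI)
  qed
  have orb: "b \<in> W \<and> h b = h a" if a: "a \<in> W" and b: "b \<in> ?X" and ab: "circle_orbit \<rho> a = circle_orbit \<rho> b" for a b
  proof -
    obtain t where t: "cmod t = 1" "fst b = t *s fst a" "snd b = twist (\<lambda>_. \<rho>) t (snd a)"
      using ab circle_orbit_eq_iff[of \<rho> "fst a" "snd a" "fst b" "snd b"] by auto
    then have "t \<noteq> 0" by auto
    moreover have "local_fibre \<rho> i b = local_fibre \<rho> i a"
      using local_fibre_invariant[OF t(1), of \<rho> i "fst a" "snd a"] t(2,3) by (metis prod.collapse)
    ultimately show ?thesis using a b t by (auto simp: W_def h_def)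
  qed
  have "quotient_chart ?X (circle_orbit \<rho>) W h"
    unfolding quotient_chart_def im
  proof (intro conjI ballI impI)
    have "smooth_on {a :: (complex ^ 2) \<times> ('k, 'm) fibre. fst a $ i \<noteq> 0} (\<lambda>a. local_fibre \<rho> i a \<bullet> p)"
      unfolding local_fibre_def by (intro smooth_intros) auto
    then have "continuous_on {a :: (complex ^ 2) \<times> ('k, 'm) fibre. fst a $ i \<noteq> 0} (\<lambda>a. local_fibre \<rho> i a \<bullet> p)"
      by (rule smooth_on_imp_continuous_on)
    moreover have "open {a :: (complex ^ 2) \<times> ('k, 'm) fibre. fst a $ i \<noteq> 0}"
      by (intro open_Collect_neq continuous_intros)
    ultimately have "open ({a. fst a $ i \<noteq> 0} \<inter> (\<lambda>a. local_fibre \<rho> i a \<bullet> p) -` {0<..})"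
      by (intro continuous_open_preimage) auto
    moreover have "W = ?X \<inter> ({a. fst a $ i \<noteq> 0} \<inter> (\<lambda>a. local_fibre \<rho> i a \<bullet> p) -` {0<..})"
      by (auto simp: W_def)
    ultimately show "openin (top_of_set ?X) W" by auto
    have "continuous_on UNIV l'" using l(2) linear_continuous_on linear_conv_bounded_linear by blast
    then show "open D" unfolding D_def by (intro open_Collect_less continuous_intros)
    show "smooth_on W h"
      unfolding h_def local_fibre_def by (intro smooth_on_linear[OF l(1)] smooth_intros) (auto simp: W_def)
    fix a assume a: "a \<in> W"
    show "b \<in> W" if "b \<in> ?X" "circle_orbit \<rho> a = circle_orbit \<rho> b" for b using orb[OF a that] by blast
    show "circle_orbit \<rho> a = circle_orbit \<rho> b \<longleftrightarrow> h a = h b" if b: "b \<in> W" for b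
    proof
      show "h a = h b" if "circle_orbit \<rho> a = circle_orbit \<rho> b"
        using orb[OF a _ that] b by (auto simp: W_def)
      assume hab: "h a = h b"
      have "circle_orbit \<rho> (\<sigma> t y) = circle_orbit \<rho> (\<sigma> 1 y)" if "cmod t = 1" for t y
        unfolding \<sigma>_def using that by (intro circle_orbit_eq_iff[THEN iffD2, symmetric]) auto
      then show "circle_orbit \<rho> a = circle_orbit \<rho> b"
        using hW[OF a] hW[OF b] u[OF a] u[OF b] hab by metis
    qed
    have "smooth_on D (\<sigma> (sgn (fst a $ i)))"
      unfolding \<sigma>_def by (intro smooth_intros smooth_on_linear[OF l(2)]) (auto simp: D_def)
    then show "\<exists>s. smooth_on D s \<and> s ` D \<subseteq> W \<and> (\<forall>y\<in>D. h (s y) = y) \<and> s (h a) = a"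
      using \<sigma>D[OF u[OF a]] hW[OF a] by (intro exI[of _ "\<sigma> (sgn (fst a $ i))"]) auto
  qed
  moreover have "a0 \<in> W" using a0 i p by (auto simp: W_def norm_eq_1 p_def[symmetric])
  ultimately show ?thesis by blast
qed

lemma presents_sphere_bundle:
  "presents (total_set :: ((complex ^ 2) \<times> ('k::finite, 'm::finite) fibre) set) (circle_orbit \<rho>)
     (sphere_bundle TYPE('k) TYPE('m) \<rho>)"
  unfolding sphere_bundle_def total_space_def
  by (rule presents_quotient_manifold[OF presents_total_space[unfolded total_space_def] sphere_bundle_charts])

lemma smooth_manifold_sphere_bundle:
  "smooth_manifold (sphere_bundle TYPE('k::finite) TYPE('m::finite) \<rho>)"
proof -
  let ?X = "total_set :: ((complex ^ 2) \<times> ('k, 'm) fibre) set"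
  have und: "underlying (sphere_bundle TYPE('k) TYPE('m) \<rho>) = quotient_topology (top_of_set ?X) (circle_orbit \<rho>)"
    using presents_sphere_bundle by (auto simp: presents_def)
  have "compact ?X" by (intro compact_Times compact_sphere)
  moreover have "smooth_on ?X (orbit_invariant \<rho>)"
    unfolding orbit_invariant_def power2_norm_eq_inner by (intro smooth_intros)
  then have "continuous_on ?X (orbit_invariant \<rho>)" by (rule smooth_on_imp_continuous_on)
  ultimately show ?thesis
    using quotient_topology_by_invariants[of ?X "orbit_invariant \<rho>" "circle_orbit \<rho>", OF _ _ orbit_invariant_eq_iff]
    by (intro presents_smooth_manifold[OF presents_sphere_bundle]) (simp_all add: und)
qed

section \<open>Gauge equivalence of circle actions\<close>

text \<open>The actions \<open>T\<close> and \<open>T'\<close> on \<open>'v\<close> are intertwined by a family of isometries over the punctured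
  plane: the associated vector bundles over the projective line are isomorphic.\<close>

definition gauge ::
  "(complex \<Rightarrow> 'v \<Rightarrow> 'v) \<Rightarrow> (complex \<Rightarrow> 'v \<Rightarrow> 'v) \<Rightarrow>
     (complex ^ 2 \<Rightarrow> 'v \<Rightarrow> 'v) \<Rightarrow> (complex ^ 2 \<Rightarrow> 'v \<Rightarrow> 'v::euclidean_space) \<Rightarrow> bool" where
  "gauge T T' A A' \<longleftrightarrow>
     smooth_on ((- {0}) \<times> UNIV) (\<lambda>p. A (fst p) (snd p)) \<and>
     smooth_on ((- {0}) \<times> UNIV) (\<lambda>p. A' (fst p) (snd p)) \<and>
     (\<forall>z. z \<noteq> 0 \<longrightarrow> linear (A z) \<and> linear (A' z) \<and>
       (\<forall>v. A' z (A z v) = v \<and> A z (A' z v) = v \<and> norm (A z v) = norm v) \<and>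
       (\<forall>t v. cmod t = 1 \<longrightarrow> A (t *s z) (T t v) = T' t (A z v)))"

definition gauge_equiv ::
  "(complex \<Rightarrow> 'v \<Rightarrow> 'v) \<Rightarrow> (complex \<Rightarrow> 'v \<Rightarrow> 'v::euclidean_space) \<Rightarrow> bool" where
  "gauge_equiv T T' \<longleftrightarrow> (\<exists>A A'. gauge T T' A A')"

lemma gauge_equivI:
  fixes A A' :: "complex ^ 2 \<Rightarrow> 'v \<Rightarrow> 'v::euclidean_space"
  assumes "smooth_on ((- {0}) \<times> UNIV) (\<lambda>p. A (fst p) (snd p))"
    "smooth_on ((- {0}) \<times> UNIV) (\<lambda>p. A' (fst p) (snd p))"
    "\<And>z. z \<noteq> 0 \<Longrightarrow> linear (A z)" "\<And>z. z \<noteq> 0 \<Longrightarrow> linear (A' z)"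
    "\<And>z v. z \<noteq> 0 \<Longrightarrow> A' z (A z v) = v" "\<And>z v. z \<noteq> 0 \<Longrightarrow> A z (A' z v) = v"
    "\<And>z v. z \<noteq> 0 \<Longrightarrow> norm (A z v) = norm v"
    "\<And>z t v. z \<noteq> 0 \<Longrightarrow> cmod t = 1 \<Longrightarrow> A (t *s z) (T t v) = T' t (A z v)"
  shows "gauge_equiv T T'"
  unfolding gauge_equiv_def gauge_def
  by (intro exI[of _ A] exI[of _ A'] conjI allI impI assms)

lemma gaugeD:
  assumes "gauge T T' A A'"
  shows "smooth_on ((- {0}) \<times> UNIV) (\<lambda>p. A (fst p) (snd p))"
    "smooth_on ((- {0}) \<times> UNIV) (\<lambda>p. A' (fst p) (snd p))"
    "\<And>z. z \<noteq> 0 \<Longrightarrow> linear (A z)" "\<And>z. z \<noteq> 0 \<Longrightarrow> linear (A' z)"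
    "\<And>z v. z \<noteq> 0 \<Longrightarrow> A' z (A z v) = v" "\<And>z v. z \<noteq> 0 \<Longrightarrow> A z (A' z v) = v"
    "\<And>z v. z \<noteq> 0 \<Longrightarrow> norm (A z v) = norm v"
    "\<And>z t v. z \<noteq> 0 \<Longrightarrow> cmod t = 1 \<Longrightarrow> A (t *s z) (T t v) = T' t (A z v)"
  using assms unfolding gauge_def by blast+

lemma smult_neq_0: "cmod t = 1 \<Longrightarrow> z \<noteq> 0 \<Longrightarrow> t *s (z :: complex ^ 'n) \<noteq> 0"
  by (auto simp: vec_eq_iff)

lemma smooth_on_gauge:
  assumes "smooth_on ((- {0}) \<times> UNIV) (\<lambda>p. A (fst p) (snd p))" "smooth_on S f" "smooth_on S g"
    "\<And>x. x \<in> S \<Longrightarrow> f x \<noteq> 0"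
  shows "smooth_on S (\<lambda>x. A (f x) (g x))"
  using smooth_on_compose[OF smooth_on_Pair[OF assms(2,3)] assms(1)] assms(4) by auto

lemma gauge_equivariant_inverse:
  assumes "gauge T T' A A'" "z \<noteq> 0" "cmod t = 1"
  shows "A' (t *s z) (T' t v) = T t (A' z v)"
proof -
  note d = gaugeD[OF assms(1)]
  have "A (t *s z) (T t (A' z v)) = T' t v" using d(8)[OF assms(2,3), of "A' z v"] d(6)[OF assms(2)] by simp
  then show ?thesis using d(5)[OF smult_neq_0[OF assms(3,2)], of "T t (A' z v)"] by simp
qed

lemma gauge_equiv_sym:
  assumes "gauge_equiv T T'" shows "gauge_equiv T' T"
proof -
  obtain A A' where g: "gauge T T' A A'" using assms by (auto simp: gauge_equiv_def)
  note d = gaugeD[OF g]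
  have "norm (A' z v) = norm v" if "z \<noteq> 0" for z v using d(6,7)[OF that] by metis
  then show ?thesis
    by (intro gauge_equivI[of A' A]) (use d gauge_equivariant_inverse[OF g] in auto)
qed

lemma gauge_equiv_trans:
  assumes "gauge_equiv T T'" "gauge_equiv T' T''" shows "gauge_equiv T T''"
proof -
  obtain A A' B B' where g: "gauge T T' A A'" "gauge T' T'' B B'"
    using assms by (auto simp: gauge_equiv_def)
  note a = gaugeD[OF g(1)] and b = gaugeD[OF g(2)]
  show ?thesis
  proof (rule gauge_equivI[of "\<lambda>z v. B z (A z v)" "\<lambda>z v. A' z (B' z v)"])
    show "smooth_on ((- {0}) \<times> UNIV) (\<lambda>p. B (fst p) (A (fst p) (snd p)))"
      by (intro smooth_on_gauge[OF b(1)] smooth_intros a) auto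
    show "smooth_on ((- {0}) \<times> UNIV) (\<lambda>p. A' (fst p) (B' (fst p) (snd p)))"
      by (intro smooth_on_gauge[OF a(2)] smooth_intros b) auto
    show "linear (\<lambda>v. B z (A z v))" "linear (\<lambda>v. A' z (B' z v))" if "z \<noteq> 0" for z
      using linear_compose[OF a(3)[OF that] b(3)[OF that]] linear_compose[OF b(4)[OF that] a(4)[OF that]]
      by (simp_all add: o_def)
  qed (use a b smult_neq_0 in auto)
qed

lemma gauge_equiv_refl: "gauge_equiv T T"
  by (rule gauge_equivI[of "\<lambda>_ v. v" "\<lambda>_ v. v"]) (auto intro: smooth_intros linear_ident)

text \<open>\<open>\<alpha>\<close> embeds a summand isometrically and its adjoint
  \<open>\<beta>\<close> is the projection to it. An equivalence on the summand is extended by the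
  identity on the orthogonal complement, where \<open>T\<close> and \<open>T'\<close> agree by the
  last assumption.\<close>

lemma gauge_extend:
  fixes \<alpha> :: "'e::euclidean_space \<Rightarrow> 'v::euclidean_space" and \<beta> :: "'v \<Rightarrow> 'e"
  assumes S: "gauge_equiv S S'" and lin: "linear \<alpha>" "linear \<beta>"
    and ba: "\<And>a. \<beta> (\<alpha> a) = a" and adj: "\<And>a v. \<alpha> a \<bullet> v = a \<bullet> \<beta> v"
    and T: "\<And>t. linear (T t)" "\<And>t. linear (S t)" "\<And>t v. cmod t = 1 \<Longrightarrow> \<beta> (T t v) = S t (\<beta> v)"
      "\<And>t a. cmod t = 1 \<Longrightarrow> T t (\<alpha> a) = \<alpha> (S t a)"
      "\<And>t v. cmod t = 1 \<Longrightarrow> T' t v = T t v + \<alpha> (S' t (\<beta> v) - S t (\<beta> v))"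
  shows "gauge_equiv T T'"
proof -
  obtain M M' where g: "gauge S S' M M'" using S by (auto simp: gauge_equiv_def)
  note m = gaugeD[OF g]
  define ext where "ext M z v = v + \<alpha> (M z (\<beta> v) - \<beta> v)" for M :: "complex ^ 2 \<Rightarrow> 'e \<Rightarrow> 'e" and z v
  have b_ext: "\<beta> (ext M z v) = M z (\<beta> v)" for M z v
    by (simp add: ext_def linear_add[OF lin(2)] ba)
  have inv: "ext M z (ext M' z v) = v" if "\<And>v. M z (M' z v) = v" for M M' z v
    unfolding ext_def[of M] b_ext by (simp add: ext_def that linear_diff[OF lin(1)])
  have sm: "smooth_on ((- {0}) \<times> UNIV) (\<lambda>p. ext M (fst p) (snd p))"
    if "smooth_on ((- {0}) \<times> UNIV) (\<lambda>p. M (fst p) (snd p))" for M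
    unfolding ext_def
    by (intro smooth_intros smooth_on_linear[OF lin(1)] smooth_on_gauge[OF that] smooth_on_linear[OF lin(2)]) auto
  have li: "linear (ext M z)" if "linear (M z)" for M z
    unfolding ext_def
    by (intro linear_compose_add linear_ident linear_compose[of "\<lambda>v. M z (\<beta> v) - \<beta> v" \<alpha>, unfolded o_def]
        linear_compose_sub linear_compose[of \<beta> "M z", unfolded o_def] lin that)
  show ?thesis
  proof (rule gauge_equivI[of "ext M" "ext M'"])
    fix z :: "complex ^ 2" and v assume z: "z \<noteq> 0"
    define w where "w = M z (\<beta> v) - \<beta> v"
    have "norm (w + \<beta> v) = norm (\<beta> v)" using m(7)[OF z] by (simp add: w_def)
    then have "(w + \<beta> v) \<bullet> (w + \<beta> v) = \<beta> v \<bullet> \<beta> v" by (simp add: dot_square_norm)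
    \<comment> \<open>The expression is the difference of the squared norms of
      \<open>M z (\<beta> v)\<close> and \<open>\<beta> v\<close>, and equally that of
      \<open>v + \<alpha> w\<close> and \<open>v\<close>.\<close>
    then have ww: "w \<bullet> w + 2 * (w \<bullet> \<beta> v) = 0"
      by (simp add: inner_add_left inner_add_right inner_commute[of "\<beta> v" w])
    have "ext M z v = v + \<alpha> w" by (simp add: ext_def w_def)
    then have "ext M z v \<bullet> ext M z v = v \<bullet> v + (w \<bullet> w + 2 * (w \<bullet> \<beta> v))"
      by (simp add: inner_add_left inner_add_right inner_commute[of v "\<alpha> w"] adj ba)
    then have "ext M z v \<bullet> ext M z v = v \<bullet> v" using ww by simp
    then show "norm (ext M z v) = norm v" by (simp add: norm_eq)
    fix t assume t: "cmod t = 1"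
    have "T t (ext M z v) = T t v + \<alpha> (S t (M z (\<beta> v)) - S t (\<beta> v))"
      by (simp add: ext_def linear_add[OF T(1)] T(4)[OF t] linear_diff[OF T(2)])
    then have "T' t (ext M z v) = T t v + \<alpha> (S' t (M z (\<beta> v)) - S t (\<beta> v))"
      by (simp add: T(5)[OF t] b_ext linear_diff[OF lin(1)])
    then show "ext M (t *s z) (T t v) = T' t (ext M z v)"
      using m(8)[OF z t, of "\<beta> v"] by (simp add: ext_def[of M "t *s z"] T(3)[OF t])
  qed (use m sm li inv in auto)
qed

text \<open>Monomials in the two coordinates have no common zero on the punctured plane. Normalised,
  they are the equivariant unit vectors from which all gauge families are built; negative exponents
  mean conjugates.\<close>

definition unit_pair :: "int \<Rightarrow> int \<Rightarrow> complex ^ 2 \<Rightarrow> complex \<times> complex" where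
  "unit_pair a b z = sgn (cpow (z $ 1) a, cpow (z $ 2) b)"

lemma unit_pair_nonzero:
  assumes "(z :: complex ^ 2) \<noteq> 0" shows "(cpow (z $ 1) a, cpow (z $ 2) b) \<noteq> 0"
proof -
  have "z $ 1 \<noteq> 0 \<or> z $ 2 \<noteq> 0" using assms by (auto simp: vec_eq_iff forall_2)
  then show ?thesis by (auto simp: cpow_eq_0_iff prod_eq_iff)
qed

lemma unit_pair_norm:
  assumes "z \<noteq> 0"
  shows "(cmod (fst (unit_pair a b z)))\<^sup>2 + (cmod (snd (unit_pair a b z)))\<^sup>2 = 1"
proof -
  have "norm (unit_pair a b z) = 1"
    unfolding unit_pair_def using unit_pair_nonzero[OF assms] by (simp add: norm_sgn)
  then show ?thesis by (simp add: norm_prod_def)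
qed

lemma unit_pair_equivariant:
  "cmod t = 1 \<Longrightarrow> unit_pair a b (t *s z) = (cpow t a * fst (unit_pair a b z), cpow t b * snd (unit_pair a b z))"
  by (simp add: unit_pair_def sgn_div_norm norm_prod_def cpow_mult norm_mult norm_cpow)

lemma smooth_on_unit_pair [smooth_intros]:
  assumes "smooth_on S f" "\<And>x. x \<in> S \<Longrightarrow> f x \<noteq> 0"
  shows "smooth_on S (\<lambda>x. unit_pair a b (f x))"
  unfolding unit_pair_def by (intro smooth_intros assms unit_pair_nonzero)

lemma unit_row_cancel:
  fixes p q x :: complex
  assumes "(cmod p)\<^sup>2 + (cmod q)\<^sup>2 = 1"
  shows "p * cnj p + q * cnj q = 1"
  using assms by (metis complex_norm_square of_real_1 of_real_add)

text \<open>The second row of the matrix is a nowhere vanishing equivariant functional, and the first row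
  completes it to a unitary matrix.\<close>

lemma gauge_sum:
  "gauge_equiv (\<lambda>t v. (cpow t a * fst v, cpow t b * snd v)) (\<lambda>t v. (cpow t (a + b) * fst v, snd v))"
proof -
  \<comment> \<open>These weights make the second component of \<open>A\<close> invariant, while the
    conjugates in the first component give it weight \<open>a + b\<close>. \<open>A'\<close> is the
    adjoint matrix.\<close>
  define P where "P = unit_pair (- a) (- b)"
  define A where "A z v = (- cnj (snd (P z)) * fst v + cnj (fst (P z)) * snd v, fst (P z) * fst v + snd (P z) * snd v)" for z v
  define A' where "A' z v = (- snd (P z) * fst v + cnj (fst (P z)) * snd v, fst (P z) * fst v + cnj (snd (P z)) * snd v)" for z v
  show ?thesis
  proof (rule gauge_equivI[of A A'])
    show "smooth_on ((- {0}) \<times> UNIV) (\<lambda>p. A (fst p) (snd p))" "smooth_on ((- {0}) \<times> UNIV) (\<lambda>p. A' (fst p) (snd p))"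
      unfolding A_def A'_def P_def by (intro smooth_intros; force)+
    fix z :: "complex ^ 2" and v :: "complex \<times> complex"
    assume z: "z \<noteq> 0"
    show "linear (A z)" "linear (A' z)"
      by (rule linearI; simp add: A_def A'_def algebra_simps)+
    obtain p q where P: "P z = (p, q)" by fastforce
    have n: "(cmod p)\<^sup>2 + (cmod q)\<^sup>2 = 1" using unit_pair_norm[OF z, of "- a" "- b"] P by (simp add: P_def)
    note u = unit_row_cancel[OF n]
    have c: "p * (cnj p * x) + q * (cnj q * x) = x" for x
      using u by (metis mult.assoc distrib_right mult_1)
    obtain x y where v: "v = (x, y)" by fastforce
    show "A' z (A z v) = v" "A z (A' z v) = v"
      using c[of x] c[of y] by (simp_all add: A_def A'_def P v algebra_simps)
    have "(cmod (- cnj q * x + cnj p * y))\<^sup>2 + (cmod (p * x + q * y))\<^sup>2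
        = ((cmod p)\<^sup>2 + (cmod q)\<^sup>2) * ((cmod x)\<^sup>2 + (cmod y)\<^sup>2)"
      unfolding cmod_power2 by (simp add: power2_eq_square algebra_simps)
    then show "norm (A z v) = norm v" by (simp add: A_def P v norm_prod_def n)
    fix t assume t: "cmod t = 1"
    have "cpow t a * cnj (cpow t a) = 1" "cpow t b * cnj (cpow t b) = 1"
      using cpow_unit_cancel[OF t] by auto
    then have ca: "cpow t a * (cnj (cpow t a) * y) = y" "cpow t b * (cnj (cpow t b) * y) = y" for y
      by (simp_all flip: mult.assoc)
    have "P (t *s z) = (cnj (cpow t a) * p, cnj (cpow t b) * q)"
      using unit_pair_equivariant[OF t, of "- a" "- b" z] P by (simp add: P_def cpow_uminus)
    then show "A (t *s z) (cpow t a * fst v, cpow t b * snd v) = (cpow t (a + b) * fst (A z v), snd (A z v))"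
      by (simp add: A_def P v cpow_add[OF t] algebra_simps ca cpow_unit_cancel[OF t])
  qed
qed

text \<open>For \<open>s = 1\<close> this is the stable triviality of the tangent bundle of the 2-sphere: the isometries
  are \<open>X \<mapsto> g X g\<^sup>*\<close> on the trace-free Hermitian matrices \<open>X\<close> with rows \<open>(r, u)\<close>, \<open>(cnj u, -r)\<close>, where
  \<open>g\<close> has rows \<open>(p, - cnj q)\<close>, \<open>(q, cnj p)\<close>.\<close>

lemma gauge_even:
  "gauge_equiv (\<lambda>t v. (cpow t (2 * s) * fst v, snd v)) (\<lambda>t (v :: complex \<times> real). v)"
proof -
  define ad where "ad p q v = (p\<^sup>2 * fst v - (cnj q)\<^sup>2 * cnj (fst v) + 2 * p * cnj q * of_real (snd v),
     (Re (p * cnj p) - Re (q * cnj q)) * snd v - 2 * Re (p * q * fst v))" for p q :: complex and v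
  \<comment> \<open>Both entries have weight \<open>- s\<close>: their quadratic coefficients cancel
    the weight \<open>2 * s\<close> of the line, and the products of one entry with the conjugate of
    another are invariant.\<close>
  define P where "P = unit_pair (- s) (- s)"
  \<comment> \<open>Replacing \<open>(p, q)\<close> by \<open>(cnj p, - q)\<close> turns the unitary
    matrix into its adjoint.\<close>
  have inv: "ad (cnj p) (- q) (ad p q v) = v" if "p * cnj p + q * cnj q = 1" for p q v
  proof -
    have re: "Re p * Re p + Im p * Im p + (Re q * Re q + Im q * Im q) = 1"
      using arg_cong[OF that, of Re] by simp
    obtain u r where v: "v = (u, r)" by fastforce
    have "ad (cnj p) (- q) (ad p q v) = (of_real ((Re p * Re p + Im p * Im p + (Re q * Re q + Im q * Im q))\<^sup>2) * u,
       (Re p * Re p + Im p * Im p + (Re q * Re q + Im q * Im q))\<^sup>2 * r)"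
      by (simp add: ad_def v complex_eq_iff power2_eq_square) (simp add: algebra_simps)
    then show ?thesis by (simp add: re v)
  qed
  have nrm: "norm (ad p q v) = norm v" if "p * cnj p + q * cnj q = 1" for p q v
  proof -
    have re: "Re p * Re p + Im p * Im p + (Re q * Re q + Im q * Im q) = 1"
      using arg_cong[OF that, of Re] by simp
    obtain u r where v: "v = (u, r)" by fastforce
    have "(cmod (fst (ad p q v)))\<^sup>2 + (snd (ad p q v))\<^sup>2
        = (Re p * Re p + Im p * Im p + (Re q * Re q + Im q * Im q))\<^sup>2 * ((cmod u)\<^sup>2 + r\<^sup>2)"
      unfolding cmod_power2 by (simp add: ad_def v power2_eq_square) (simp add: algebra_simps)
    then show ?thesis by (simp add: norm_prod_def re v)
  qed
  show ?thesis
  proof (rule gauge_equivI[of "\<lambda>z. ad (fst (P z)) (snd (P z))" "\<lambda>z. ad (cnj (fst (P z))) (- snd (P z))"])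
    show "smooth_on ((- {0}) \<times> UNIV) (\<lambda>p. ad (fst (P (fst p))) (snd (P (fst p))) (snd p))"
      "smooth_on ((- {0}) \<times> UNIV) (\<lambda>p. ad (cnj (fst (P (fst p)))) (- snd (P (fst p))) (snd p))"
      unfolding ad_def P_def by (intro smooth_intros; force)+
    fix z :: "complex ^ 2" and v :: "complex \<times> real"
    assume z: "z \<noteq> 0"
    show "linear (ad (fst (P z)) (snd (P z)))" "linear (ad (cnj (fst (P z))) (- snd (P z)))"
      by (rule linearI; simp add: ad_def algebra_simps scaleR_conv_of_real)+
    obtain p q where P: "P z = (p, q)" by fastforce
    have "(cmod p)\<^sup>2 + (cmod q)\<^sup>2 = 1" using unit_pair_norm[OF z, of "- s" "- s"] P by (simp add: P_def)
    note u = unit_row_cancel[OF this]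
    show "ad (cnj (fst (P z))) (- snd (P z)) (ad (fst (P z)) (snd (P z)) v) = v"
      using inv[OF u] by (simp add: P)
    show "ad (fst (P z)) (snd (P z)) (ad (cnj (fst (P z))) (- snd (P z)) v) = v"
      using inv[of "cnj p" "- q" v] u by (simp add: P mult.commute)
    show "norm (ad (fst (P z)) (snd (P z)) v) = norm v" using nrm[OF u] by (simp add: P)
    fix t assume t: "cmod t = 1"
    define c where "c = cpow t s"
    have c: "c * cnj c = 1" unfolding c_def by (rule cpow_unit_cancel[OF t])
    have c2: "cpow t (2 * s) = c\<^sup>2" using cpow_add[OF t, of s s] by (simp only: c_def power2_eq_square mult_2)
    have Pt: "P (t *s z) = (cnj c * p, cnj c * q)"
      using unit_pair_equivariant[OF t, of "- s" "- s" z] P by (simp add: P_def cpow_uminus c_def)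
    obtain u' r where v: "v = (u', r)" by fastforce
    have k: "(cnj c * p)\<^sup>2 * (c\<^sup>2 * u') = p\<^sup>2 * u'" "(cnj (cnj c * q))\<^sup>2 * cnj (c\<^sup>2 * u') = (cnj q)\<^sup>2 * cnj u'"
      "cnj c * p * cnj (cnj c * q) = p * cnj q" "cnj c * p * cnj (cnj c * p) = p * cnj p"
      "cnj c * q * cnj (cnj c * q) = q * cnj q" "cnj c * p * (cnj c * q) * (c\<^sup>2 * u') = p * q * u'"
      using c by (simp; algebra)+
    have k': "2 * (cnj c * p) * cnj (cnj c * q) = 2 * p * cnj q" using k(3) by (simp only: mult.assoc)
    show "ad (fst (P (t *s z))) (snd (P (t *s z))) (cpow t (2 * s) * fst v, snd v) = ad (fst (P z)) (snd (P z)) v"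
      unfolding Pt P c2 v ad_def fst_conv snd_conv k k' ..
  qed
qed

text \<open>Split weight \<open>a\<close> into \<open>c\<close> on the line itself and
  \<open>a - c\<close> on the spare line; the latter is even, so it cancels against the real
  summand.\<close>

lemma gauge_equiv_weight_parity:
  assumes "even (a - c)"
  shows "gauge_equiv (\<lambda>t v. (cpow t a * fst v, snd v)) (\<lambda>t (v :: complex \<times> complex \<times> real). (cpow t c * fst v, snd v))"
proof -
  have lin: "linear (\<lambda>v :: complex \<times> complex \<times> real. (cpow t a * fst v, cpow t b * fst (snd v), snd (snd v)))"
    "linear (\<lambda>v :: complex \<times> complex \<times> real. (cpow t a * fst v, snd v))"
    "linear (\<lambda>v :: complex \<times> complex. (cpow t a * fst v, cpow t b * snd v))"
    "linear (\<lambda>v :: complex \<times> complex. (cpow t a * fst v, snd v))"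
    "linear (\<lambda>v :: complex \<times> real. (cpow t a * fst v, snd v))" for t a b
    by (auto intro!: linearI simp: algebra_simps)
  have one: "gauge_equiv (\<lambda>t (v :: complex \<times> complex \<times> real). (cpow t c * fst v, cpow t (a - c) * fst (snd v), snd (snd v)))
     (\<lambda>t v. (cpow t a * fst v, snd v))"
    by (rule gauge_extend[OF gauge_sum[of c "a - c"], of "\<lambda>v. (fst v, snd v, 0)" "\<lambda>v. (fst v, fst (snd v))"])
      (auto intro!: linearI lin simp: inner_prod_def)
  obtain s where s: "a - c = 2 * s" using assms unfolding dvd_def by blast
  have "gauge_equiv (\<lambda>t (v :: complex \<times> complex \<times> real). (cpow t c * fst v, cpow t (a - c) * fst (snd v), snd (snd v)))
     (\<lambda>t v. (cpow t c * fst v, snd v))"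
    unfolding s
    by (rule gauge_extend[OF gauge_even[of s], of "\<lambda>v. (0, v)" "\<lambda>v. snd v"])
      (auto intro!: linearI lin simp: inner_prod_def)
  then show ?thesis using gauge_equiv_trans[OF gauge_equiv_sym[OF one]] by blast
qed

section \<open>Reduction of the weights\<close>

lemma gauge_merge:
  assumes ij: "i \<noteq> j"
  shows "gauge_equiv (twist w :: _ \<Rightarrow> ('k::finite, 'm::finite) fibre \<Rightarrow> _) (twist (w(i := w i + w j, j := 0)))"
proof (rule gauge_extend[OF gauge_sum[of "w i" "w j"],
      of "\<lambda>v. (axis i (fst v) + axis j (snd v), 0)" "\<lambda>v. (fst v $ i, fst v $ j)"])
  show "(axis i (fst a) + axis j (snd a), 0) \<bullet> v = a \<bullet> (fst v $ i, fst v $ j)" for a and v :: "('k, 'm) fibre"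
    by (simp add: inner_prod_def inner_add_left inner_axis')
qed (use ij in \<open>auto intro!: linearI linear_twist simp: twist_def vec_eq_iff axis_def algebra_simps\<close>)

lemma gauge_merge_set:
  assumes "finite A" "i \<notin> A"
  shows "gauge_equiv (twist w :: _ \<Rightarrow> ('k::finite, 'm::finite) fibre \<Rightarrow> _)
     (twist (\<lambda>l. if l = i then w i + sum w A else if l \<in> A then 0 else w l))"
  using assms
proof (induction A)
  case empty
  have "(\<lambda>l. if l = i then w i + sum w {} else if l \<in> {} then 0 else w l) = w" by auto
  then show ?case by (simp add: gauge_equiv_refl)
next
  case (insert j A)
  let ?w = "\<lambda>l. if l = i then w i + sum w A else if l \<in> A then 0 else w l"
  have "?w(i := ?w i + ?w j, j := 0) = (\<lambda>l. if l = i then w i + sum w (insert j A) else if l \<in> insert j A then 0 else w l)"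
    using insert by (auto simp: fun_eq_iff)
  moreover have "gauge_equiv (twist ?w :: _ \<Rightarrow> ('k, 'm) fibre \<Rightarrow> _) (twist (?w(i := ?w i + ?w j, j := 0)))"
    by (rule gauge_merge) (use insert in auto)
  ultimately show ?case using gauge_equiv_trans[OF insert.IH] insert.prems by simp
qed

text \<open>\<open>\<gamma>\<close> embeds an invariant copy of C + R orthogonal to the line whose
  weight changes. It is kept abstract because its complex part may be a complex coordinate of weight
  0 or a pair of real coordinates.\<close>

lemma gauge_change_weight:
  fixes \<gamma> :: "complex \<times> real \<Rightarrow> ('k::finite, 'm::finite) fibre"
  assumes even: "even (w i - c)"
    and lin: "linear \<gamma>" "linear \<delta>" and dg: "\<And>u. \<delta> (\<gamma> u) = u" and adj: "\<And>u v. \<gamma> u \<bullet> v = u \<bullet> \<delta> v"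
    and inv: "\<And>t u. twist w t (\<gamma> u) = \<gamma> u" "\<And>t v. \<delta> (twist w t v) = \<delta> v"
    and orth: "\<And>u. fst (\<gamma> u) $ i = 0" "\<And>x. \<delta> (axis i x, 0) = 0"
  shows "gauge_equiv (twist w :: _ \<Rightarrow> ('k, 'm) fibre \<Rightarrow> _) (twist (w(i := c)))"
proof (rule gauge_extend[OF gauge_equiv_weight_parity[OF even],
      of "\<lambda>v. (axis i (fst v), 0) + \<gamma> (snd v)" "\<lambda>v. (fst v $ i, \<delta> v)"])
  have ax: "linear (\<lambda>v :: complex \<times> complex \<times> real. (axis i (fst v), 0) :: ('k, 'm) fibre)"
    by (rule linearI) (auto simp: vec_eq_iff axis_def)
  show "linear (\<lambda>v. (axis i (fst v), 0) + \<gamma> (snd v))"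
    by (intro linear_compose_add ax linear_compose[of snd \<gamma>, unfolded o_def] lin linear_snd)
  show "linear (\<lambda>v. (fst v $ i, \<delta> v))"
    by (rule linearI) (simp_all add: linear_add[OF lin(2)] linear_cmul[OF lin(2)])
  show "linear (\<lambda>v :: complex \<times> complex \<times> real. (cpow t (w i) * fst v, snd v))" for t
    by (rule linearI) (simp_all add: algebra_simps)
  show "(fst ((axis i (fst a), 0) + \<gamma> (snd a)) $ i, \<delta> ((axis i (fst a), 0) + \<gamma> (snd a))) = a" for a
    by (simp add: linear_add[OF lin(2)] orth dg)
  show "((axis i (fst a), 0) + \<gamma> (snd a)) \<bullet> v = a \<bullet> (fst v $ i, \<delta> v)" for a v
    by (simp add: inner_add_left adj inner_axis' inner_prod_def[of "(axis i (fst a), 0)"] inner_prod_def[of a])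
  show "twist w t ((axis i (fst a), 0) + \<gamma> (snd a)) =
      (axis i (fst (cpow t (w i) * fst a, snd a)), 0) + \<gamma> (snd (cpow t (w i) * fst a, snd a))" for t a
    by (simp add: linear_add[OF linear_twist] inv) (simp add: twist_def vec_eq_iff axis_def)
  show "(fst (twist w t v) $ i, \<delta> (twist w t v)) =
      (cpow t (w i) * fst (fst v $ i, \<delta> v), snd (fst v $ i, \<delta> v))" for t v
    by (simp add: inv) (simp add: twist_def)
  show "twist (w(i := c)) t v = twist w t v +
      ((axis i (fst ((cpow t c * fst (fst v $ i, \<delta> v), snd (fst v $ i, \<delta> v)) -
         (cpow t (w i) * fst (fst v $ i, \<delta> v), snd (fst v $ i, \<delta> v)))), 0) +
       \<gamma> (snd ((cpow t c * fst (fst v $ i, \<delta> v), snd (fst v $ i, \<delta> v)) -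
         (cpow t (w i) * fst (fst v $ i, \<delta> v), snd (fst v $ i, \<delta> v)))))" for t v
    by (simp add: linear_0[OF lin(1)]) (simp add: twist_def vec_eq_iff axis_def algebra_simps)
qed (rule linear_twist)

text \<open>All weights are first collected on the coordinate \<open>i\<close>, which then carries
  \<open>CARD('k) * \<rho>\<close>. The size assumption supplies the invariant C + R that allows
  this weight to change by an even amount.\<close>

lemma gauge_normal_form:
  fixes i :: "'k::finite"
  assumes big: "CARD('k) \<ge> 2 \<or> CARD('m::finite) \<ge> 3" and even: "even (int CARD('k) * \<rho> - c)"
  shows "gauge_equiv (twist (\<lambda>_. \<rho>) :: _ \<Rightarrow> ('k, 'm) fibre \<Rightarrow> _) (twist (\<lambda>l. if l = i then c else 0))"
proof -
  define w :: "'k \<Rightarrow> int" where "w l = (if l = i then int CARD('k) * \<rho> else 0)" for l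
  have "\<rho> + (\<Sum>l\<in>UNIV - {i}. \<rho>) = int CARD('k) * \<rho>"
    using card_Suc_Diff1[of UNIV i] by (simp add: algebra_simps flip: of_nat_Suc)
  then have "(\<lambda>l. if l = i then \<rho> + (\<Sum>l\<in>UNIV - {i}. \<rho>) else if l \<in> UNIV - {i} then 0 else \<rho>) = w"
    by (auto simp: w_def fun_eq_iff)
  then have 1: "gauge_equiv (twist (\<lambda>_. \<rho>) :: _ \<Rightarrow> ('k, 'm) fibre \<Rightarrow> _) (twist w)"
    using gauge_merge_set[of "UNIV - {i}" i "\<lambda>_. \<rho>"] by (simp cong: if_cong)
  have ev: "even (w i - c)" using even by (simp add: w_def)
  have wi: "w l = 0" if "l \<noteq> i" for l using that by (simp add: w_def)
  have "gauge_equiv (twist w :: _ \<Rightarrow> ('k, 'm) fibre \<Rightarrow> _) (twist (w(i := c)))"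
    using big
  proof
    assume "CARD('k) \<ge> 2"
    then have "card (UNIV - {i}) \<noteq> 0" by simp
    then obtain j where j: "j \<noteq> i" by (metis Diff_eq_empty_iff UNIV_I card.empty singleton_iff subsetI)
    obtain l :: 'm where True by blast
    show ?thesis
    proof (rule gauge_change_weight[where w = w and i = i and c = c and
          \<gamma> = "\<lambda>u. (axis j (fst u), axis l (snd u))" and \<delta> = "\<lambda>v. (fst v $ j, snd v $ l)", OF ev])
      show "(axis j (fst u), axis l (snd u)) \<bullet> v = u \<bullet> (fst v $ j, snd v $ l)" for u and v :: "('k, 'm) fibre"
        by (simp add: inner_prod_def inner_axis')
    qed (use j wi[OF j] in \<open>auto intro!: linearI simp: twist_def vec_eq_iff axis_def zero_prod_def\<close>)
  next
    assume "CARD('m) \<ge> 3"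
    then obtain T :: "'m set" where "card T = 3" by (metis obtain_subset_with_card_n)
    \<comment> \<open>Two of these real coordinates serve as the spare complex line and the third as
      the spare real one.\<close>
    then obtain a b d :: 'm where d: "a \<noteq> b" "b \<noteq> d" "a \<noteq> d" by (auto simp: card_3_iff)
    show ?thesis
    proof (rule gauge_change_weight[where w = w and i = i and c = c and
          \<gamma> = "\<lambda>u. (0, axis a (Re (fst u)) + axis b (Im (fst u)) + axis d (snd u))" and
          \<delta> = "\<lambda>v. (Complex (snd v $ a) (snd v $ b), snd v $ d)", OF ev])
      show "(0, axis a (Re (fst u)) + axis b (Im (fst u)) + axis d (snd u)) \<bullet> v = u \<bullet> (Complex (snd v $ a) (snd v $ b), snd v $ d)"
        for u and v :: "('k, 'm) fibre"
        by (simp add: inner_prod_def inner_axis' inner_add_left inner_complex_def)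
    qed (use d in \<open>auto intro!: linearI simp: twist_def vec_eq_iff axis_def zero_prod_def complex_eq_iff algebra_simps\<close>)
  qed
  moreover have "w(i := c) = (\<lambda>l. if l = i then c else 0)" by (auto simp: w_def)
  ultimately show ?thesis using gauge_equiv_trans[OF 1] by simp
qed

section \<open>Diffeomorphisms between the bundles\<close>

text \<open>\<open>\<Phi>\<close> descends to an injective map because it matches the fibres of the
  two projections exactly. The local inverses \<open>\<Psi>\<close>, correct up to
  \<open>\<tau>\<close>, give surjectivity and lift the inverse map.\<close>

lemma presents_diffeomorphicI:
  assumes M: "presents X \<pi> M" "smooth_manifold M" and N: "presents Y \<tau> N" "smooth_manifold N"
    and \<Phi>: "smooth_on X \<Phi>" "\<Phi> ` X \<subseteq> Y"
    and eq: "\<And>x x'. x \<in> X \<Longrightarrow> x' \<in> X \<Longrightarrow> \<pi> x = \<pi> x' \<longleftrightarrow> \<tau> (\<Phi> x) = \<tau> (\<Phi> x')"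
    and loc: "\<And>y. y \<in> Y \<Longrightarrow> \<exists>U \<Psi>. openin (top_of_set Y) U \<and> y \<in> U \<and> smooth_on U \<Psi> \<and> \<Psi> ` U \<subseteq> X \<and>
      (\<forall>u\<in>U. \<tau> (\<Phi> (\<Psi> u)) = \<tau> u)"
  shows "diffeomorphic M N"
proof -
  obtain F where F: "\<And>x. x \<in> X \<Longrightarrow> F (\<pi> x) = \<tau> (\<Phi> x)"
    using function_factors_left_gen[of "\<lambda>x. x \<in> X" \<pi> "\<lambda>x. \<tau> (\<Phi> x)"] eq by metis
  obtain G where G: "\<And>x. x \<in> X \<Longrightarrow> G (\<tau> (\<Phi> x)) = \<pi> x"
    using function_factors_left_gen[of "\<lambda>x. x \<in> X" "\<lambda>x. \<tau> (\<Phi> x)" \<pi>] eq by metis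
  have "smooth_map M N F" by (rule presents_smooth_mapI[OF M(1) N(1) \<Phi> F])
  moreover have "smooth_map N M G"
    unfolding presents_smooth_map_iff[OF N(1) M(1)]
  proof
    fix y assume "y \<in> Y"
    then obtain U \<Psi> where U: "openin (top_of_set Y) U" "y \<in> U" "smooth_on U \<Psi>" "\<Psi> ` U \<subseteq> X"
      "\<forall>u\<in>U. \<tau> (\<Phi> (\<Psi> u)) = \<tau> u" using loc[of y] by blast
    have "\<pi> (\<Psi> u) = G (\<tau> u)" if "u \<in> U" for u using G[of "\<Psi> u"] U that by auto
    then show "\<exists>U \<Phi>. openin (top_of_set Y) U \<and> y \<in> U \<and> smooth_on U \<Phi> \<and> \<Phi> ` U \<subseteq> X \<and> (\<forall>u\<in>U. \<pi> (\<Phi> u) = G (\<tau> u))"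
      using U by (intro exI[of _ U] exI[of _ \<Psi>]) simp
  qed
  moreover have "F (G r) = r" if r: "r \<in> topspace (underlying N)" for r
  proof -
    obtain y where y: "y \<in> Y" "r = \<tau> y" using r presents_topspace[OF N(1)] by auto
    obtain U \<Psi> where "y \<in> U" "\<Psi> ` U \<subseteq> X" "\<forall>u\<in>U. \<tau> (\<Phi> (\<Psi> u)) = \<tau> u" using loc[OF y(1)] by blast
    then have "\<Psi> y \<in> X" "r = \<tau> (\<Phi> (\<Psi> y))" using y by auto
    then show ?thesis by (simp add: F G)
  qed
  moreover have "G (F q) = q" if "q \<in> topspace (underlying M)" for q
    using that by (auto simp: presents_topspace[OF M(1)] F G)
  ultimately show ?thesis unfolding diffeomorphic_def using M(2) N(2) by blast
qed

text \<open>A gauge family is isometric, so it preserves the unit spheres of the fibres, and its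
  equivariance makes it descend to orbits.\<close>

lemma diffeomorphic_of_gauge_equiv:
  assumes "gauge_equiv (twist (\<lambda>_. \<rho>) :: _ \<Rightarrow> ('k::finite, 'm::finite) fibre \<Rightarrow> _) (twist (\<lambda>_. \<rho>'))"
  shows "diffeomorphic (sphere_bundle TYPE('k) TYPE('m) \<rho>) (sphere_bundle TYPE('k) TYPE('m) \<rho>')"
proof -
  obtain A A' where g: "gauge (twist (\<lambda>_. \<rho>) :: _ \<Rightarrow> ('k, 'm) fibre \<Rightarrow> _) (twist (\<lambda>_. \<rho>')) A A'"
    using assms by (auto simp: gauge_equiv_def)
  note a = gaugeD[OF g]
  let ?X = "total_set :: ((complex ^ 2) \<times> ('k, 'm) fibre) set"
  have nz: "z \<noteq> 0" if "norm z = 1" for z :: "complex ^ 2" using that by auto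
  have nA': "norm (A' z v) = norm v" if "z \<noteq> 0" for z v using a(6,7)[OF that] by metis
  show ?thesis
  proof (rule presents_diffeomorphicI[OF presents_sphere_bundle smooth_manifold_sphere_bundle
        presents_sphere_bundle smooth_manifold_sphere_bundle])
    show "smooth_on ?X (\<lambda>p. (fst p, A (fst p) (snd p)))"
      by (intro smooth_intros smooth_on_gauge[OF a(1)]) auto
    show "(\<lambda>p. (fst p, A (fst p) (snd p))) ` ?X \<subseteq> ?X" using a(7) nz by auto
    fix x x' assume "x \<in> ?X" "x' \<in> ?X"
    then obtain z v z' v' where x: "x = (z, v)" "x' = (z', v')" and z: "z \<noteq> 0" "z' \<noteq> 0" using nz by auto
    have "v' = twist (\<lambda>_. \<rho>) t v \<longleftrightarrow> A z' v' = twist (\<lambda>_. \<rho>') t (A z v)" if "cmod t = 1" "z' = t *s z" for t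
      using a(8)[OF z(1) that(1), of v] a(5)[OF z(2)] that by metis
    then show "circle_orbit \<rho> x = circle_orbit \<rho> x' \<longleftrightarrow>
        circle_orbit \<rho>' (fst x, A (fst x) (snd x)) = circle_orbit \<rho>' (fst x', A (fst x') (snd x'))"
      unfolding x fst_conv snd_conv circle_orbit_eq_iff by blast
  next
    fix y assume "y \<in> ?X"
    moreover have "smooth_on ?X (\<lambda>p. (fst p, A' (fst p) (snd p)))"
      by (intro smooth_intros smooth_on_gauge[OF a(2)]) auto
    ultimately show "\<exists>U \<Psi>. openin (top_of_set ?X) U \<and> y \<in> U \<and> smooth_on U \<Psi> \<and> \<Psi> ` U \<subseteq> ?X \<and>
      (\<forall>u\<in>U. circle_orbit \<rho>' (fst (\<Psi> u), A (fst (\<Psi> u)) (snd (\<Psi> u))) = circle_orbit \<rho>' u)"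
      using a(6) nA' nz
      by (intro exI[of _ ?X] exI[of _ "\<lambda>p. (fst p, A' (fst p) (snd p))"]) auto
  qed
qed

section \<open>The Hopf map and the product of spheres\<close>

definition hopf :: "complex ^ 2 \<Rightarrow> real ^ 3" where
  "hopf z = vector [2 * Re (z $ 1 * cnj (z $ 2)), 2 * Im (z $ 1 * cnj (z $ 2)), (cmod (z $ 1))\<^sup>2 - (cmod (z $ 2))\<^sup>2]"

lemma norm_real_3: "(norm (p :: real ^ 3))\<^sup>2 = (p $ 1)\<^sup>2 + (p $ 2)\<^sup>2 + (p $ 3)\<^sup>2"
  by (simp add: norm_vec_def L2_set_def sum_3)

lemma smooth_on_vector_2 [smooth_intros]:
  fixes a b :: "_ \<Rightarrow> 'b::euclidean_space"
  assumes "smooth_on S a" "smooth_on S b" shows "smooth_on S (\<lambda>x. vector [a x, b x] :: 'b ^ 2)"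
proof -
  have "smooth_on S (\<lambda>x. \<chi> i :: 2. if i = 1 then a x else b x)"
  proof (rule smooth_on_vec_lambda)
    show "smooth_on S (\<lambda>x. if i = 1 then a x else b x)" for i :: 2
      by (cases "i = 1") (simp_all add: assms)
  qed
  moreover have "(\<chi> i :: 2. if i = 1 then a x else b x) = vector [a x, b x]" for x
    by (simp add: vec_eq_iff forall_2)
  ultimately show ?thesis by simp
qed

lemma smooth_on_vector_3 [smooth_intros]:
  fixes a b c :: "_ \<Rightarrow> 'b::euclidean_space"
  assumes "smooth_on S a" "smooth_on S b" "smooth_on S c"
  shows "smooth_on S (\<lambda>x. vector [a x, b x, c x] :: 'b ^ 3)"
proof -
  have "smooth_on S (\<lambda>x. \<chi> i :: 3. if i = 1 then a x else if i = 2 then b x else c x)"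
  proof (rule smooth_on_vec_lambda)
    show "smooth_on S (\<lambda>x. if i = 1 then a x else if i = 2 then b x else c x)" for i :: 3
      by (cases "i = 1"; cases "i = 2") (simp_all add: assms)
  qed
  moreover have "(\<chi> i :: 3. if i = 1 then a x else if i = 2 then b x else c x) = vector [a x, b x, c x]" for x
    by (simp add: vec_eq_iff forall_3)
  ultimately show ?thesis by simp
qed

lemma norm_hopf: "norm (hopf z) = (norm z)\<^sup>2"
proof -
  have "(norm (hopf z))\<^sup>2 = ((norm z)\<^sup>2)\<^sup>2"
    unfolding norm_real_3 norm_complex_2 hopf_def vector_3 cmod_power2
    by (simp add: power2_eq_square algebra_simps)
  then show ?thesis by (rule power2_eq_imp_eq) auto
qed

text \<open>Translates the Hopf map into the first two entries of \<open>orbit_invariant\<close>, so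
  that its fibres on the 3-sphere are the circle orbits.\<close>

lemma hopf_eq_iff:
  assumes "norm z = 1" "norm z' = 1"
  shows "hopf z = hopf z' \<longleftrightarrow> z $ 1 * cnj (z $ 2) = z' $ 1 * cnj (z' $ 2) \<and> (cmod (z $ 1))\<^sup>2 = (cmod (z' $ 1))\<^sup>2"
proof -
  have e: "(cmod (z $ 2))\<^sup>2 = 1 - (cmod (z $ 1))\<^sup>2" "(cmod (z' $ 2))\<^sup>2 = 1 - (cmod (z' $ 1))\<^sup>2"
    using norm_complex_2[of z] norm_complex_2[of z'] assms by auto
  show ?thesis
    unfolding hopf_def vec_eq_iff forall_3 vector_3 complex_eq_iff[of "z $ 1 * cnj (z $ 2)"] e by auto
qed

text \<open>Choose the representative whose first (respectively second) coordinate is positive. Its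
  modulus follows from the third component and the norm, and the other coordinate from
  \<open>z $ 1 * cnj (z $ 2)\<close>. Each choice breaks down at a single pole.\<close>

lemma hopf_section:
  fixes p :: "real ^ 3"
  assumes p: "norm p = 1"
  shows "p $ 3 \<noteq> - 1 \<Longrightarrow> norm (vector [of_real (sqrt ((1 + p $ 3) / 2)),
           Complex (p $ 1) (- p $ 2) / of_real (2 * sqrt ((1 + p $ 3) / 2))] :: complex ^ 2) = 1 \<and>
         hopf (vector [of_real (sqrt ((1 + p $ 3) / 2)),
           Complex (p $ 1) (- p $ 2) / of_real (2 * sqrt ((1 + p $ 3) / 2))]) = p"
    and "p $ 3 \<noteq> 1 \<Longrightarrow> norm (vector [Complex (p $ 1) (p $ 2) / of_real (2 * sqrt ((1 - p $ 3) / 2)),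
           of_real (sqrt ((1 - p $ 3) / 2))] :: complex ^ 2) = 1 \<and>
         hopf (vector [Complex (p $ 1) (p $ 2) / of_real (2 * sqrt ((1 - p $ 3) / 2)),
           of_real (sqrt ((1 - p $ 3) / 2))]) = p"
proof -
  have n: "(p $ 1)\<^sup>2 + (p $ 2)\<^sup>2 = (1 + p $ 3) * (1 - p $ 3)"
    using norm_real_3[of p] p by (simp add: algebra_simps power2_eq_square)
  have "\<bar>p $ 3\<bar> \<le> 1" using component_le_norm_cart[of p 3] p by simp
  then have le: "- 1 \<le> p $ 3" "p $ 3 \<le> 1" by auto
  have one: "norm z = 1" if "(norm z)\<^sup>2 = 1" for z :: "complex ^ 2"
    using that norm_ge_zero[of z] by (metis abs_of_nonneg power2_eq_1_iff abs_1 abs_minus_cancel)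
  have sq: "(cmod (Complex a b / of_real (2 * s)))\<^sup>2 = (a\<^sup>2 + b\<^sup>2) / (4 * s\<^sup>2)" for a b s
    by (simp add: norm_divide power_divide power_mult_distrib cmod_power2 norm_mult)
  have cnj_div: "cnj (Complex a b / of_real (2 * s)) = Complex (a / (2 * s)) (- b / (2 * s))" for a b s
    by (simp add: complex_eq_iff Re_divide_of_real Im_divide_of_real)
  {
    assume "p $ 3 \<noteq> - 1"
    define s where "s = sqrt ((1 + p $ 3) / 2)"
    have pos: "1 + p $ 3 > 0" using le \<open>p $ 3 \<noteq> - 1\<close> by linarith
    then have s: "s > 0" "s\<^sup>2 = (1 + p $ 3) / 2" by (simp_all add: s_def)
    let ?z = "vector [of_real s, Complex (p $ 1) (- p $ 2) / of_real (2 * s)] :: complex ^ 2"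
    have z2: "(cmod (?z $ 2))\<^sup>2 = (1 - p $ 3) / 2"
      unfolding vector_2 sq s(2) power2_minus n using pos by (simp add: field_simps)
    have z1: "(cmod (?z $ 1))\<^sup>2 = (1 + p $ 3) / 2" using s by simp
    have "norm ?z = 1" by (rule one) (simp only: norm_complex_2 z1 z2, simp add: field_simps)
    moreover have "?z $ 1 * cnj (?z $ 2) = Complex (p $ 1 / 2) (p $ 2 / 2)"
      unfolding vector_2 cnj_div using s by (simp add: complex_eq_iff)
    then have "hopf ?z = p"
      unfolding hopf_def z1 z2 by (simp add: vec_eq_iff forall_3 field_simps)
    ultimately show "norm ?z = 1 \<and> hopf ?z = p" by blast
  }
  {
    assume "p $ 3 \<noteq> 1"
    define s where "s = sqrt ((1 - p $ 3) / 2)"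
    have pos: "1 - p $ 3 > 0" using le \<open>p $ 3 \<noteq> 1\<close> by linarith
    then have s: "s > 0" "s\<^sup>2 = (1 - p $ 3) / 2" by (simp_all add: s_def)
    let ?z = "vector [Complex (p $ 1) (p $ 2) / of_real (2 * s), of_real s] :: complex ^ 2"
    have z1: "(cmod (?z $ 1))\<^sup>2 = (1 + p $ 3) / 2"
      unfolding vector_2 sq s(2) power2_minus n using pos by (simp add: field_simps)
    have z2: "(cmod (?z $ 2))\<^sup>2 = (1 - p $ 3) / 2" using s by simp
    have "norm ?z = 1" by (rule one) (simp only: norm_complex_2 z1 z2, simp add: field_simps)
    moreover have "?z $ 1 * cnj (?z $ 2) = Complex (p $ 1 / 2) (p $ 2 / 2)"
      using s by (simp add: complex_eq_iff Re_divide_of_real Im_divide_of_real)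
    then have "hopf ?z = p"
      unfolding hopf_def z1 z2 by (simp add: vec_eq_iff forall_3 field_simps)
    ultimately show "norm ?z = 1 \<and> hopf ?z = p" by blast
  }
qed

lemma hopf_local_section:
  fixes p0 :: "real ^ 3"
  assumes "norm p0 = 1"
  obtains N s where "open N" "p0 \<in> N" "smooth_on N s" "\<And>p. p \<in> N \<Longrightarrow> norm p = 1 \<Longrightarrow> norm (s p) = 1 \<and> hopf (s p) = p"
proof -
  have C: "smooth_on N (\<lambda>p. Complex (a p) (b p))" if "smooth_on N a" "smooth_on N b"
    for N :: "(real ^ 3) set" and a b
  proof -
    have "(\<lambda>p. Complex (a p) (b p)) = (\<lambda>p. of_real (a p) + \<i> * of_real (b p))"
      by (simp add: complex_eq_iff fun_eq_iff)
    then show ?thesis by (simp only:) (intro smooth_intros that)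
  qed
  have "p0 $ 3 > - 1 \<or> p0 $ 3 < 1" by linarith
  then show thesis
  proof
    assume "p0 $ 3 > - 1"
    show thesis
    proof (rule that)
      show "open {p :: real ^ 3. p $ 3 > - 1}" by (intro open_Collect_less continuous_intros)
      show "smooth_on {p :: real ^ 3. p $ 3 > - 1} (\<lambda>p. vector [of_real (sqrt ((1 + p $ 3) / 2)),
           Complex (p $ 1) (- p $ 2) / of_real (2 * sqrt ((1 + p $ 3) / 2))] :: complex ^ 2)"
        by (intro smooth_intros C) auto
    qed (use \<open>p0 $ 3 > - 1\<close> hopf_section(1) in auto)
  next
    assume "p0 $ 3 < 1"
    show thesis
    proof (rule that)
      show "open {p :: real ^ 3. p $ 3 < 1}" by (intro open_Collect_less continuous_intros)
      show "smooth_on {p :: real ^ 3. p $ 3 < 1} (\<lambda>p. vector [Complex (p $ 1) (p $ 2) / of_real (2 * sqrt ((1 - p $ 3) / 2)),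
           of_real (sqrt ((1 - p $ 3) / 2))] :: complex ^ 2)"
        by (intro smooth_intros C) auto
    qed (use \<open>p0 $ 3 < 1\<close> hopf_section(2) in auto)
  qed
qed

lemma presents_S2_times_sphere:
  "presents (sphere 0 1 \<times> sphere 0 1) id (S2_times_sphere TYPE('n::finite))"
  unfolding S2_times_sphere_def by (rule presents_sphere_product) simp

lemma smooth_manifold_S2_times_sphere: "smooth_manifold (S2_times_sphere TYPE('n::finite))"
  by (rule presents_smooth_manifold[OF presents_S2_times_sphere])
    (simp_all add: S2_times_sphere_def embedded_simps Hausdorff_space_subtopology second_countable_subtopology
      second_countable_euclidean)

text \<open>With weight 0 the circle leaves the fibre alone, so the orbit space of the base is
  realised by \<open>hopf\<close> and the fibre is merely rewritten by a linear isometry.\<close>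

lemma diffeomorphic_trivial_bundle:
  assumes "CARD('n::finite) = 2 * CARD('k::finite) + CARD('m::finite)"
  shows "diffeomorphic (sphere_bundle TYPE('k) TYPE('m) 0) (S2_times_sphere TYPE('n))"
proof -
  have "dim (UNIV :: ('k, 'm) fibre set) = dim (UNIV :: (real ^ 'n) set)"
    using assms by (simp add: dim_UNIV)
  then obtain f :: "('k, 'm) fibre \<Rightarrow> real ^ 'n" and g where "linear f" "linear g" "range f = UNIV" "range g = UNIV"
    "\<And>x. x \<in> UNIV \<Longrightarrow> norm (f x) = norm x" "\<And>y. y \<in> UNIV \<Longrightarrow> norm (g y) = norm y"
    "\<And>x. x \<in> UNIV \<Longrightarrow> g (f x) = x" "\<And>y. y \<in> UNIV \<Longrightarrow> f (g y) = y"
    by (rule isometries_subspaces[OF subspace_UNIV subspace_UNIV]) (rule that)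
  then have fg: "linear f" "linear g" "\<And>x. norm (f x) = norm x" "\<And>y. norm (g y) = norm y"
    "\<And>x. g (f x) = x" "\<And>y. f (g y) = y" by auto
  let ?X = "total_set :: ((complex ^ 2) \<times> ('k, 'm) fibre) set"
  let ?Y = "sphere (0 :: real ^ 3) 1 \<times> sphere (0 :: real ^ 'n) 1"
  show ?thesis
  proof (rule presents_diffeomorphicI[OF presents_sphere_bundle smooth_manifold_sphere_bundle
        presents_S2_times_sphere smooth_manifold_S2_times_sphere])
    show "smooth_on ?X (\<lambda>a. (hopf (fst a), f (snd a)))"
      unfolding hopf_def power2_norm_eq_inner by (intro smooth_intros smooth_on_linear[OF fg(1)])
    show "(\<lambda>a. (hopf (fst a), f (snd a))) ` ?X \<subseteq> ?Y" by (auto simp: norm_hopf fg)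
    fix x x' assume x: "x \<in> ?X" "x' \<in> ?X"
    have tw: "twist (\<lambda>_. - 0) t v = v" for t and v :: "('k, 'm) fibre" by simp
    have "f (snd x) = f (snd x') \<longleftrightarrow> snd x = snd x'" using fg(5) by metis
    then show "circle_orbit 0 x = circle_orbit 0 x' \<longleftrightarrow> id (hopf (fst x), f (snd x)) = id (hopf (fst x'), f (snd x'))"
      unfolding orbit_invariant_eq_iff[OF x] orbit_invariant_def tw
      using hopf_eq_iff[of "fst x" "fst x'"] x by auto
  next
    fix y assume y: "y \<in> ?Y"
    then have "norm (fst y) = 1" by auto
    then obtain N s where N: "open N" "fst y \<in> N" "smooth_on N s"
      "\<And>p. p \<in> N \<Longrightarrow> norm p = 1 \<Longrightarrow> norm (s p) = 1 \<and> hopf (s p) = p" by (rule hopf_local_section) blast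
    let ?U = "?Y \<inter> (N \<times> UNIV)"
    have "smooth_on ?U (\<lambda>a. (s (fst a), g (snd a)))"
      by (intro smooth_intros smooth_on_linear[OF fg(2)] smooth_on_compose[OF _ N(3)]) auto
    moreover have "open (N \<times> (UNIV :: (real ^ 'n) set))" using N(1) by (intro open_Times) auto
    then have "openin (top_of_set ?Y) ?U" by blast
    ultimately show "\<exists>U \<Psi>. openin (top_of_set ?Y) U \<and> y \<in> U \<and> smooth_on U \<Psi> \<and> \<Psi> ` U \<subseteq> ?X \<and>
      (\<forall>u\<in>U. id (hopf (fst (\<Psi> u)), f (snd (\<Psi> u))) = id u)"
      using N y fg by (intro exI[of _ ?U] exI[of _ "\<lambda>a. (s (fst a), g (snd a))"]) auto
  qed
qed

section \<open>A topological obstruction\<close>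

text \<open>The squaring map \<open>u \<mapsto> u u\<^sup>T\<close> from \<open>\<complex>\<^sup>2 - {0}\<close> onto the punctured cone of singular symmetric
  matrices with rows \<open>(A, D)\<close>, \<open>(D, C)\<close>; up to coordinates, the spin double cover of \<open>SO(3)\<close>.\<close>

definition veronese :: "complex \<times> complex \<Rightarrow> complex \<times> complex \<times> complex" where
  "veronese u = ((fst u)\<^sup>2, (snd u)\<^sup>2, fst u * snd u)"

text \<open>Requiring \<open>(A, C) \<noteq> 0\<close> removes only the apex, since
  \<open>A = C = 0\<close> forces \<open>D = 0\<close>.\<close>

definition sym_cone :: "(complex \<times> complex \<times> complex) set" where
  "sym_cone = {(A, C, D). A * C = D\<^sup>2 \<and> (A, C) \<noteq> 0}"

lemma veronese_uminus: "veronese (- u) = veronese u"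
  by (simp add: veronese_def)

lemma veronese_image: "veronese ` (- {0}) = sym_cone"
proof
  show "veronese ` (- {0}) \<subseteq> sym_cone"
    by (auto simp: veronese_def sym_cone_def power_mult_distrib zero_prod_def)
  show "sym_cone \<subseteq> veronese ` (- {0})"
  proof
    fix x assume "x \<in> sym_cone"
    then obtain A C D where x: "x = (A, C, D)" "A * C = D\<^sup>2" "(A, C) \<noteq> 0" by (auto simp: sym_cone_def)
    show "x \<in> veronese ` (- {0})"
    proof (cases "A = 0")
      case True
      then have "D = 0" using x(2) by simp
      then have "veronese (0, csqrt C) = x" using True x(1) by (simp add: veronese_def)
      moreover have "(0, csqrt C) \<noteq> 0" using x(3) True by (auto simp: zero_prod_def)
      ultimately show ?thesis by (metis ComplI image_eqI singletonD)
    next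
      case False
      have "(D / csqrt A)\<^sup>2 = C" using x(2) False by (simp add: power_divide field_simps)
      then have "veronese (csqrt A, D / csqrt A) = x" using False x(1) by (simp add: veronese_def)
      moreover have "(csqrt A, D / csqrt A) \<noteq> 0" using False by (auto simp: zero_prod_def)
      ultimately show ?thesis by (metis ComplI image_eqI singletonD)
    qed
  qed
qed

text \<open>Near \<open>veronese g0\<close> use the functional \<open>l\<close>, the Hermitian
  product with \<open>g0\<close>. Its square is a linear function \<open>R\<close> on the cone.
  Where \<open>R\<close> avoids the nonpositive reals, the two preimages are separated by the sign
  of \<open>Re (l u)\<close>, and the principal square root selects the positive sheet.\<close>

lemma covering_space_veronese: "covering_space (- {0}) veronese sym_cone"
  unfolding covering_space_def
proof (intro conjI ballI)
  show "continuous_on (- {0}) veronese" unfolding veronese_def by (intro continuous_intros)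
  show "veronese ` (- {0}) = sym_cone" by (rule veronese_image)
  fix x assume "x \<in> sym_cone"
  then obtain g0 where g0: "g0 \<noteq> 0" "x = veronese g0" unfolding veronese_image[symmetric] by auto
  obtain a b where ab: "g0 = (a, b)" by fastforce
  define l where "l u = fst u * cnj a + snd u * cnj b" for u
  define R where "R = (\<lambda>(A, C, D). (cnj a)\<^sup>2 * A + (cnj b)\<^sup>2 * C + 2 * cnj a * cnj b * D)"
  \<comment> \<open>On the positive sheet both numerators are coordinates of \<open>u\<close>
    multiplied by \<open>l u\<close>, and \<open>r\<close> equals \<open>l u\<close>.\<close>
  define s where "s y = (let r = csqrt (R y) in case y of (A, C, D) \<Rightarrow>
    ((cnj a * A + cnj b * D) / r, (cnj a * D + cnj b * C) / r))" for y
  define T where "T = sym_cone \<inter> R -` (- \<real>\<^sub>\<le>\<^sub>0)"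
  define P where "P = {u. Re (l u) > 0}"
  define N where "N = {u. Re (l u) < 0}"
  have l_minus: "l (- u) = - l u" for u by (simp add: l_def)
  have Rl: "R (veronese u) = (l u)\<^sup>2" for u
    by (simp add: R_def veronese_def l_def power2_eq_square algebra_simps)
  have l0: "u \<noteq> 0" if "Re (l u) \<noteq> 0" for u using that by (auto simp: l_def)
  have neg: "(l u)\<^sup>2 \<notin> \<real>\<^sub>\<le>\<^sub>0 \<longleftrightarrow> Re (l u) \<noteq> 0" for u
    by (cases "Re (l u) = 0") (auto simp: complex_nonpos_Reals_iff Re_power2 Im_power2)
  have sP: "s (veronese u) = u" if "u \<in> P" for u
  proof -
    have c: "csqrt ((l u)\<^sup>2) = l u" using that by (intro csqrt_square) (auto simp: P_def)
    have nz: "l u \<noteq> 0" using that by (auto simp: P_def)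
    have "cnj a * (fst u)\<^sup>2 + cnj b * (fst u * snd u) = fst u * l u"
      "cnj a * (fst u * snd u) + cnj b * (snd u)\<^sup>2 = snd u * l u"
      by (simp_all add: l_def power2_eq_square algebra_simps)
    then show ?thesis using nz by (simp add: s_def Let_def Rl c) (simp add: veronese_def)
  qed
  have vT: "veronese u \<in> T \<longleftrightarrow> Re (l u) \<noteq> 0" if "u \<noteq> 0" for u
    using veronese_image that by (auto simp: T_def Rl neg)
  have T_ex: "\<exists>u\<in>P. y = veronese u" if "y \<in> T" for y
  proof -
    have "y \<in> veronese ` (- {0})" using that by (simp add: T_def veronese_image)
    then obtain u where u: "u \<noteq> 0" "y = veronese u" by blast
    then have "Re (l u) \<noteq> 0" using vT that by simp
    then have "u \<in> P \<or> - u \<in> P" by (auto simp: P_def l_minus)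
    then show ?thesis using u(2) veronese_uminus[of u] by metis
  qed
  have cs: "continuous_on T s"
  proof -
    have cR: "continuous_on S R" for S unfolding R_def case_prod_unfold by (intro continuous_intros)
    have "continuous_on T (\<lambda>y. csqrt (R y))"
      by (rule continuous_on_compose2[OF continuous_on_csqrt cR]) (auto simp: T_def)
    moreover have "csqrt (R y) \<noteq> 0" if "y \<in> T" for y using that by (auto simp: T_def)
    ultimately show ?thesis
      unfolding s_def Let_def case_prod_unfold by (intro continuous_intros) auto
  qed
  have cv: "continuous_on S veronese" for S unfolding veronese_def by (intro continuous_intros)
  have PT: "veronese u \<in> T" if "u \<in> P" for u using that l0 vT[of u] by (auto simp: P_def)
  have NP: "u \<in> N \<longleftrightarrow> - u \<in> P" for u by (simp add: N_def P_def l_minus)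
  have sT: "s y \<in> P" "veronese (s y) = y" if "y \<in> T" for y using T_ex[OF that] sP by auto
  have hP: "homeomorphism P T veronese s"
    unfolding homeomorphism_def
  proof (intro conjI cs cv ballI)
    show "veronese ` P = T" using PT T_ex by blast
    show "s ` T = P" using sT(1) sP PT by (metis (no_types, lifting) image_eqI image_subsetI subsetI subset_antisym)
  qed (use sP sT in auto)
  have v: "- s (veronese u) = u" if "u \<in> N" for u
    using sP[of "- u"] that NP veronese_uminus[of u] by simp
  have w: "veronese (- s y) = y" if "y \<in> T" for y using sT(2)[OF that] by (simp add: veronese_uminus)
  have NT: "veronese u \<in> T" if "u \<in> N" for u using PT[of "- u"] that NP veronese_uminus[of u] by simp
  have sN: "- s y \<in> N" if "y \<in> T" for y using sT(1)[OF that] NP[of "- s y"] by simp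
  have hN: "homeomorphism N T veronese (\<lambda>y. - s y)"
    unfolding homeomorphism_def
  proof (intro conjI cv ballI continuous_on_minus[OF cs])
    show "veronese ` N = T" using NT w sN by (metis (no_types, lifting) image_eqI image_subsetI subsetI subset_antisym)
    show "(\<lambda>y. - s y) ` T = N" using NT v sN by (metis (no_types, lifting) image_eqI image_subsetI subsetI subset_antisym)
  qed (use v w in auto)
  have "continuous_on UNIV l" unfolding l_def by (intro continuous_intros)
  then have "open P" "open N"
    unfolding P_def N_def by (intro open_Collect_less continuous_intros; simp)+
  then have op: "openin (top_of_set (- {0})) P" "openin (top_of_set (- {0})) N"
    using l0 by (auto intro!: open_subset simp: P_def N_def)
  have cR: "continuous_on UNIV R" unfolding R_def case_prod_unfold by (intro continuous_intros)
  have "open (R -` (- \<real>\<^sub>\<le>\<^sub>0))" using cR by (intro open_vimage) auto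
  then have oT: "openin (top_of_set sym_cone) T" unfolding T_def by auto
  have xT: "x \<in> T"
  proof -
    have "Re (l g0) = (cmod a)\<^sup>2 + (cmod b)\<^sup>2"
      unfolding cmod_power2 by (simp add: l_def ab power2_eq_square)
    moreover have "(cmod a)\<^sup>2 + (cmod b)\<^sup>2 \<noteq> 0" using g0(1) ab by (auto simp: sum_power2_eq_zero_iff zero_prod_def)
    ultimately show ?thesis using vT[OF g0(1)] g0(2) by simp
  qed
  show "\<exists>T. x \<in> T \<and> openin (top_of_set sym_cone) T \<and> (\<exists>v. \<Union>v = (- {0}) \<inter> veronese -` T \<and>
      (\<forall>u\<in>v. openin (top_of_set (- {0})) u) \<and> pairwise disjnt v \<and> (\<forall>u\<in>v. \<exists>q. homeomorphism u T veronese q))"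
  proof (intro exI[of _ T] conjI exI[of _ "{P, N}"])
    have "u \<in> P \<union> N \<longleftrightarrow> u \<noteq> 0 \<and> veronese u \<in> T" for u
      using vT[of u] l0[of u] by (auto simp: P_def N_def)
    then show "\<Union> {P, N} = (- {0}) \<inter> veronese -` T" by blast
    show "pairwise disjnt {P, N}" by (auto simp: pairwise_def disjnt_def P_def N_def)
  qed (use op oT xT hP hN in auto)
qed

lemma no_equivariant_sym_cone_map:
  fixes f :: "complex ^ 2 \<Rightarrow> complex \<times> complex \<times> complex"
  assumes f: "continuous_on (sphere 0 1) f" "f ` sphere 0 1 \<subseteq> sym_cone"
    and eq: "\<And>z t. norm z = 1 \<Longrightarrow> cmod t = 1 \<Longrightarrow>
      f (t *s z) = (cnj t * fst (f z), cnj t * fst (snd (f z)), cnj t * snd (snd (f z)))"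
  shows False
proof -
  have sc: "simply_connected (sphere (0 :: complex ^ 2) 1)" by (rule simply_connected_sphere) simp
  obtain g where g: "continuous_on (sphere 0 1) g" "g \<in> sphere 0 1 \<rightarrow> - {0}"
    "\<And>z. z \<in> sphere 0 1 \<Longrightarrow> veronese (g z) = f z"
    using covering_space_lift[OF covering_space_veronese sc locally_path_connected_sphere f(1)] f(2) by blast
  define z0 :: "complex ^ 2" where "z0 = axis 1 1"
  have z0: "norm z0 = 1" by (simp add: z0_def norm_axis_1)
  \<comment> \<open>\<open>cis (- \<theta> / 2)\<close> squares to
    \<open>cnj (cis \<theta>)\<close>, so \<open>?h\<close> lifts \<open>f\<close> along the orbit
    and starts at \<open>g z0\<close>. By uniqueness it equals \<open>g\<close> along the orbit;
    after a full turn the orbit has closed but \<open>?h\<close> has reached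
    \<open>- g z0\<close>.\<close>
  let ?\<gamma> = "\<lambda>\<theta>. cis \<theta> *s z0" and ?h = "\<lambda>\<theta>. (cis (- \<theta> / 2) * fst (g z0), cis (- \<theta> / 2) * snd (g z0))"
  have \<gamma>: "?\<gamma> \<theta> \<in> sphere 0 1" for \<theta> using z0 by simp
  have c\<gamma>: "continuous_on {0..2 * pi} ?\<gamma>"
    unfolding vector_scalar_mult_def by (intro continuous_intros continuous_on_vec_lambda)
  have sq: "(cis (- \<theta> / 2))\<^sup>2 = cnj (cis \<theta>)" "cis (- \<theta> / 2) * cis (- \<theta> / 2) = cnj (cis \<theta>)" for \<theta>
    by (simp_all add: power2_eq_square cis_mult cis_cnj)
  have nz: "g z0 \<noteq> 0" using g(2) z0 by auto
  have "(g \<circ> ?\<gamma>) (2 * pi) = ?h (2 * pi)"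
  proof (rule covering_space_lift_unique[OF covering_space_veronese, where f = "f \<circ> ?\<gamma>" and T = "{0..2 * pi}" and a = 0
          and x = "2 * pi" and ?g1.0 = "g \<circ> ?\<gamma>" and ?g2.0 = ?h])
    show "(g \<circ> ?\<gamma>) 0 = ?h 0" by simp
    have "?\<gamma> ` {0..2 * pi} \<subseteq> sphere 0 1" using \<gamma> by blast
    then show "continuous_on {0..2 * pi} (f \<circ> ?\<gamma>)" "continuous_on {0..2 * pi} (g \<circ> ?\<gamma>)"
      using continuous_on_compose[OF c\<gamma> continuous_on_subset[OF f(1)]]
        continuous_on_compose[OF c\<gamma> continuous_on_subset[OF g(1)]] by blast+
    show "f \<circ> ?\<gamma> \<in> {0..2 * pi} \<rightarrow> sym_cone" using f(2) \<gamma> by auto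
    show "g \<circ> ?\<gamma> \<in> {0..2 * pi} \<rightarrow> - {0}" using g(2) \<gamma> by auto
    show "(f \<circ> ?\<gamma>) \<theta> = veronese ((g \<circ> ?\<gamma>) \<theta>)" for \<theta> using g(3) \<gamma> by simp
    show "continuous_on {0..2 * pi} ?h" by (intro continuous_intros continuous_on_cis) auto
    show "?h \<in> {0..2 * pi} \<rightarrow> - {0}" using nz by (auto simp: prod_eq_iff)
    show "(f \<circ> ?\<gamma>) \<theta> = veronese (?h \<theta>)" for \<theta>
    proof -
      define h where "h = cis (- \<theta> / 2)"
      have "f (cis \<theta> *s z0) = (cnj (cis \<theta>) * (fst (g z0))\<^sup>2, cnj (cis \<theta>) * (snd (g z0))\<^sup>2,
          cnj (cis \<theta>) * (fst (g z0) * snd (g z0)))"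
        using eq[OF z0, of "cis \<theta>"] g(3)[of z0] z0 by (simp add: veronese_def flip: g(3))
      moreover have "h\<^sup>2 = cnj (cis \<theta>)" unfolding h_def by (rule sq(1))
      moreover have "h * fst (g z0) * (h * snd (g z0)) = h\<^sup>2 * (fst (g z0) * snd (g z0))"
        by (simp add: power2_eq_square)
      ultimately have "f (cis \<theta> *s z0) = veronese (h * fst (g z0), h * snd (g z0))"
        by (simp only: veronese_def fst_conv snd_conv power_mult_distrib)
      then show ?thesis by (simp add: h_def)
    qed
  qed auto
  moreover have "cis (- (2 * pi) / 2) = - 1" by (simp add: complex_eq_iff)
  ultimately have "g z0 = - g z0" by (simp add: prod_eq_iff)
  then have "2 *\<^sub>R g z0 = 0" by (metis add.right_inverse scaleR_2)
  then show False using nz by simp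
qed

text \<open>The frame must become orthogonal with equal lengths by a process that commutes with
  rotations of the pair, which Gram-Schmidt does not. The resulting isotropic vector of weight -1
  contradicts the previous lemma.\<close>

lemma no_equivariant_2_frame:
  fixes a b :: "complex ^ 2 \<Rightarrow> real ^ 3"
  assumes cont: "continuous_on (sphere 0 1) a" "continuous_on (sphere 0 1) b"
    and indep: "\<And>z \<alpha> \<beta>. norm z = 1 \<Longrightarrow> \<alpha> *\<^sub>R a z + \<beta> *\<^sub>R b z = 0 \<Longrightarrow> \<alpha> = 0 \<and> \<beta> = 0"
    and eq: "\<And>z t. norm z = 1 \<Longrightarrow> cmod t = 1 \<Longrightarrow> a (t *s z) = Re t *\<^sub>R a z - Im t *\<^sub>R b z"
      "\<And>z t. norm z = 1 \<Longrightarrow> cmod t = 1 \<Longrightarrow> b (t *s z) = Im t *\<^sub>R a z + Re t *\<^sub>R b z"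
  shows False
proof -
  define n where "n z = cross3 (a z) (b z)" for z
  \<comment> \<open>With J the quarter turn of the plane of \<open>a z\<close> and
    \<open>b z\<close> about \<open>n z\<close>, these are x = |n| (a - J b) and y = - J x, hence
    orthogonal of equal length. The orientation of J by \<open>n z\<close> makes the mixed term of
    the squared norm positive, so \<open>x z\<close> cannot vanish.\<close>
  define x where "x z = norm (n z) *\<^sub>R a z - cross3 (n z) (b z)" for z
  define y where "y z = - (norm (n z) *\<^sub>R b z) - cross3 (n z) (a z)" for z
  define q where "q i z = Complex (x z $ i) (y z $ i)" for i z
  \<comment> \<open>A linear change of coordinates turning the equation for isotropic vectors,
    \<open>(q 1 z)^2 + (q 2 z)^2 + (q 3 z)^2 = 0\<close>, into \<open>A * C = D^2\<close>.\<close>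
  define f where "f z = (q 1 z + \<i> * q 2 z, - (q 1 z - \<i> * q 2 z), q 3 z)" for z
  have n0: "n z \<noteq> 0" if z: "norm z = 1" for z
  proof
    assume "n z = 0"
    then have col: "collinear {0, a z, b z}" by (simp add: n_def cross_eq_0)
    have "a z \<noteq> 0" using indep[OF z, of 1 0] by auto
    then obtain k where "b z = k *\<^sub>R a z" using col collinear_lemma[of "a z" "b z"] indep[OF z, of 0 1] by auto
    then show False using indep[OF z, of k "- 1"] by simp
  qed
  have iso: "x z \<bullet> x z = y z \<bullet> y z \<and> x z \<bullet> y z = 0 \<and> x z \<noteq> 0" if z: "norm z = 1" for z
  proof -
    define m where "m = norm (n z)"
    have m: "m > 0" "n z \<bullet> n z = m * m" using n0[OF z] by (simp_all add: m_def dot_square_norm power2_eq_square)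
    have o: "n z \<bullet> a z = 0" "n z \<bullet> b z = 0" "a z \<bullet> n z = 0" "b z \<bullet> n z = 0"
      by (simp_all add: n_def dot_cross_self)
    have t: "a z \<bullet> cross3 (n z) (b z) = - (m * m)" "b z \<bullet> cross3 (n z) (a z) = m * m"
      "a z \<bullet> cross3 (n z) (a z) = 0" "b z \<bullet> cross3 (n z) (b z) = 0"
      unfolding m(2)[symmetric] by (simp_all add: n_def cross3_simps)
    have xx: "x z \<bullet> x z = m * m * (a z \<bullet> a z + b z \<bullet> b z) + 2 * (m * m * m)"
      unfolding x_def m_def[symmetric]
      by (simp add: inner_diff_left inner_diff_right dot_cross o t m inner_commute[of "cross3 _ _" "a z"])
        (simp add: algebra_simps)
    have yy: "y z \<bullet> y z = m * m * (a z \<bullet> a z + b z \<bullet> b z) + 2 * (m * m * m)"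
      unfolding y_def m_def[symmetric]
      by (simp add: inner_diff_left inner_diff_right dot_cross o t m inner_commute[of "cross3 _ _" "b z"])
        (simp add: algebra_simps)
    have xy: "x z \<bullet> y z = 0"
      unfolding x_def y_def m_def[symmetric]
      by (simp add: inner_diff_left inner_diff_right dot_cross o t m inner_commute[of "cross3 _ _" "b z"])
        (simp add: algebra_simps inner_commute)
    have "x z \<bullet> x z > 0" unfolding xx using m by (simp add: add_nonneg_pos)
    then show ?thesis using xx yy xy by auto
  qed
  have rot: "x (t *s z) = Re t *\<^sub>R x z + Im t *\<^sub>R y z \<and> y (t *s z) = Re t *\<^sub>R y z - Im t *\<^sub>R x z"
    if z: "norm z = 1" and t: "cmod t = 1" for z t
  proof -
    have r: "Re t * Re t + Im t * Im t = 1" using t by (simp add: cmod_def power2_eq_square)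
    have "n (t *s z) = (Re t * Re t + Im t * Im t) *\<^sub>R n z"
      unfolding n_def eq[OF z t] by (simp add: cross3_simps vec_eq_iff forall_3)
    then have nt: "n (t *s z) = n z" using r by simp
    show ?thesis
      unfolding x_def y_def nt eq[OF z t]
      by (simp add: vec_eq_iff forall_3 cross3_def) (simp add: algebra_simps)
  qed
  show False
  proof (rule no_equivariant_sym_cone_map[of f])
    note cc = bounded_bilinear.continuous_on[OF bilinear_cross[unfolded bilinear_conv_bounded_bilinear]]
    have cn: "continuous_on (sphere 0 1) n" unfolding n_def by (intro cc cont)
    have "continuous_on (sphere 0 1) x" "continuous_on (sphere 0 1) y"
      unfolding x_def y_def by (intro continuous_intros cc cont cn)+
    then have "continuous_on (sphere 0 1) (q i)" for i
      unfolding q_def Complex_eq by (intro continuous_intros)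
    then show "continuous_on (sphere 0 1) f" unfolding f_def by (intro continuous_intros)
    show "f ` sphere 0 1 \<subseteq> sym_cone"
    proof (rule image_subsetI)
      fix z :: "complex ^ 2" assume "z \<in> sphere 0 1"
      then have z: "norm z = 1" by simp
      have "x z \<bullet> x z = y z \<bullet> y z" "x z \<bullet> y z = 0" using iso[OF z] by auto
      then have null: "(q 1 z)\<^sup>2 + (q 2 z)\<^sup>2 + (q 3 z)\<^sup>2 = 0"
        by (simp add: q_def complex_eq_iff inner_vec_def sum_3 power2_eq_square)
      have e: "(q 1 z + \<i> * q 2 z) * - (q 1 z - \<i> * q 2 z) = - ((q 1 z)\<^sup>2 + (q 2 z)\<^sup>2)"
        by (simp add: power2_eq_square algebra_simps)
      have "(q 1 z + \<i> * q 2 z) * - (q 1 z - \<i> * q 2 z) = (q 3 z)\<^sup>2"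
        unfolding e using null by (metis add_eq_0_iff minus_minus)
      moreover have False if "q 1 z + \<i> * q 2 z = 0" "- (q 1 z - \<i> * q 2 z) = 0"
      proof -
        have "q 1 z = 0" "q 2 z = 0" using that by (auto simp: complex_eq_iff)
        then have "q 3 z = 0" using null by simp
        then have "x z = 0" using \<open>q 1 z = 0\<close> \<open>q 2 z = 0\<close> by (simp add: q_def complex_eq_iff vec_eq_iff forall_3)
        then show False using iso[OF z] by simp
      qed
      ultimately show "f z \<in> sym_cone" by (auto simp: f_def sym_cone_def zero_prod_def)
    qed
    fix z :: "complex ^ 2" and t assume z: "norm z = 1" and t: "cmod t = 1"
    have "q i (t *s z) = cnj t * q i z" for i
      using rot[OF z t] by (simp add: q_def complex_eq_iff)
    then show "f (t *s z) = (cnj t * fst (f z), cnj t * fst (snd (f z)), cnj t * snd (snd (f z)))"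
      by (simp add: f_def algebra_simps)
  qed
qed

text \<open>An invariant field of directions on the 3-sphere is parametrised by the 2-sphere, so it misses
  some direction of a space of dimension at least 4.\<close>

lemma missed_direction:
  fixes c :: "complex ^ 2 \<Rightarrow> 'v::euclidean_space"
  assumes W: "subspace W" "dim W \<ge> 4" and c: "smooth_on (- {0}) c"
    and inv: "\<And>z t. norm z = 1 \<Longrightarrow> cmod t = 1 \<Longrightarrow> c (t *s z) = c z"
  obtains w where "w \<in> W" "norm w = 1" "\<And>z r. norm z = 1 \<Longrightarrow> r > 0 \<Longrightarrow> w \<noteq> r *\<^sub>R c z"
proof -
  have "dim W \<ge> DIM(complex ^ 2)" using W(2) by simp
  then obtain V where V: "subspace V" "V \<subseteq> span W" "dim V = DIM(complex ^ 2)"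
    using choose_subspace_of_subspace by metis
  obtain l :: "'v \<Rightarrow> complex ^ 2" and l' where l: "linear l" "linear l'" "\<And>y. l' y \<in> V" "\<And>y. l (l' y) = y"
    "\<And>x. x \<in> V \<Longrightarrow> l' (l x) = x" by (rule subspace_coordinates[OF V(1,3)]) (rule that)
  \<comment> \<open>Every circle orbit meets the slice where the second coordinate is real, so three
    real parameters reach all orbits and all positive radii.\<close>
  define lift :: "complex \<times> real \<Rightarrow> complex ^ 2" where "lift y = vector [fst y, of_real (snd y)]" for y
  define \<Phi> where "\<Phi> y = norm y *\<^sub>R c (sgn (lift y))" for y
  have lift0: "lift y \<noteq> 0" if "y \<noteq> 0" for y
    using that by (auto simp: lift_def vec_eq_iff forall_2 prod_eq_iff)
  have "smooth_on (- {0}) (\<lambda>y. l (\<Phi> y))"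
    unfolding \<Phi>_def
  proof (intro smooth_on_linear[OF l(1)] smooth_on_scaleR smooth_on_norm smooth_on_ident)
    have "smooth_on (- {0}) (\<lambda>y. sgn (lift y))"
      using lift0 unfolding lift_def by (intro smooth_intros) auto
    then show "smooth_on (- {0}) (\<lambda>y. c (sgn (lift y)))"
      by (rule smooth_on_compose[OF _ c]) (rule image_subsetI, use lift0 in \<open>simp add: sgn_zero_iff\<close>)
  qed auto
  then have "(\<lambda>y. l (\<Phi> y)) differentiable_on (- {0})"
    by (rule smooth_on_imp_differentiable_on) auto
  \<comment> \<open>A differentiable image of a 3-dimensional domain in the real 4-dimensional
    \<open>complex ^ 2\<close> has measure zero. This is why a 4-dimensional \<open>V\<close> was
    chosen inside \<open>W\<close>.\<close>
  then have "negligible ((\<lambda>y. l (\<Phi> y)) ` (- {0}))"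
    by (rule negligible_differentiable_image_lowdim[rotated]) simp
  then have "negligible (insert 0 ((\<lambda>y. l (\<Phi> y)) ` (- {0})))" by simp
  then have "insert 0 ((\<lambda>y. l (\<Phi> y)) ` (- {0})) \<noteq> UNIV" using non_negligible_UNIV by metis
  then obtain y where y: "y \<noteq> 0" "\<And>u. u \<noteq> 0 \<Longrightarrow> y \<noteq> l (\<Phi> u)" by auto
  have w0: "l' y \<noteq> 0" using y(1) l(1,4) linear_0 by metis
  have miss: "l' y \<noteq> r *\<^sub>R c z" if z: "norm z = 1" and r: "r > 0" for z r
  proof
    assume eq: "l' y = r *\<^sub>R c z"
    \<comment> \<open>Rotates the second coordinate of \<open>z\<close> onto the nonnegative reals,
      into the slice.\<close>
    define t where "t = (if z $ 2 = 0 then 1 else cnj (sgn (z $ 2)))"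
    have t: "cmod t = 1" by (simp add: t_def norm_sgn)
    have t2: "t * z $ 2 = of_real (cmod (z $ 2))"
      by (simp add: t_def sgn_eq) (simp add: complex_norm_square[symmetric] power2_eq_square mult.commute)
    define u where "u = (r *\<^sub>R (t * z $ 1), r * cmod (z $ 2))"
    have lu: "lift u = r *\<^sub>R (t *s z)"
      using t2 by (simp add: u_def lift_def vec_eq_iff forall_2 scaleR_conv_of_real[where 'a = complex])
    have "(norm u)\<^sup>2 = r\<^sup>2 * ((cmod (z $ 1))\<^sup>2 + (cmod (z $ 2))\<^sup>2)"
      by (simp add: u_def norm_prod_def norm_mult t power_mult_distrib algebra_simps)
    then have "(norm u)\<^sup>2 = r\<^sup>2" using norm_complex_2[of z] z by simp
    then have nu: "norm u = r" using r by (simp add: power2_eq_iff_nonneg)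
    have "sgn (lift u) = t *s z" unfolding lu using r t z by (simp add: sgn_div_norm)
    then have "\<Phi> u = l' y" unfolding \<Phi>_def nu eq using inv[OF z t] by simp
    moreover have "u \<noteq> 0" using nu r by auto
    ultimately show False using y(2)[of u] l(4) by simp
  qed
  show thesis
  proof (rule that)
    have "l' y \<in> W" using l(3) V(2) W(1) span_eq_iff by blast
    then show "sgn (l' y) \<in> W" using W(1) by (simp add: sgn_div_norm subspace_scale)
    show "norm (sgn (l' y)) = 1" using w0 by (simp add: norm_sgn)
    fix z r assume z: "norm (z :: complex ^ 2) = 1" and r: "(r :: real) > 0"
    have "l' y = norm (l' y) *\<^sub>R sgn (l' y)" using w0 by (simp add: sgn_div_norm)
    then show "sgn (l' y) \<noteq> r *\<^sub>R c z"
      using miss[OF z, of "norm (l' y) * r"] r w0 by (metis mult_pos_pos scaleR_scaleR zero_less_norm_iff)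
  qed
qed

text \<open>Reflect \<open>n\<close> to \<open>w\<close>, then project along \<open>w\<close>.\<close>

definition collapse :: "'v::euclidean_space \<Rightarrow> 'v \<Rightarrow> 'v \<Rightarrow> 'v" where
  "collapse w n x = flat w (x - (2 * (x \<bullet> (n - w)) / ((n - w) \<bullet> (n - w))) *\<^sub>R (n - w))"

lemma linear_collapse: "linear (collapse w n)"
  unfolding collapse_def
  by (rule linearI) (simp_all add: flat_def algebra_simps inner_add_left add_divide_distrib inner_diff_left diff_divide_distrib)

lemma collapse_orthogonal: "norm w = 1 \<Longrightarrow> collapse w n x \<bullet> w = 0"
  by (simp add: collapse_def flat_def inner_diff_left norm_eq_1)

lemma collapse_in_subspace: "subspace W \<Longrightarrow> w \<in> W \<Longrightarrow> n \<in> W \<Longrightarrow> x \<in> W \<Longrightarrow> collapse w n x \<in> W"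
  unfolding collapse_def flat_def by (intro subspace_diff subspace_scale)

text \<open>The reflection is bijective and exchanges the unit vectors \<open>n\<close> and
  \<open>w\<close>; the projection afterwards kills exactly the multiples of
  \<open>w\<close>.\<close>

lemma collapse_kernel:
  assumes w: "norm w = 1" and n: "norm n = 1" and ne: "n \<noteq> w" and x: "collapse w n x = 0"
  shows "\<exists>\<mu>. x = \<mu> *\<^sub>R n"
proof -
  let ?u = "n - w"
  define k where "k = 2 * (x \<bullet> ?u) / (?u \<bullet> ?u)"
  define r where "r = x - k *\<^sub>R ?u"
  have ww: "w \<bullet> w = 1" "n \<bullet> n = 1" using w n by (simp_all add: norm_eq_1)
  have uu: "?u \<bullet> ?u = 2 - 2 * (n \<bullet> w)" "w \<bullet> ?u = n \<bullet> w - 1"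
    using ww by (simp_all add: inner_diff_left inner_diff_right inner_commute)
  have u0: "?u \<bullet> ?u \<noteq> 0" using ne by simp
  have r: "r = (r \<bullet> w) *\<^sub>R w" using x by (simp add: collapse_def flat_def k_def r_def)
  have "x \<bullet> ?u = k / 2 * (?u \<bullet> ?u)" using u0 by (simp add: k_def)
  then have "r \<bullet> ?u = - (k / 2) * (?u \<bullet> ?u)" by (simp only: r_def inner_diff_left inner_scaleR_left)
  moreover have "r \<bullet> ?u = (r \<bullet> w) * (w \<bullet> ?u)" by (subst r) simp
  ultimately have "(r \<bullet> w) * (n \<bullet> w - 1) = - k * (1 - n \<bullet> w)" unfolding uu by (simp add: algebra_simps)
  then have "(r \<bullet> w - k) * (1 - n \<bullet> w) = 0" by (simp add: algebra_simps)
  moreover have "1 - n \<bullet> w \<noteq> 0" using u0 uu(1) by simp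
  ultimately have k: "r \<bullet> w = k" by simp
  have "x = r + k *\<^sub>R ?u" by (simp add: r_def)
  also have "\<dots> = k *\<^sub>R n" using r k by (simp add: algebra_simps)
  finally show ?thesis by blast
qed

text \<open>Such a frame would trivialise the sum of a line bundle of degree 1 and a trivial bundle. The
  invariant sections are split off one at a time, until the ambient space has dimension 3.\<close>

lemma no_equivariant_frame:
  fixes a b :: "complex ^ 2 \<Rightarrow> 'v::euclidean_space" and c :: "'i \<Rightarrow> complex ^ 2 \<Rightarrow> 'v"
  assumes "finite I" "I \<noteq> {}" "subspace W" "dim W = card I + 2"
    and "smooth_on (- {0}) a" "smooth_on (- {0}) b" "\<And>i. i \<in> I \<Longrightarrow> smooth_on (- {0}) (c i)"
    and "\<And>z. norm z = 1 \<Longrightarrow> a z \<in> W" "\<And>z. norm z = 1 \<Longrightarrow> b z \<in> W"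
      "\<And>i z. i \<in> I \<Longrightarrow> norm z = 1 \<Longrightarrow> c i z \<in> W"
    and "\<And>z \<alpha> \<beta> \<gamma>. norm z = 1 \<Longrightarrow> \<alpha> *\<^sub>R a z + \<beta> *\<^sub>R b z + (\<Sum>i\<in>I. \<gamma> i *\<^sub>R c i z) = 0 \<Longrightarrow>
      \<alpha> = 0 \<and> \<beta> = 0 \<and> (\<forall>i\<in>I. \<gamma> i = 0)"
    and "\<And>z t. norm z = 1 \<Longrightarrow> cmod t = 1 \<Longrightarrow> a (t *s z) = Re t *\<^sub>R a z - Im t *\<^sub>R b z"
      "\<And>z t. norm z = 1 \<Longrightarrow> cmod t = 1 \<Longrightarrow> b (t *s z) = Im t *\<^sub>R a z + Re t *\<^sub>R b z"
      "\<And>i z t. i \<in> I \<Longrightarrow> norm z = 1 \<Longrightarrow> cmod t = 1 \<Longrightarrow> c i (t *s z) = c i z"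
  shows False
  using assms
proof (induction I arbitrary: W a b c rule: finite_ne_induct)
  case (singleton i)
  \<comment> \<open>In dimension 3 the one remaining invariant field is dropped; the rotating pair
    alone is contradictory.\<close>
  have "dim W = DIM(real ^ 3)" using singleton.prems(2) by simp
  then obtain l :: "'v \<Rightarrow> real ^ 3" and l' where l: "linear l" "linear l'" "\<And>y. l' y \<in> W" "\<And>y. l (l' y) = y"
    "\<And>x. x \<in> W \<Longrightarrow> l' (l x) = x" by (rule subspace_coordinates[OF singleton.prems(1)]) (rule that)
  have sub: "sphere (0 :: complex ^ 2) 1 \<subseteq> - {0}" by auto
  have "smooth_on (sphere 0 1) (\<lambda>z. l (a z))" "smooth_on (sphere 0 1) (\<lambda>z. l (b z))"
    using singleton.prems(3,4) sub by (auto intro!: smooth_on_linear[OF l(1)] elim: smooth_on_subset)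
  note cont = this[THEN smooth_on_imp_continuous_on]
  show False
  proof (rule no_equivariant_2_frame[OF cont])
    fix z :: "complex ^ 2" and \<alpha> \<beta> assume z: "norm z = 1" and "\<alpha> *\<^sub>R l (a z) + \<beta> *\<^sub>R l (b z) = 0"
    then have "l (\<alpha> *\<^sub>R a z + \<beta> *\<^sub>R b z) = 0" by (simp add: linear_add[OF l(1)] linear_cmul[OF l(1)])
    moreover have "\<alpha> *\<^sub>R a z + \<beta> *\<^sub>R b z \<in> W"
      using z singleton.prems by (intro subspace_add subspace_scale) auto
    ultimately have "\<alpha> *\<^sub>R a z + \<beta> *\<^sub>R b z = 0" using l(5) linear_0[OF l(2)] by metis
    then show "\<alpha> = 0 \<and> \<beta> = 0" using singleton.prems(9)[OF z, of \<alpha> \<beta> "\<lambda>_. 0"] by simp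
  next
    fix z :: "complex ^ 2" and t assume "norm z = 1" "cmod t = 1"
    then show "l (a (t *s z)) = Re t *\<^sub>R l (a z) - Im t *\<^sub>R l (b z)" "l (b (t *s z)) = Im t *\<^sub>R l (a z) + Re t *\<^sub>R l (b z)"
      using singleton.prems(10,11)
      by (simp_all add: linear_diff[OF l(1)] linear_add[OF l(1)] linear_cmul[OF l(1)])
  qed
next
  case (insert j I)
  note W = insert.prems(1)
  have dimW: "dim W = card I + 3" using insert.prems(2) insert.hyps by simp
  have "card I \<noteq> 0" using insert.hyps by simp
  then have "dim W \<ge> 4" using dimW by simp
  moreover have "smooth_on (- {0}) (c j)" using insert.prems(5) by simp
  moreover have cj_inv: "c j (t *s z) = c j z" if "norm z = 1" "cmod t = 1" for z t
    using insert.prems(12)[of j z t] that by simp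
  ultimately obtain w where w: "w \<in> W" "norm w = 1"
    and miss: "\<And>z r. norm z = 1 \<Longrightarrow> r > 0 \<Longrightarrow> w \<noteq> r *\<^sub>R c j z"
    by (rule missed_direction[OF W]) (assumption | rule that)+
  \<comment> \<open>Extended radially from the sphere, because only there is \<open>c j\<close>
    known not to vanish.\<close>
  define n where "n z = sgn (c j (sgn z))" for z
  \<comment> \<open>Projecting along \<open>n z\<close> directly would land in a hyperplane that
    moves with \<open>z\<close>. \<open>P z\<close> has the same kernel on the sphere, but its
    values lie in the fixed complement of \<open>w\<close>.\<close>
  define P where "P z = collapse w (n z)" for z
  have cj0: "c j z \<noteq> 0" if z: "norm z = 1" for z
  proof
    assume "c j z = 0"
    then have "(\<Sum>i\<in>insert j I. (if i = j then 1 else 0) *\<^sub>R c i z) = 0"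
      by (intro sum.neutral) auto
    then show False using insert.prems(9)[OF z, of 0 0 "\<lambda>i. if i = j then 1 else 0"] by auto
  qed
  have n_sphere: "n z = sgn (c j z)" if "norm z = 1" for z using that by (simp add: n_def sgn_div_norm)
  have n1: "norm (n z) = 1" if "norm z = 1" for z
    using cj0[OF that] by (simp add: n_sphere[OF that] norm_sgn)
  have nw': "n z \<noteq> w" if "norm z = 1" for z
    using miss[OF that, of "inverse (norm (c j z))"] cj0[OF that] by (auto simp: n_sphere[OF that] sgn_div_norm)
  have sgn1: "norm (sgn z) = 1" if "z \<noteq> 0" for z :: "complex ^ 2" using that by (simp add: norm_sgn)
  have nw: "n z \<noteq> w" if "z \<noteq> 0" for z
    using nw'[OF sgn1[OF that]] sgn1[OF that] by (simp add: n_def sgn_div_norm[of "sgn z"])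
  have nW: "n z \<in> W" if "norm z = 1" for z
    using insert.prems(8)[of j z] that W by (simp add: n_sphere sgn_div_norm subspace_scale)
  have sn: "smooth_on (- {0}) n"
    unfolding n_def
  proof (rule smooth_on_sgn)
    show "smooth_on (- {0}) (\<lambda>z. c j (sgn z))"
      by (rule smooth_on_compose[OF _ insert.prems(5)[of j]]) (auto intro!: smooth_intros simp: sgn_zero_iff)
  qed (use cj0 sgn1 in auto)
  have nw2: "(n z - w) \<bullet> (n z - w) \<noteq> 0" if "z \<noteq> 0" for z using nw[OF that] by simp
  have sP: "smooth_on (- {0}) (\<lambda>z. P z (f z))" if "smooth_on (- {0}) f" for f
    unfolding P_def collapse_def by (intro smooth_intros sn that) (use nw2 in auto)
  have linP: "linear (P z)" for z unfolding P_def by (rule linear_collapse)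
  have P_inv: "P (t *s z) = P z" if "norm z = 1" "cmod t = 1" for z t
    using that cj_inv[OF that] by (simp add: P_def n_sphere)
  define W' where "W' = {y \<in> W. \<forall>x\<in>span {w}. orthogonal x y}"
  have W': "y \<in> W' \<longleftrightarrow> y \<in> W \<and> y \<bullet> w = 0" for y
    by (auto simp: W'_def span_singleton orthogonal_def inner_commute)
  have subW': "subspace W'"
    using W by (auto simp: subspace_def W' inner_add_left)
  have "dim W' + dim (span {w}) = dim W"
    unfolding W'_def using W w(1) span_minimal[of "{w}" W] by (intro dim_subspace_orthogonal_to_vectors) simp_all
  moreover have "w \<noteq> 0" using w(2) by auto
  ultimately have dimW': "dim W' = card I + 2" using dimW by (simp add: dim_singleton)
  have PW: "P z x \<in> W'" if "norm z = 1" "x \<in> W" for z x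
    unfolding W' P_def using collapse_orthogonal[OF w(2)] collapse_in_subspace[OF W w(1) nW that(2)] that(1) by simp
  show False
  proof (rule insert.IH[OF subW' dimW', where a = "\<lambda>z. P z (a z)" and b = "\<lambda>z. P z (b z)" and c = "\<lambda>i z. P z (c i z)"])
    fix z :: "complex ^ 2" and \<alpha> \<beta> \<gamma>
    assume z: "norm z = 1"
      and "\<alpha> *\<^sub>R P z (a z) + \<beta> *\<^sub>R P z (b z) + (\<Sum>i\<in>I. \<gamma> i *\<^sub>R P z (c i z)) = 0"
    then have "P z (\<alpha> *\<^sub>R a z + \<beta> *\<^sub>R b z + (\<Sum>i\<in>I. \<gamma> i *\<^sub>R c i z)) = 0"
      by (simp add: linear_add[OF linP] linear_cmul[OF linP] linear_sum[OF linP])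
    then obtain \<mu> where "\<alpha> *\<^sub>R a z + \<beta> *\<^sub>R b z + (\<Sum>i\<in>I. \<gamma> i *\<^sub>R c i z) = \<mu> *\<^sub>R n z"
      unfolding P_def using collapse_kernel[OF w(2) n1[OF z] nw'[OF z]] by blast
    moreover define \<nu> where "\<nu> = \<mu> / norm (c j z)"
    ultimately have e: "\<alpha> *\<^sub>R a z + \<beta> *\<^sub>R b z + (\<Sum>i\<in>I. \<gamma> i *\<^sub>R c i z) = \<nu> *\<^sub>R c j z"
      by (simp add: n_sphere[OF z] sgn_div_norm divide_inverse)
    have "(\<Sum>i\<in>I. (if i = j then - \<nu> else \<gamma> i) *\<^sub>R c i z) = (\<Sum>i\<in>I. \<gamma> i *\<^sub>R c i z)"
      using insert.hyps by (intro sum.cong) auto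
    then have "\<alpha> *\<^sub>R a z + \<beta> *\<^sub>R b z + (\<Sum>i\<in>insert j I. (if i = j then - \<nu> else \<gamma> i) *\<^sub>R c i z) = 0"
      using insert.hyps e by (simp add: algebra_simps)
    then have "\<alpha> = 0 \<and> \<beta> = 0 \<and> (\<forall>i\<in>insert j I. (if i = j then - \<nu> else \<gamma> i) = 0)"
      by (rule insert.prems(9)[OF z])
    moreover have "\<gamma> i = 0" if "\<forall>i\<in>insert j I. (if i = j then - \<nu> else \<gamma> i) = 0" "i \<in> I" for i
      using that insert.hyps by (metis insertI2)
    ultimately show "\<alpha> = 0 \<and> \<beta> = 0 \<and> (\<forall>i\<in>I. \<gamma> i = 0)" by blast
  next
    fix z :: "complex ^ 2" and t assume zt: "norm z = 1" "cmod t = 1"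
    show "P (t *s z) (a (t *s z)) = Re t *\<^sub>R P z (a z) - Im t *\<^sub>R P z (b z)"
      "P (t *s z) (b (t *s z)) = Im t *\<^sub>R P z (a z) + Re t *\<^sub>R P z (b z)"
      unfolding P_inv[OF zt] insert.prems(10)[OF zt] insert.prems(11)[OF zt]
      by (simp_all add: linear_diff[OF linP] linear_add[OF linP] linear_cmul[OF linP])
    show "P (t *s z) (c i (t *s z)) = P z (c i z)" if "i \<in> I" for i
      unfolding P_inv[OF zt] using insert.prems(12)[of i z t] zt that by simp
  next
    show "smooth_on (- {0}) (\<lambda>z. P z (a z))" "smooth_on (- {0}) (\<lambda>z. P z (b z))"
      by (intro sP insert.prems)+
    show "smooth_on (- {0}) (\<lambda>z. P z (c i z))" if "i \<in> I" for i
      using insert.prems(5)[of i] that by (intro sP) simp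
    fix z :: "complex ^ 2" assume z: "norm z = 1"
    show "P z (a z) \<in> W'" "P z (b z) \<in> W'" using PW[OF z] insert.prems(6,7) z by auto
    show "P z (c i z) \<in> W'" if "i \<in> I" for i using PW[OF z] insert.prems(8)[of i z] z that by simp
  qed
qed

section \<open>The bundles with an odd total weight are not products\<close>

text \<open>If \<open>H\<close> factors through \<open>F\<close> near \<open>x\<close>, a direction
  killed by the derivative of \<open>F\<close> is stationary for \<open>H\<close>. It is applied
  with coordinates for \<open>H\<close> that detect every direction transverse to the orbit.\<close>

lemma has_vector_derivative_kernel:
  assumes F: "(F has_derivative F') (at x)" "F' h = 0" and G: "(G has_derivative G') (at (F x))"
    and N: "open N" "x \<in> N" "\<And>y. y \<in> N \<Longrightarrow> G (F y) = H y"
  shows "((\<lambda>s :: real. H (x + s *\<^sub>R h)) has_vector_derivative 0) (at 0)"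
proof -
  have "((\<lambda>y. G (F y)) has_derivative (\<lambda>v. G' (F' v))) (at x)" using has_derivative_compose[OF F(1) G] .
  then have H: "(H has_derivative (\<lambda>v. G' (F' v))) (at (x + 0 *\<^sub>R h))"
    using has_derivative_transform_within_open[OF _ N] by simp
  have "((\<lambda>s :: real. x + s *\<^sub>R h) has_derivative (\<lambda>s. s *\<^sub>R h)) (at 0)"
    by (auto intro!: derivative_eq_intros)
  from has_derivative_compose[OF this H]
  have "((\<lambda>s :: real. H (x + s *\<^sub>R h)) has_derivative (\<lambda>s. G' (F' (s *\<^sub>R h)))) (at 0)" by simp
  moreover have "G' (F' (s *\<^sub>R h)) = s *\<^sub>R 0" for s
    using F(2) linear_cmul[OF has_derivative_linear[OF F(1)]] linear_0[OF has_derivative_linear[OF G]] by simp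
  ultimately show ?thesis unfolding has_vector_derivative_def by simp
qed

lemma projective_derivative:
  fixes a b p q :: complex
  assumes "q \<noteq> 0"
  shows "((\<lambda>s :: real. (p + of_real s * a) / (q + of_real s * b)) has_vector_derivative (a * q - p * b) / q\<^sup>2) (at 0)"
proof -
  have "((\<lambda>s. (p + s * a) / (q + s * b)) has_field_derivative (a * q - p * b) / q\<^sup>2) (at (of_real 0))"
    using assms by (auto intro!: derivative_eq_intros simp: power2_eq_square)
  then show ?thesis by (rule has_vector_derivative_real_field)
qed

text \<open>Spans the complex tangent line of the projective line at the class of \<open>z\<close>, with weight 2 because of
  the conjugations.\<close>

definition horizontal :: "complex ^ 2 \<Rightarrow> complex ^ 2" where
  "horizontal z = vector [- cnj (z $ 2), cnj (z $ 1)]"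

lemma horizontal_smult: "horizontal (t *s z) = cnj t *s horizontal z"
  by (simp add: horizontal_def vec_eq_iff forall_2)

lemma sgn_smult: "cmod t = 1 \<Longrightarrow> sgn (t *s z) = t *s sgn (z :: complex ^ 'n)"
  by (simp add: sgn_div_norm vec_eq_iff)

lemma sgn_twist: "cmod t = 1 \<Longrightarrow> sgn (twist w t v) = twist w t (sgn v)"
  by (simp add: sgn_div_norm linear_cmul[OF linear_twist])

text \<open>Affine coordinates of an orbit, together with the fibre coordinate rescaled to be independent of
  the norm of the fibre vector.\<close>

definition orbit_coordinates ::
  "int \<Rightarrow> ('k::finite, 'm::finite) fibre \<Rightarrow> 2 \<Rightarrow> 2 \<Rightarrow> (complex ^ 2) \<times> ('k, 'm) fibre \<Rightarrow> complex \<times> ('k, 'm) fibre" where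
  "orbit_coordinates \<rho> e i j a = (fst a $ j / fst a $ i, inverse (snd a \<bullet> e) *\<^sub>R local_fibre \<rho> i a)"

lemma orbit_coordinates_sgn:
  assumes "z \<noteq> 0" "v \<noteq> 0"
  shows "orbit_coordinates \<rho> e i j (sgn z, sgn v) = orbit_coordinates \<rho> e i j (z, v)"
proof -
  have "sgn (cnj (sgn z $ i)) = sgn (cnj (z $ i))"
    using assms(1) by (simp add: sgn_div_norm[of z] sgn_scaleR)
  moreover have "inverse (sgn v \<bullet> e) *\<^sub>R twist (\<lambda>_. \<rho>) t (sgn v) = inverse (v \<bullet> e) *\<^sub>R twist (\<lambda>_. \<rho>) t v" for t
    using assms(2) by (simp add: sgn_div_norm[of v] linear_cmul[OF linear_twist])
  ultimately show ?thesis
    using assms(1) by (simp add: orbit_coordinates_def local_fibre_def sgn_div_norm[of z] scaleR_conv_of_real[where 'a = complex])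
qed

lemma orbit_coordinates_cong:
  assumes "circle_orbit \<rho> a = circle_orbit \<rho> b" and e: "fst e = 0"
  shows "orbit_coordinates \<rho> e i j a = orbit_coordinates \<rho> e i j b"
proof -
  obtain t where t: "cmod t = 1" "fst b = t *s fst a" "snd b = twist (\<lambda>_. \<rho>) t (snd a)"
    using assms(1) circle_orbit_eq_iff[of \<rho> "fst a" "snd a" "fst b" "snd b"] by auto
  have "local_fibre \<rho> i b = local_fibre \<rho> i a"
    using local_fibre_invariant[OF t(1), of \<rho> i "fst a" "snd a"] t(2,3) by (metis prod.collapse)
  moreover have "snd b \<bullet> e = snd a \<bullet> e"
    unfolding t(3) using e by (simp add: twist_def inner_prod_def)
  moreover have "t \<noteq> 0" using t(1) by auto
  ultimately show ?thesis by (simp add: orbit_coordinates_def t(2))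
qed

lemma smooth_on_orbit_coordinates:
  assumes "smooth_on S f" "\<And>x. x \<in> S \<Longrightarrow> fst (f x) $ i \<noteq> 0" "\<And>x. x \<in> S \<Longrightarrow> snd (f x) \<bullet> e \<noteq> 0"
  shows "smooth_on S (\<lambda>x. orbit_coordinates \<rho> e i j (f x))"
  unfolding orbit_coordinates_def local_fibre_def by (intro smooth_intros assms) (use assms in auto)

text \<open>The affine coordinate moves at a rate proportional to \<open>u\<close>, the factor being
  a determinant equal to plus or minus the squared norm of \<open>z\<close>. Since \<open>v\<close>
  is orthogonal to \<open>e\<close>, the rescaling factor stays 1 and the fibre coordinate moves at
  rate \<open>v\<close> up to an isometry.\<close>

lemma orbit_coordinates_immersive:
  fixes z :: "complex ^ 2" and v e :: "('k::finite, 'm::finite) fibre"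
  assumes z: "norm z = 1" and ij: "z $ i \<noteq> 0" "j \<noteq> i" and e: "norm e = 1" "fst e = 0" and v: "v \<bullet> e = 0"
    and d: "((\<lambda>s :: real. orbit_coordinates \<rho> e i j ((z, e) + s *\<^sub>R (u *s horizontal z, v))) has_vector_derivative 0) (at 0)"
  shows "u = 0 \<and> v = 0"
proof -
  let ?h = "u *s horizontal z"
  have "((\<lambda>s :: real. (z $ j + of_real s * ?h $ j) / (z $ i + of_real s * ?h $ i)) has_vector_derivative 0) (at 0)"
    using bounded_linear.has_vector_derivative[OF bounded_linear_fst d]
    by (simp add: orbit_coordinates_def scaleR_conv_of_real[where 'a = complex])
  from vector_derivative_unique_at[OF this projective_derivative[OF ij(1)]]
  have "?h $ j * z $ i - z $ j * ?h $ i = 0" using ij(1) by simp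
  moreover have "?h $ j * z $ i - z $ j * ?h $ i = u \<or> ?h $ j * z $ i - z $ j * ?h $ i = - u"
  proof -
    have n: "z $ 1 * cnj (z $ 1) + z $ 2 * cnj (z $ 2) = 1"
      using norm_complex_2[of z] z by (intro unit_row_cancel) simp
    have "(i = 1 \<and> j = 2) \<or> (i = 2 \<and> j = 1)" using ij(2) exhaust_2[of i] exhaust_2[of j] by auto
    then show ?thesis
    proof
      assume "i = 1 \<and> j = 2"
      then have "?h $ j * z $ i - z $ j * ?h $ i = u * (z $ 1 * cnj (z $ 1) + z $ 2 * cnj (z $ 2))"
        by (simp add: horizontal_def algebra_simps)
      then show ?thesis unfolding n by simp
    next
      assume "i = 2 \<and> j = 1"
      then have "?h $ j * z $ i - z $ j * ?h $ i = - u * (z $ 1 * cnj (z $ 1) + z $ 2 * cnj (z $ 2))"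
        by (simp add: horizontal_def algebra_simps)
      then show ?thesis unfolding n by simp
    qed
  qed
  ultimately have u: "u = 0" by (metis neg_equal_0_iff_equal)
  define c where "c = hopf_phase i z"
  have c: "cmod c = 1" using ij(1) by (simp add: c_def norm_sgn)
  have "orbit_coordinates \<rho> e i j ((z, e) + s *\<^sub>R (0, v)) = (z $ j / z $ i, twist (\<lambda>_. \<rho>) c e + s *\<^sub>R twist (\<lambda>_. \<rho>) c v)" for s
    using e(1) v by (simp add: orbit_coordinates_def local_fibre_def inner_add_left norm_eq_1 linear_add[OF linear_twist]
        linear_cmul[OF linear_twist] flip: c_def)
  then have "((\<lambda>s. twist (\<lambda>_. \<rho>) c e + s *\<^sub>R twist (\<lambda>_. \<rho>) c v) has_vector_derivative 0) (at 0)"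
    using bounded_linear.has_vector_derivative[OF bounded_linear_snd d] u by simp
  moreover have "((\<lambda>s. twist (\<lambda>_. \<rho>) c e + s *\<^sub>R twist (\<lambda>_. \<rho>) c v) has_vector_derivative twist (\<lambda>_. \<rho>) c v) (at 0)"
    by (auto intro!: derivative_eq_intros simp: has_vector_derivative_def)
  ultimately have "twist (\<lambda>_. \<rho>) c v = 0" using vector_derivative_unique_at by blast
  then have "v = 0" using norm_twist[OF c, of "\<lambda>_. \<rho>" v] by simp
  then show ?thesis using u by simp
qed

text \<open>A diffeomorphism to \<open>S\<^sup>2 \<times> S\<^sup>n\<close> and the normal directions of the latter trivialise the tangent bundle
  along the section of fixed points \<open>e\<close>, stabilised by \<open>\<real>\<^sup>2\<close>.\<close>

lemma tangent_trivialization: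
  fixes e :: "('k::finite, 'm::finite) fibre"
  assumes diff: "diffeomorphic (sphere_bundle TYPE('k) TYPE('m) \<rho>) (S2_times_sphere TYPE('n::finite))"
    and e: "norm e = 1" "fst e = 0"
  obtains L :: "complex ^ 2 \<Rightarrow> (complex \<times> real) \<times> ('k, 'm) fibre \<Rightarrow> (real ^ 3) \<times> (real ^ 'n)" where
    "\<And>S y. smooth_on S y \<Longrightarrow> smooth_on (S \<inter> - {0}) (\<lambda>z. L z (y z))"
    "\<And>z. z \<noteq> 0 \<Longrightarrow> linear (L z)"
    "\<And>z y. norm z = 1 \<Longrightarrow> L z y = 0 \<Longrightarrow> y = 0"
    "\<And>z t u b v. z \<noteq> 0 \<Longrightarrow> cmod t = 1 \<Longrightarrow>
      L (t *s z) ((cpow t (2 * 1) * u, b), twist (\<lambda>_. \<rho>) t v) = L z ((u, b), v)"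
proof -
  let ?B = "sphere_bundle TYPE('k) TYPE('m) \<rho>" and ?P = "S2_times_sphere TYPE('n)"
  let ?X = "total_set :: ((complex ^ 2) \<times> ('k, 'm) fibre) set" and ?\<pi> = "circle_orbit \<rho>"
  let ?Y = "sphere (0 :: real ^ 3) 1 \<times> sphere (0 :: real ^ 'n) 1"
  note B = presents_sphere_bundle[where 'k = 'k and 'm = 'm and \<rho> = \<rho>]
    and P = presents_S2_times_sphere[where 'n = 'n]
  obtain f g where f: "smooth_map ?B ?P f" and g: "smooth_map ?P ?B g"
    and gf: "\<forall>x\<in>topspace (underlying ?B). g (f x) = x"
    using diff unfolding diffeomorphic_def by blast
  have e0: "e \<noteq> 0" using e by auto
  have sf: "smooth_on ?X (\<lambda>x. f (?\<pi> x))"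
  proof (rule smooth_on_local)
    fix x assume "x \<in> ?X"
    then obtain U \<Phi> where U: "openin (top_of_set ?X) U" "x \<in> U" "smooth_on U \<Phi>" "\<forall>u\<in>U. id (\<Phi> u) = f (?\<pi> u)"
      using f[unfolded presents_smooth_map_iff[OF B P], rule_format, of x] by blast
    then have "smooth_on U (\<lambda>x. f (?\<pi> x))" by (intro smooth_on_cong[THEN iffD1, OF _ U(3)]) simp
    then show "\<exists>U. openin (top_of_set ?X) U \<and> x \<in> U \<and> smooth_on U (\<lambda>x. f (?\<pi> x))" using U by blast
  qed
  have fY: "f (?\<pi> x) \<in> ?Y" if "x \<in> ?X" for x
  proof -
    have "?\<pi> x \<in> topspace (underlying ?B)" using that by (simp add: presents_topspace[OF B])
    moreover have "f ` topspace (underlying ?B) \<subseteq> topspace (underlying ?P)"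
      using f unfolding smooth_map_def using continuous_map_image_subset_topspace by blast
    ultimately show ?thesis unfolding presents_topspace[OF P] by auto
  qed
  \<comment> \<open>Normalising both vectors extends the map from the product of spheres to an open
    set, where it has ordinary derivatives.\<close>
  define D :: "((complex ^ 2) \<times> ('k, 'm) fibre) set" where "D = {x. fst x \<noteq> 0 \<and> snd x \<noteq> 0}"
  define N where "N x = (sgn (fst x), sgn (snd x))" for x :: "(complex ^ 2) \<times> ('k, 'm) fibre"
  define F where "F x = f (?\<pi> (N x))" for x
  have oD: "open D" unfolding D_def by (intro open_Collect_conj open_Collect_neq continuous_intros)
  have NX: "N x \<in> ?X" if "x \<in> D" for x using that by (auto simp: N_def D_def norm_sgn)
  have sN: "smooth_on D N" unfolding N_def by (intro smooth_intros) (auto simp: D_def)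
  have sF: "smooth_on D F" unfolding F_def by (rule smooth_on_compose[OF sN sf]) (use NX in blast)
  have FY: "F x \<in> ?Y" if "x \<in> D" for x unfolding F_def by (rule fY[OF NX[OF that]])
  have zD: "(z, e) \<in> D" if "z \<noteq> 0" for z using that e0 by (simp add: D_def)
  define DF where "DF x = frechet_derivative F (at x)" for x
  have DF: "(F has_derivative DF x) (at x)" if "x \<in> D" for x
    unfolding DF_def by (rule smooth_on_has_derivative[OF sF oD that])
  have linDF: "linear (DF x)" if "x \<in> D" for x using DF[OF that] has_derivative_linear by blast
  \<comment> \<open>The component of \<open>v\<close> along \<open>e\<close> is radial, so it is
    free to carry the normal direction of the 2-sphere; the additional real coordinate carries the
    normal direction of the other sphere.\<close>
  define L where "L z y = DF (z, e) (fst (fst y) *s horizontal z, snd y) +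
    ((snd y \<bullet> e) *\<^sub>R fst (F (z, e)), snd (fst y) *\<^sub>R snd (F (z, e)))" for z y
  \<comment> \<open>Both components of \<open>F\<close> have norm 1 throughout \<open>D\<close>;
    differentiate that identity.\<close>
  have tangent: "fst (F x) \<bullet> fst (DF x h) = 0 \<and> snd (F x) \<bullet> snd (DF x h) = 0" if x: "x \<in> D" for x h
  proof -
    have "fst (F x) \<bullet> fst (DF x h) + fst (DF x h) \<bullet> fst (F x) = 0"
    proof -
      have "((\<lambda>x. fst (F x) \<bullet> fst (F x)) has_derivative (\<lambda>h. fst (F x) \<bullet> fst (DF x h) + fst (DF x h) \<bullet> fst (F x))) (at x)"
        by (intro has_derivative_inner has_derivative_fst DF[OF x])
      then have "((\<lambda>x. 1 :: real) has_derivative (\<lambda>h. fst (F x) \<bullet> fst (DF x h) + fst (DF x h) \<bullet> fst (F x))) (at x)"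
        by (rule has_derivative_transform_within_open[OF _ oD x]) (use FY in \<open>auto simp: mem_Times_iff norm_eq_1\<close>)
      from fun_cong[OF has_derivative_unique[OF this has_derivative_const], of h] show ?thesis .
    qed
    moreover have "snd (F x) \<bullet> snd (DF x h) + snd (DF x h) \<bullet> snd (F x) = 0"
    proof -
      have "((\<lambda>x. snd (F x) \<bullet> snd (F x)) has_derivative (\<lambda>h. snd (F x) \<bullet> snd (DF x h) + snd (DF x h) \<bullet> snd (F x))) (at x)"
        by (intro has_derivative_inner has_derivative_snd DF[OF x])
      then have "((\<lambda>x. 1 :: real) has_derivative (\<lambda>h. snd (F x) \<bullet> snd (DF x h) + snd (DF x h) \<bullet> snd (F x))) (at x)"
        by (rule has_derivative_transform_within_open[OF _ oD x]) (use FY in \<open>auto simp: mem_Times_iff norm_eq_1\<close>)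
      from fun_cong[OF has_derivative_unique[OF this has_derivative_const], of h] show ?thesis .
    qed
    ultimately show ?thesis by (simp add: inner_commute)
  qed
  have immersive: "u = 0 \<and> v = 0"
    if z: "norm z = 1" and v: "v \<bullet> e = 0" and 0: "DF (z, e) (u *s horizontal z, v) = 0" for z u v
  proof -
    have z0: "z \<noteq> 0" using z by auto
    define x where "x = (z, e)"
    have x: "x \<in> D" "N x = x" using zD[OF z0] z e by (simp_all add: x_def N_def sgn_div_norm)
    then have xX: "x \<in> ?X" using NX[of x] by simp
    \<comment> \<open>A local lift \<open>\<Gamma>\<close> of the inverse diffeomorphism recovers
      the orbit of \<open>N y\<close> from \<open>F y\<close>. Hence orbit coordinates factor
      through \<open>F\<close>, and \<open>F\<close> can kill no direction that they see.\<close>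
    note lift = bspec[OF g[unfolded presents_smooth_map_iff[OF P B]] FY[OF x(1)]]
    obtain U \<Gamma> where U: "openin (top_of_set ?Y) U" "F x \<in> U" "smooth_on U \<Gamma>" "\<Gamma> ` U \<subseteq> ?X"
      "\<forall>y\<in>U. ?\<pi> (\<Gamma> y) = g (id y)"
      using lift by (elim exE conjE) (rule that)
    have \<Gamma>F: "?\<pi> (\<Gamma> (F y)) = ?\<pi> (N y)" if "y \<in> D" "F y \<in> U" for y
    proof -
      have "?\<pi> (N y) \<in> topspace (underlying ?B)" using NX[OF that(1)] by (simp add: presents_topspace[OF B])
      then show ?thesis using U(5) that(2) gf by (simp add: F_def)
    qed
    have "z $ 1 \<noteq> 0 \<or> z $ 2 \<noteq> 0" using norm_complex_2[of z] z by auto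
    then obtain i j where i: "z $ i \<noteq> 0" and j: "j \<noteq> (i :: 2)" by (metis exhaust_2 zero_neq_one)
    let ?H = "orbit_coordinates \<rho> e i j"
    define V where "V = {y \<in> U. \<Gamma> y \<in> {a. fst a $ i \<noteq> 0 \<and> snd a \<bullet> e \<noteq> 0}}"
    have "open {a :: (complex ^ 2) \<times> ('k, 'm) fibre. fst a $ i \<noteq> 0 \<and> snd a \<bullet> e \<noteq> 0}"
      by (intro open_Collect_conj open_Collect_neq continuous_intros)
    then have "openin (top_of_set U) V" unfolding V_def by (rule openin_smooth_on_preimage[OF U(3)])
    then have oV: "openin (top_of_set ?Y) V" using U(1) openin_trans by blast
    have "smooth_on V \<Gamma>" using U(3) by (rule smooth_on_subset) (auto simp: V_def)
    then have sV: "smooth_on V (\<lambda>y. ?H (\<Gamma> y))"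
      by (rule smooth_on_orbit_coordinates) (auto simp: V_def)
    have "F x \<in> V"
    proof -
      have "circle_orbit \<rho> (z, e) = circle_orbit \<rho> (fst (\<Gamma> (F x)), snd (\<Gamma> (F x)))"
        using \<Gamma>F[OF x(1) U(2)] x(2) by (simp add: x_def)
      then obtain t where t: "cmod t = 1" "fst (\<Gamma> (F x)) = t *s z" "snd (\<Gamma> (F x)) = twist (\<lambda>_. \<rho>) t e"
        unfolding circle_orbit_eq_iff by blast
      have "twist (\<lambda>_. \<rho>) t e \<bullet> e = 1" using e by (simp add: twist_def inner_prod_def norm_eq_1)
      then show ?thesis using U(2) t i by (auto simp: V_def)
    qed
    \<comment> \<open>The coordinates of \<open>\<Gamma>\<close> are defined only on a piece of the
      product of spheres; an ambient extension is needed to have a derivative.\<close>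
    then obtain W G where W: "open W" "F x \<in> W" "\<And>n. Ck_on n G W" "\<forall>y\<in>W \<inter> V. G y = ?H (\<Gamma> y)"
      using sV unfolding smooth_on_def by meson
    have G: "(G has_derivative frechet_derivative G (at (F x))) (at (F x))"
      by (rule smooth_on_has_derivative[OF _ W(1,2)]) (use W smooth_on_open in blast)
    define O' where "O' = {y \<in> D. F y \<in> V} \<inter> {y \<in> D. F y \<in> W}"
    have "open O'"
    proof -
      have "openin (top_of_set D) {y \<in> D. F y \<in> V}"
        by (rule openin_smooth_on_preimage_openin[OF sF _ oV]) (use FY in blast)
      moreover have "openin (top_of_set D) {y \<in> D. F y \<in> W}"
        by (rule openin_smooth_on_preimage[OF sF W(1)])
      ultimately show ?thesis unfolding O'_def using oD by (meson open_Int openin_open_trans)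
    qed
    moreover have "x \<in> O'" using x \<open>F x \<in> V\<close> W(2) by (simp add: O'_def)
    moreover have "G (F y) = ?H y" if "y \<in> O'" for y
    proof -
      have y: "y \<in> D" "F y \<in> U" "F y \<in> W \<inter> V" using that by (auto simp: O'_def V_def)
      then have "G (F y) = ?H (\<Gamma> (F y))" using W(4) by blast
      also have "\<dots> = ?H (N y)" by (rule orbit_coordinates_cong[OF \<Gamma>F[OF y(1,2)] e(2)])
      also have "\<dots> = ?H y"
        using orbit_coordinates_sgn[of "fst y" "snd y" \<rho> e i j] y(1) by (simp add: N_def D_def)
      finally show ?thesis .
    qed
    ultimately have "((\<lambda>s :: real. ?H (x + s *\<^sub>R (u *s horizontal z, v))) has_vector_derivative 0) (at 0)"
      by (rule has_vector_derivative_kernel[OF DF[OF x(1)] 0[folded x_def] G])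
    then show ?thesis using orbit_coordinates_immersive[OF z i j e v] by (simp add: x_def)
  qed
  show thesis
  proof (rule that[of L])
    fix S and y :: "complex ^ 2 \<Rightarrow> (complex \<times> real) \<times> ('k, 'm) fibre"
    assume "smooth_on S y"
    then have y: "smooth_on (S \<inter> - {0}) y" by (rule smooth_on_subset) auto
    have s1: "smooth_on (S \<inter> - {0}) (\<lambda>z. (z, e))" by (intro smooth_intros)
    have s2: "smooth_on (S \<inter> - {0}) (\<lambda>z. (fst (fst (y z)) *s horizontal z, snd (y z)))"
      unfolding horizontal_def by (intro smooth_intros y)
    have sD: "smooth_on (S \<inter> - {0}) (\<lambda>z. DF (z, e) (fst (fst (y z)) *s horizontal z, snd (y z)))"
      unfolding DF_def by (rule smooth_on_frechet_derivative[OF sF oD s1 _ s2]) (use zD in auto)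
    have sFz: "smooth_on (S \<inter> - {0}) (\<lambda>z. F (z, e))"
      by (rule smooth_on_compose[OF s1 sF]) (use zD in auto)
    show "smooth_on (S \<inter> - {0}) (\<lambda>z. L z (y z))"
      unfolding L_def by (intro smooth_intros sD sFz y)
  next
    fix z :: "complex ^ 2" assume z: "z \<noteq> 0"
    note lD = linDF[OF zD[OF z]]
    have J: "linear (\<lambda>y :: (complex \<times> real) \<times> ('k, 'm) fibre. (fst (fst y) *s horizontal z, snd y))"
      by (rule linearI) (simp_all add: vec_eq_iff algebra_simps scaleR_conv_of_real[where 'a = complex])
    have R: "linear (\<lambda>y :: (complex \<times> real) \<times> ('k, 'm) fibre.
        ((snd y \<bullet> e) *\<^sub>R fst (F (z, e)), snd (fst y) *\<^sub>R snd (F (z, e))))"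
      by (rule linearI) (simp_all add: inner_add_left scaleR_left_distrib)
    show "linear (L z)"
      unfolding L_def by (intro linear_compose_add linear_compose[OF J lD, unfolded o_def] R)
  next
    fix z :: "complex ^ 2" and y assume z: "norm z = 1" and L0: "L z y = 0"
    obtain u b v where y: "y = ((u, b), v)" by (metis prod.collapse)
    have x: "(z, e) \<in> D" by (rule zD) (use z in auto)
    define h where "h = (u *s horizontal z, v)"
    have "fst (L z y) = 0" "snd (L z y) = 0" using L0 by auto
    then have l: "fst (DF (z, e) h) + (v \<bullet> e) *\<^sub>R fst (F (z, e)) = 0" "snd (DF (z, e) h) + b *\<^sub>R snd (F (z, e)) = 0"
      by (simp_all add: L_def y h_def)
    have n: "fst (F (z, e)) \<bullet> fst (F (z, e)) = 1" "snd (F (z, e)) \<bullet> snd (F (z, e)) = 1"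
      using FY[OF x] by (auto simp: mem_Times_iff norm_eq_1)
    have ve: "v \<bullet> e = 0"
      using arg_cong[OF l(1), of "inner (fst (F (z, e)))"] tangent[OF x, of h] n by (simp add: inner_add_right)
    moreover have b: "b = 0"
      using arg_cong[OF l(2), of "inner (snd (F (z, e)))"] tangent[OF x, of h] n by (simp add: inner_add_right)
    ultimately have "DF (z, e) h = 0" using l by (simp add: prod_eq_iff)
    then show "y = 0" using immersive[OF z ve, of u] b by (simp add: h_def y zero_prod_def)
  next
    fix z :: "complex ^ 2" and t u b and v :: "('k, 'm) fibre" assume z: "z \<noteq> 0" and t: "cmod t = 1"
    define T where "T x = (t *s fst x, twist (\<lambda>_. \<rho>) t (snd x))" for x :: "(complex ^ 2) \<times> ('k, 'm) fibre"
    have TD: "T x \<in> D \<longleftrightarrow> x \<in> D" for x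
    proof -
      have "norm (t *s fst x) = norm (fst x)" "norm (twist (\<lambda>_. \<rho>) t (snd x)) = norm (snd x)" using t by simp_all
      then have "t *s fst x = 0 \<longleftrightarrow> fst x = 0" "twist (\<lambda>_. \<rho>) t (snd x) = 0 \<longleftrightarrow> snd x = 0"
        by (metis norm_eq_zero)+
      then show ?thesis unfolding D_def T_def mem_Collect_eq fst_conv snd_conv by blast
    qed
    have FT: "F (T x) = F x" for x
    proof -
      have "circle_orbit \<rho> (sgn (fst x), sgn (snd x)) = circle_orbit \<rho> (sgn (t *s fst x), sgn (twist (\<lambda>_. \<rho>) t (snd x)))"
        unfolding circle_orbit_eq_iff using sgn_smult[OF t] sgn_twist[OF t] t by blast
      then show ?thesis by (simp add: F_def N_def T_def)
    qed
    have Te: "T (z, e) = (t *s z, e)" using e(2) by (cases e) (simp add: T_def twist_def vec_eq_iff)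
    have linT: "linear T"
      unfolding T_def
      by (rule linearI) (simp_all add: linear_add[OF linear_twist] linear_cmul[OF linear_twist] vec_eq_iff algebra_simps
          scaleR_conv_of_real[where 'a = complex])
    then have "(T has_derivative T) (at (z, e))"
      by (intro bounded_linear_imp_has_derivative) (simp add: linear_conv_bounded_linear)
    \<comment> \<open>Differentiating the invariance \<open>F (T x) = F x\<close> at a fixed point
      of the fibre action.\<close>
    then have "DF (z, e) = (\<lambda>h. DF (T (z, e)) (T h))"
      by (rule has_derivative_factor[OF _ DF DF oD zD[OF z] FT]) (use TD zD[OF z] in auto)
    then have "DF (z, e) (u *s horizontal z, v) = DF (t *s z, e) (T (u *s horizontal z, v))"
      unfolding Te by metis
    \<comment> \<open>\<open>horizontal\<close> picks up \<open>cnj t\<close>, so compensating costs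
      a second factor \<open>t\<close>: the tangent line of the base has weight 2. The form
      \<open>2 * 1\<close> matches \<open>gauge_even\<close> with \<open>s = 1\<close>.\<close>
    moreover have "T (u *s horizontal z, v) = ((cpow t (2 * 1) * u) *s horizontal (t *s z), twist (\<lambda>_. \<rho>) t v)"
    proof -
      have "cpow t (2 * 1) = t * t" using cpow_add[OF t, of 1 1] by simp
      moreover have "t * cnj t = 1" using cpow_unit_cancel[OF t, of 1] by simp
      then have "t * (t * u * cnj t) = t * u" by algebra
      ultimately show ?thesis
        by (simp add: T_def horizontal_smult vector_smult_assoc mult_ac)
    qed
    moreover have "twist (\<lambda>_. \<rho>) t v \<bullet> e = v \<bullet> e" using e(2) by (simp add: twist_def inner_prod_def)
    moreover have "F (t *s z, e) = F (z, e)" using FT[of "(z, e)"] Te by simp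
    ultimately show "L (t *s z) ((cpow t (2 * 1) * u, b), twist (\<lambda>_. \<rho>) t v) = L z ((u, b), v)"
      by (simp add: L_def)
  qed
qed

text \<open>Composing the tangent trivialisation with the gauge families leaves a single line of
  weight 1. A fixed basis of the source then becomes a frame with one rotating pair and otherwise
  invariant vectors, which is impossible.\<close>

lemma sphere_bundle_not_product:
  assumes card: "CARD('n::finite) = 2 * CARD('k::finite) + CARD('m::finite)"
    and big: "CARD('k) \<ge> 2 \<or> CARD('m) \<ge> 3" and odd: "odd (int CARD('k) * \<rho>)"
  shows "\<not> diffeomorphic (sphere_bundle TYPE('k) TYPE('m) \<rho>) (S2_times_sphere TYPE('n))"
proof
  assume diff: "diffeomorphic (sphere_bundle TYPE('k) TYPE('m) \<rho>) (S2_times_sphere TYPE('n))"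
  obtain l :: 'm and i :: 'k where True by blast
  define e :: "('k, 'm) fibre" where "e = (0, axis l 1)"
  have "norm e = 1" "fst e = 0" by (simp_all add: e_def norm_prod_def norm_axis_1)
  then obtain L :: "complex ^ 2 \<Rightarrow> (complex \<times> real) \<times> ('k, 'm) fibre \<Rightarrow> (real ^ 3) \<times> (real ^ 'n)" where
    L: "\<And>S y. smooth_on S y \<Longrightarrow> smooth_on (S \<inter> - {0}) (\<lambda>z. L z (y z))"
    "\<And>z. z \<noteq> 0 \<Longrightarrow> linear (L z)"
    "\<And>z y. norm z = 1 \<Longrightarrow> L z y = 0 \<Longrightarrow> y = 0"
    "\<And>z t u b v. z \<noteq> 0 \<Longrightarrow> cmod t = 1 \<Longrightarrow>
      L (t *s z) ((cpow t (2 * 1) * u, b), twist (\<lambda>_. \<rho>) t v) = L z ((u, b), v)"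
    by (rule tangent_trivialization[OF diff]) (rule that)
  let ?w = "\<lambda>l. if l = i then 1 else 0 :: int"
  have "gauge_equiv (twist (\<lambda>_. \<rho>) :: _ \<Rightarrow> ('k, 'm) fibre \<Rightarrow> _) (twist ?w)"
    by (rule gauge_normal_form[OF big]) (use odd in simp)
  then obtain A A' where g: "gauge (twist (\<lambda>_. \<rho>) :: _ \<Rightarrow> ('k, 'm) fibre \<Rightarrow> _) (twist ?w) A A'"
    by (auto simp: gauge_equiv_def)
  obtain B B' where h: "gauge (\<lambda>t v. (cpow t (2 * 1) * fst v, snd v)) (\<lambda>t (v :: complex \<times> real). v) B B'"
    using gauge_even[of 1] by (auto simp: gauge_equiv_def)
  note a = gaugeD[OF g] and b = gaugeD[OF h]
  \<comment> \<open>\<open>B'\<close> undoes the weight 2 of the base direction with the help of the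
    extra real coordinate, and \<open>A'\<close> gathers the fibre weights into one line.\<close>
  define M where "M z y = L z (B' z (fst y), A' z (snd y))" for z y
  have nz: "z \<noteq> 0" if "norm z = 1" for z :: "complex ^ 2" using that by auto
  have sM: "smooth_on (- {0}) (\<lambda>z. M z y)" for y
  proof -
    have "smooth_on (- {0}) (\<lambda>z. (B' z (fst y), A' z (snd y)))"
      by (intro smooth_intros smooth_on_gauge[OF b(2)] smooth_on_gauge[OF a(2)]) auto
    from L(1)[OF this] show ?thesis by (simp add: M_def)
  qed
  have linM: "linear (M z)" if z: "z \<noteq> 0" for z
    by (rule linearI) (simp_all add: M_def linear_add[OF a(4)[OF z]] linear_add[OF b(4)[OF z]]
        linear_cmul[OF a(4)[OF z]] linear_cmul[OF b(4)[OF z]] flip: linear_add[OF L(2)[OF z]] linear_cmul[OF L(2)[OF z]])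
  have injM: "y = 0" if z: "norm z = 1" and "M z y = 0" for z y
  proof -
    have "(B' z (fst y), A' z (snd y)) = 0" by (rule L(3)[OF z]) (use that(2) in \<open>simp add: M_def\<close>)
    then have "B' z (fst y) = 0" "A' z (snd y) = 0" by (simp_all add: prod_eq_iff)
    then have "fst y = 0" "snd y = 0"
      using b(6)[OF nz[OF z]] a(6)[OF nz[OF z]] linear_0[OF b(3)[OF nz[OF z]]] linear_0[OF a(3)[OF nz[OF z]]] by metis+
    then show ?thesis by (simp add: prod_eq_iff)
  qed
  have eqM: "M (t *s z) (y, twist ?w t v) = M z (y, v)" if z: "norm z = 1" and t: "cmod t = 1" for z t y v
    using gauge_equivariant_inverse[OF g nz[OF z] t, of v] gauge_equivariant_inverse[OF h nz[OF z] t, of y]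
      L(4)[OF nz[OF z] t, of "fst (B' z y)" "snd (B' z y)" "A' z v"]
    by (simp add: M_def)
  define e1 e2 :: "(complex \<times> real) \<times> ('k, 'm) fibre" where "e1 = (0, axis i 1, 0)" and "e2 = (0, axis i \<i>, 0)"
  define I where "I = Basis - {e1, e2}"
  have e12: "e1 \<in> Basis" "e2 \<in> Basis" "e1 \<noteq> e2"
    by (auto simp: e1_def e2_def Basis_prod_def Basis_vec_def axis_eq_axis)
  have "card I = DIM((complex \<times> real) \<times> ('k, 'm) fibre) - 2"
    unfolding I_def using e12 by (subst card_Diff_subset) auto
  then have cI: "card I = 2 * CARD('k) + CARD('m) + 1" by simp
  have fixed: "twist ?w t (snd c) = snd c" if "c \<in> I" for c t
  proof -
    have c: "c \<in> Basis" "c \<noteq> e1" "c \<noteq> e2" using that by (auto simp: I_def)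
    from c(1) consider p where "c = (p, 0)" | y where "c = (0, 0, y)"
      | l' u where "c = (0, axis l' u, 0)" "u = 1 \<or> u = \<i>"
      by (auto simp: Basis_prod_def Basis_vec_def Basis_complex_def)
    then show ?thesis
    proof cases
      case 1
      then show ?thesis using linear_0[OF linear_twist] by simp
    next
      case 2
      then show ?thesis by (simp add: twist_def vec_eq_iff)
    next
      case 3
      then have "l' \<noteq> i" using c(2,3) by (auto simp: e1_def e2_def)
      then show ?thesis using 3 by (simp add: twist_def vec_eq_iff axis_def)
    qed
  qed
  show False
  proof (rule no_equivariant_frame[where I = I and W = "UNIV :: ((real ^ 3) \<times> (real ^ 'n)) set"
        and a = "\<lambda>z. M z e1" and b = "\<lambda>z. M z e2" and c = "\<lambda>c z. M z c"])
    show "finite I" by (simp add: I_def)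
    show "I \<noteq> {}" using cI by auto
    show "dim (UNIV :: ((real ^ 3) \<times> (real ^ 'n)) set) = card I + 2" using cI card by simp
    fix z :: "complex ^ 2" assume z: "norm z = 1"
    note lM = linM[OF nz[OF z]]
    show "\<alpha> = 0 \<and> \<beta> = 0 \<and> (\<forall>i\<in>I. \<gamma> i = 0)"
      if "\<alpha> *\<^sub>R M z e1 + \<beta> *\<^sub>R M z e2 + (\<Sum>c\<in>I. \<gamma> c *\<^sub>R M z c) = 0" for \<alpha> \<beta> \<gamma>
    proof -
      define \<kappa> where "\<kappa> c = (if c = e1 then \<alpha> else if c = e2 then \<beta> else \<gamma> c)" for c
      have "M z (\<alpha> *\<^sub>R e1 + \<beta> *\<^sub>R e2 + (\<Sum>c\<in>I. \<gamma> c *\<^sub>R c)) = 0"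
        using that by (simp add: linear_add[OF lM] linear_cmul[OF lM] linear_sum[OF lM])
      then have "\<alpha> *\<^sub>R e1 + \<beta> *\<^sub>R e2 + (\<Sum>c\<in>I. \<gamma> c *\<^sub>R c) = 0" by (rule injM[OF z])
      moreover have "finite I" "e1 \<notin> I" "e2 \<notin> I" and BI: "Basis = insert e1 (insert e2 I)"
        using e12 by (auto simp: I_def)
      then have "(\<Sum>c\<in>Basis. \<kappa> c *\<^sub>R c) = \<kappa> e1 *\<^sub>R e1 + (\<kappa> e2 *\<^sub>R e2 + (\<Sum>c\<in>I. \<kappa> c *\<^sub>R c))"
        unfolding BI using e12(3) by simp
      moreover have "(\<Sum>c\<in>I. \<kappa> c *\<^sub>R c) = (\<Sum>c\<in>I. \<gamma> c *\<^sub>R c)"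
        by (intro sum.cong) (auto simp: \<kappa>_def I_def)
      ultimately have "(\<Sum>c\<in>Basis. \<kappa> c *\<^sub>R c) = 0" using e12(3) by (simp add: \<kappa>_def add.assoc)
      then have "\<kappa> c = 0" if "c \<in> Basis" for c
        using inner_sum_left_Basis[OF that, of \<kappa>] by simp
      then have "\<kappa> e1 = 0" "\<kappa> e2 = 0" "\<And>c. c \<in> I \<Longrightarrow> \<kappa> c = 0" using e12 by (auto simp: I_def)
      then show ?thesis using e12(3) by (auto simp: \<kappa>_def I_def split: if_splits)
    qed
    fix t assume t: "cmod t = 1"
    have tt: "t * cnj t = 1" using cpow_unit_cancel[OF t, of 1] by simp
    have tw: "(axis i u, 0) = twist ?w t (axis i (cnj t * u), 0 :: real ^ 'm)" for u
      using tt by (simp add: twist_def vec_eq_iff axis_def mult.assoc[symmetric])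
    \<comment> \<open>Transferring the rotation from the vector to the point conjugates
      \<open>t\<close>; this produces the signs demanded of the rotating pair.\<close>
    have M_axis: "M (t *s z) (0, axis i u, 0) = M z (0, axis i (cnj t * u), 0)" for u
      by (subst tw) (rule eqM[OF z t])
    have "(0, axis i (cnj t * 1), 0) = Re t *\<^sub>R e1 - Im t *\<^sub>R e2"
      by (simp add: e1_def e2_def vec_eq_iff axis_def complex_eq_iff zero_prod_def)
    then show "M (t *s z) e1 = Re t *\<^sub>R M z e1 - Im t *\<^sub>R M z e2"
      using M_axis[of 1] by (simp add: linear_diff[OF lM] linear_cmul[OF lM] flip: e1_def)
    have "(0, axis i (cnj t * \<i>), 0) = Im t *\<^sub>R e1 + Re t *\<^sub>R e2"
      by (simp add: e1_def e2_def vec_eq_iff axis_def complex_eq_iff zero_prod_def)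
    then show "M (t *s z) e2 = Im t *\<^sub>R M z e1 + Re t *\<^sub>R M z e2"
      using M_axis[of \<i>] by (simp add: linear_add[OF lM] linear_cmul[OF lM] flip: e2_def)
    show "M (t *s z) c = M z c" if "c \<in> I" for c
      using eqM[OF z t, of "fst c" "snd c"] fixed[OF that] by simp
  qed (use sM in auto)
qed

text \<open>The conjunct that \<open>B 1\<close> is not the product matters for even
  \<open>k1\<close>, where all the bundles are diffeomorphic to the product and the second type does
  not occur.\<close>

theorem corollary4p13:
  fixes k1 k2 :: nat and \<rho> :: int
  assumes "CARD('k::finite) = k1" and "CARD('m::finite) = 2 * k2 + 1"
    and "CARD('n::finite) = 2 * k1 + 2 * k2 + 1"
    and "k1 \<ge> 1" and "k2 \<ge> 0" and "2 * k1 + 2 * k2 > 2"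
  shows
    "let B = sphere_bundle TYPE('k) TYPE('m); P = S2_times_sphere TYPE('n) in
       diffeomorphic (B 0) P \<and>
       (diffeomorphic (B \<rho>) (B 0) \<longleftrightarrow> even k1 \<or> even \<rho>) \<and>
       (diffeomorphic (B \<rho>) (B 1) \<and> \<not> diffeomorphic (B 1) P \<longleftrightarrow> odd k1 \<and> odd \<rho>)"
proof -
  let ?B = "sphere_bundle TYPE('k) TYPE('m)" and ?P = "S2_times_sphere TYPE('n)"
  have card: "CARD('n) = 2 * CARD('k) + CARD('m)" using assms(1-3) by simp
  \<comment> \<open>If \<open>k1 = 1\<close>, the bound forces \<open>k2 \<ge> 1\<close>, hence at
    least three real coordinates.\<close>
  have big: "CARD('k) \<ge> 2 \<or> CARD('m) \<ge> 3" using assms(1,2,4-6) by auto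
  note pB = presents_sphere_bundle[where 'k = 'k and 'm = 'm] and pP = presents_S2_times_sphere[where 'n = 'n]
  have trivial: "diffeomorphic (?B 0) ?P" by (rule diffeomorphic_trivial_bundle[OF card])
  have same: "diffeomorphic (?B \<sigma>) (?B \<tau>)" if "even (int k1 * \<sigma>) \<longleftrightarrow> even (int k1 * \<tau>)" for \<sigma> \<tau>
  proof (rule diffeomorphic_of_gauge_equiv)
    obtain i :: 'k where True by blast
    \<comment> \<open>Both bundles are brought to the normal form of the first; equal parity is what
      makes it reachable from the second.\<close>
    let ?c = "int k1 * \<sigma>"
    have "gauge_equiv (twist (\<lambda>_. \<sigma>) :: _ \<Rightarrow> ('k, 'm) fibre \<Rightarrow> _) (twist (\<lambda>l. if l = i then ?c else 0))"
      "gauge_equiv (twist (\<lambda>_. \<tau>) :: _ \<Rightarrow> ('k, 'm) fibre \<Rightarrow> _) (twist (\<lambda>l. if l = i then ?c else 0))"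
      by (rule gauge_normal_form[OF big]; use that assms(1) in auto)+
    then show "gauge_equiv (twist (\<lambda>_. \<sigma>) :: _ \<Rightarrow> ('k, 'm) fibre \<Rightarrow> _) (twist (\<lambda>_. \<tau>))"
      using gauge_equiv_trans gauge_equiv_sym by blast
  qed
  have distinct: "\<not> diffeomorphic (?B \<sigma>) ?P" if "odd (int k1 * \<sigma>)" for \<sigma>
    using sphere_bundle_not_product[OF card big, of \<sigma>] that assms(1) by simp
  have product_iff: "diffeomorphic (?B \<sigma>) ?P \<longleftrightarrow> even (int k1 * \<sigma>)" for \<sigma>
    using distinct[of \<sigma>] same[of \<sigma> 0] presents_diffeomorphic_trans[OF pB pB pP _ trivial] by auto
  have "diffeomorphic (?B \<rho>) (?B 0) \<longleftrightarrow> even (int k1 * \<rho>)"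
    using same[of \<rho> 0] product_iff[of \<rho>] presents_diffeomorphic_trans[OF pB pB pP _ trivial] by auto
  moreover have "diffeomorphic (?B \<rho>) (?B 1) \<and> \<not> diffeomorphic (?B 1) ?P \<longleftrightarrow> odd k1 \<and> odd \<rho>"
  proof
    assume l: "diffeomorphic (?B \<rho>) (?B 1) \<and> \<not> diffeomorphic (?B 1) ?P"
    have "\<not> diffeomorphic (?B \<rho>) ?P"
      using presents_diffeomorphic_trans[OF pB pB pP diffeomorphic_sym] l by blast
    then show "odd k1 \<and> odd \<rho>" using product_iff by simp
  qed (use same[of \<rho> 1] product_iff in simp)
  ultimately show ?thesis using trivial by (simp add: Let_def)
qed

end
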